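(* Let $k/\mathbb{Q}$ be a Galois CM extension with group $G$, $p$ a prime, fix an embedding $k\subset\mathbb{C}$, and for each infinite place $v$ choose $\sigma_v\in G$ inducing $v$ after composition with $k\subset\mathbb{C}$. Let $C=T_k/\overline{\alpha_{p,\infty}(E_p(k))}^0$, where $^0$ denotes the connected component of zero of the closure, and identify its Pontrjagin dual $\hat C$ with a subgroup of $\bigoplus_{v|\infty}\mathbb{Z}$ via the isomorphism $\bigoplus_{v|\infty}\mathbb{Z}\cong\hat T_k$, $\mu\mapsto\chi_\mu$, $\chi_\mu(t)=\prod_{v|\infty}\exp(\mu_v\,\sigma_v t_v)$. Then $$\hat C=\Big\{\mu\in\bigoplus_{v|\infty}\mathbb{Z}:\ \langle\mu,\varepsilon_{\mathfrak{p},\mathfrak{p}'}\rangle=0\text{ for all }\mathfrak{p},\mathfrak{p}'\in S\Big\}.$$ Moreover $\dim\overline{\alpha_{p,\infty}(E_p(k))}$ equals the dimension of the $\mathbb{Q}$-span of the elements $\varepsilon_{\mathfrak{p},\mathfrak{p}'}$, $\mathfrak{p},\mathfrak{p}'\in S$, in $\bigoplus_{v|\infty}\mathbb{Q}$. In particular, $\alpha_{p,\infty}(E_p(k))$ is dense in $T_k$ if $p$ is completely decomposed in $k$.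
   Context: $E_p(k)$ is the group of $x\in k^*$ with $\|x\|_v=1$ for all places $v\nmid p$ (including infinite places). $c$ is complex conjugation on $k$. All infinite places $v$ are complex; $\mathbb{R}(1)_v=\{z\in k_v:\mathrm{Re}\,z=0\}$, $\mathbb{Z}(1)_v$ the image of $2\pi i\mathbb{Z}$ in $k_v$; $T_k=\bigoplus_{v|\infty}\mathbb{R}(1)_v/\mathbb{Z}(1)_v$, a real torus of dimension $\frac12[k:\mathbb{Q}]$, and $\alpha_{p,\infty}:E_p(k)\to T_k$, $x\mapsto(\log_v x_v)_{v|\infty}$ with $\log_v$ the complex logarithm. In $\chi_\mu$, $\sigma_v$ denotes the isomorphism $\mathbb{R}(1)_v/\mathbb{Z}(1)_v\to i\mathbb{R}/2\pi i\mathbb{Z}$ induced by $\sigma_v:k_v\cong\mathbb{C}$. ${\mathcal T}$ is the set of primes $\mathfrak{p}\mid p$ of $k$ with $\mathfrak{p}^c\neq\mathfrak{p}$, and $S\subset{\mathcal T}$ a system of representatives of ${\mathcal T}$ under complex conjugation. For $\mathfrak{p},\mathfrak{p}'\in{\mathcal T}$, $\varepsilon_{\mathfrak{p},\mathfrak{p}'}\in\bigoplus_{v|\infty}\mathbb{Q}$ is the function on infinite places with $\varepsilon_{\mathfrak{p},\mathfrak{p}'}(v)=1$ if $\sigma_v\mathfrak{p}=\mathfrak{p}'$, $=-1$ if $\sigma_v\mathfrak{p}=c\mathfrak{p}'$, and $=0$ otherwise. $\langle\sum a_v v,\sum b_v v\rangle=\sum a_vb_v$. *)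

theory Defs
  imports "HOL-Analysis.Analysis" "HOL-Computational_Algebra.Polynomial"
begin

definition qscale :: "rat \<Rightarrow> complex \<Rightarrow> complex" where
  "qscale q z = of_rat q * z"

definition subfield_C :: "complex set \<Rightarrow> bool" where
  "subfield_C k \<longleftrightarrow> 0 \<in> k \<and> 1 \<in> k \<and>
     (\<forall>x\<in>k. \<forall>y\<in>k. x + y \<in> k \<and> x * y \<in> k) \<and>
     (\<forall>x\<in>k. - x \<in> k \<and> inverse x \<in> k)"

definition number_field :: "complex set \<Rightarrow> bool" where
  "number_field k \<longleftrightarrow> subfield_C k \<and>
     (\<exists>B. finite B \<and> B \<subseteq> k \<and> k \<subseteq> module.span qscale B)"

definition nf_degree :: "complex set \<Rightarrow> nat" where
  "nf_degree k = vector_space.dim qscale k"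

definition nf_auts :: "complex set \<Rightarrow> (complex \<Rightarrow> complex) set" where
  "nf_auts k = {\<sigma>. \<sigma> ` k = k \<and> (\<forall>x\<in>k. \<forall>y\<in>k. \<sigma> (x + y) = \<sigma> x + \<sigma> y \<and> \<sigma> (x * y) = \<sigma> x * \<sigma> y)
      \<and> \<sigma> 1 = 1 \<and> (\<forall>x. x \<notin> k \<longrightarrow> \<sigma> x = x)}"

definition galois_nf :: "complex set \<Rightarrow> bool" where
  "galois_nf k \<longleftrightarrow> number_field k \<and> card (nf_auts k) = nf_degree k"

text \<open>CM field: totally imaginary quadratic extension of a totally real subfield.
  (Embeddings of a Galois field into C are exactly the automorphisms.)\<close>
definition CM_galois :: "complex set \<Rightarrow> bool" where
  "CM_galois k \<longleftrightarrow> galois_nf k \<and>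
     (\<forall>\<sigma>\<in>nf_auts k. \<exists>x\<in>k. \<sigma> x \<notin> \<real>) \<and>
     (\<exists>kp. subfield_C kp \<and> kp \<subseteq> k \<and> (\<forall>\<sigma>\<in>nf_auts k. \<sigma> ` kp \<subseteq> \<real>) \<and>
           nf_degree k = 2 * nf_degree kp)"

definition conj_aut :: "complex set \<Rightarrow> (complex \<Rightarrow> complex) \<Rightarrow> (complex \<Rightarrow> complex)" where
  "conj_aut k \<sigma> = (\<lambda>x. if x \<in> k then cnj (\<sigma> x) else x)"

definition ring_of_integers :: "complex set \<Rightarrow> complex set" where
  "ring_of_integers k = {x\<in>k. algebraic_int x}"

definition nz_prime_ideal :: "complex set \<Rightarrow> complex set \<Rightarrow> bool" where
  "nz_prime_ideal k P \<longleftrightarrow> (let R = ring_of_integers k in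
     P \<subseteq> R \<and> 0 \<in> P \<and> P \<noteq> {0} \<and> P \<noteq> R \<and>
     (\<forall>x\<in>P. \<forall>y\<in>P. x + y \<in> P) \<and> (\<forall>a\<in>R. \<forall>x\<in>P. a * x \<in> P) \<and>
     (\<forall>a\<in>R. \<forall>b\<in>R. a * b \<in> P \<longrightarrow> a \<in> P \<or> b \<in> P))"

definition primes_above :: "complex set \<Rightarrow> nat \<Rightarrow> complex set set" where
  "primes_above k p = {P. nz_prime_ideal k P \<and> of_nat p \<in> P}"

text \<open>Local ring of O_k at P; x has P-adic absolute value 1 iff x and 1/x lie in it.\<close>
definition loc_ring :: "complex set \<Rightarrow> complex set \<Rightarrow> complex set" where
  "loc_ring k P = {a / b | a b. a \<in> ring_of_integers k \<and> b \<in> ring_of_integers k \<and> b \<notin> P}"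

text \<open>E_p(k): norm 1 at all places not above p, including all infinite places
  (the infinite places are given by x \<mapsto> |\<sigma> x| for \<sigma> in the Galois group).\<close>
definition E_p :: "complex set \<Rightarrow> nat \<Rightarrow> complex set" where
  "E_p k p = {x\<in>k. x \<noteq> 0 \<and>
      (\<forall>P. nz_prime_ideal k P \<and> of_nat p \<notin> P \<longrightarrow> x \<in> loc_ring k P \<and> inverse x \<in> loc_ring k P) \<and>
      (\<forall>\<sigma>\<in>nf_auts k. cmod (\<sigma> x) = 1)}"

definition T_primes :: "complex set \<Rightarrow> nat \<Rightarrow> complex set set" where
  "T_primes k p = {P\<in>primes_above k p. cnj ` P \<noteq> P}"

text \<open>sig :: 'v \<Rightarrow> aut: sig v = \<sigma>_v; the infinite places are indexed by the
  finite type 'v; sig picks exactly one of \<sigma>, c\<sigma> for every \<sigma> in G.\<close>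
definition place_reps :: "complex set \<Rightarrow> ('v \<Rightarrow> (complex \<Rightarrow> complex)) \<Rightarrow> bool" where
  "place_reps k sig \<longleftrightarrow> inj sig \<and> range sig \<subseteq> nf_auts k \<and>
     (\<forall>v w. sig w \<noteq> conj_aut k (sig v)) \<and>
     (\<forall>\<sigma>\<in>nf_auts k. \<exists>v. \<sigma> = sig v \<or> \<sigma> = conj_aut k (sig v))"

text \<open>T_k is identified with the compact torus (S^1)^'v via the exponential:
  the class of t_v in R(1)_v/Z(1)_v corresponds to exp(\<sigma>_v t_v).\<close>
definition torus :: "(complex ^ 'v) set" where
  "torus = {t. \<forall>v. cmod (t $ v) = 1}"

text \<open>alpha_{p,\<infinity>}(x), transported along exp: coordinate v is exp(Log(\<sigma>_v x)) = \<sigma>_v x.\<close>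
definition alpha_inf :: "('v \<Rightarrow> (complex \<Rightarrow> complex)) \<Rightarrow> complex \<Rightarrow> complex ^ 'v" where
  "alpha_inf sig x = (\<chi> v. exp (Ln (sig v x)))"

text \<open>Character chi_mu(t) = prod_v exp(mu_v \<sigma>_v t_v), on the exp-model.\<close>
definition char_mu :: "int ^ 'v \<Rightarrow> complex ^ 'v \<Rightarrow> complex" where
  "char_mu \<mu> t = (\<Prod>v\<in>UNIV. (t $ v) powi (\<mu> $ v))"

definition lie_alg :: "(complex ^ 'v) set \<Rightarrow> (real ^ 'v) set" where
  "lie_alg H = {w. \<forall>s::real. (\<chi> v. exp (\<i> * of_real (s * w $ v))) \<in> H}"

definition lie_dim :: "(complex ^ 'v::finite) set \<Rightarrow> nat" where
  "lie_dim H = dim (lie_alg H)"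

definition eps :: "complex set \<Rightarrow> ('v \<Rightarrow> (complex \<Rightarrow> complex)) \<Rightarrow> complex set \<Rightarrow> complex set \<Rightarrow> rat ^ 'v" where
  "eps k sig P P' = (\<chi> v. if sig v ` P = P' then 1 else if sig v ` P = cnj ` P' then -1 else 0)"

definition rat_span_dim :: "(rat ^ 'v) set \<Rightarrow> nat" where
  "rat_span_dim X = vector_space.dim (\<lambda>(c::rat) x. c *s x) X"

definition completely_decomposed :: "complex set \<Rightarrow> nat \<Rightarrow> bool" where
  "completely_decomposed k p \<longleftrightarrow> card (primes_above k p) = nf_degree k"

end

theory Submission
  imports "Jordan_Normal_Form.Char_Poly" Defs
begin

text \<open>Two ingredients are combined. First, a closed subgroup of a torus is the intersection of the kernels
  of the characters trivial on it (approximate a separating function by a trigonometric polynomial and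
  average over the subgroup). Hence, if the characters \<open>\<mu>\<close> taking finitely many values on the subgroup
  \<open>A\<close> are those orthogonal to a set \<open>E\<close> of rational vectors, then the Lie algebra of the closure of \<open>A\<close>
  is the real span of \<open>E\<close>, and a character is trivial on the identity component iff it is orthogonal to \<open>E\<close>.

  Second, for \<open>x\<close> in \<open>E_p\<close> the value of \<open>\<mu>\<close> at the image of \<open>x\<close> is again an element \<open>y\<close> of \<open>E_p\<close>. Its
  order at a prime \<open>P'\<close> in \<open>S\<close> is the sum over \<open>P\<close> in \<open>S\<close> of \<open>ord_P x\<close> times \<open>\<langle>\<mu>, \<epsilon>\<^bsub>P,P'\<^esub>\<rangle>\<close>, because \<open>cnj x = 1 / x\<close>
  makes orders at conjugate primes opposite. If all pairings vanish, \<open>y\<close> is an algebraic integer all of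
  whose conjugates have absolute value 1, and there are only finitely many such. Conversely, finiteness
  of the class group provides \<open>b\<close> generating a power of \<open>P\<close>, and \<open>b / cnj b\<close> in \<open>E_p\<close> has nonzero order
  exactly at \<open>P\<close> and its conjugate, which isolates each pairing. The number theory rests on pigeonhole arguments:
  an element of the ring of integers whose conjugates are all smaller than 1 in absolute value vanishes.\<close>

section \<open>Algebraic integers form a ring\<close>

text \<open>A torus character evaluated at the image of \<open>x\<close> is a product of integer
  powers of conjugates of \<open>x\<close>. Since the automorphisms map \<open>k\<close> to itself,
  this value is again a number in \<open>k\<close>, which is what turns a question about a closure
  in a real torus into one about orders at primes.

  The two arithmetic facts do not match exactly: a character trivial on \<open>A\<close> is
  orthogonal to \<open>E\<close>, but one orthogonal to \<open>E\<close> is only known to take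
  finitely many values on \<open>A\<close>, which are then roots of unity. Connectedness absorbs
  this finite ambiguity: a continuous function with finitely many values is constant on the identity
  component and on every one-parameter subgroup. Finite averages of translates take the place of
  Haar measure.

  Primes fixed by conjugation never contribute, because the order of an element of
  \<open>E_p k p\<close> there equals its own negative. If \<open>p\<close> is completely
  decomposed, the Galois group permutes the primes above \<open>p\<close> freely; every place
  \<open>v\<close> is then isolated by a vector in \<open>E\<close> whose only nonzero entry is at
  \<open>v\<close>, so only the zero character is orthogonal to \<open>E\<close>.\<close>

no_notation vec_index (infixl "$" 100)

context
begin

interpretation zmod: Modules.module "\<lambda>(c::int) (z::complex). of_int c * z"
  by unfold_locales (auto simp: algebra_simps)

text \<open>Expanding each \<open>z * w\<close> over the generators gives an integer matrix for
  which the list of generators is an eigenvector with eigenvalue \<open>z\<close>. Hence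
  \<open>z\<close> is a root of a monic integer polynomial, the characteristic polynomial. The
  element \<open>w0\<close> makes the eigenvector nonzero.\<close>

lemma algebraic_int_if_stabilizes_fg:
  assumes fin: "finite W" and w0: "w0 \<in> W" "w0 \<noteq> 0"
    and stab: "\<And>w. w \<in> W \<Longrightarrow> z * w \<in> zmod.span W"
  shows "algebraic_int z"
proof -
  obtain f :: "nat \<Rightarrow> complex" where f: "bij_betw f {0..<card W} W"
    using fin ex_bij_betw_nat_finite by blast
  let ?n = "card W"
  have "\<exists>c. z * w = (\<Sum>w'\<in>W. of_int (c w') * w')" if "w \<in> W" for w
    using stab[OF that] unfolding zmod.span_finite[OF fin] by auto
  then obtain c where c: "\<And>w. w \<in> W \<Longrightarrow> z * w = (\<Sum>w'\<in>W. of_int (c w w') * w')"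
    by metis
  define B :: "int Matrix.mat" where "B = Matrix.mat ?n ?n (\<lambda>(i,j). c (f i) (f j))"
  define A :: "complex Matrix.mat" where "A = map_mat of_int B"
  define v where "v = Matrix.vec ?n f"
  have B: "B \<in> carrier_mat ?n ?n" by (simp add: B_def)
  have A: "A \<in> carrier_mat ?n ?n" by (simp add: A_def B)
  have v: "v \<in> carrier_vec ?n" by (simp add: v_def)
  obtain i0 where i0: "i0 < ?n" "f i0 = w0"
    using bij_betw_imp_surj_on[OF f] w0(1) by (metis atLeastLessThan_iff imageE)
  have "v \<noteq> 0\<^sub>v ?n"
  proof
    assume "v = 0\<^sub>v ?n"
    then have "vec_index v i0 = 0" using i0 by simp
    then show False using i0 w0 by (simp add: v_def)
  qed
  moreover have "A *\<^sub>v v = z \<cdot>\<^sub>v v"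
  proof (rule eq_vecI)
    fix i assume "i < dim_vec (z \<cdot>\<^sub>v v)"
    then have i: "i < ?n" by (simp add: v_def)
    then have fi: "f i \<in> W" using f by (auto simp: bij_betw_def)
    have "vec_index (A *\<^sub>v v) i = (\<Sum>j\<in>{0..<?n}. of_int (c (f i) (f j)) * f j)"
      using i by (simp add: A_def B_def v_def scalar_prod_def)
    also have "\<dots> = (\<Sum>w'\<in>W. of_int (c (f i) w') * w')"
      by (rule sum.reindex_bij_betw[OF f])
    also have "\<dots> = z * f i" using c[OF fi] by simp
    finally show "vec_index (A *\<^sub>v v) i = vec_index (z \<cdot>\<^sub>v v) i"
      using i by (simp add: v_def)
  qed (simp add: A_def B_def v_def)
  ultimately have "eigenvalue A z"
    unfolding eigenvalue_def eigenvector_def using A v by auto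
  then have "poly (char_poly A) z = 0" using eigenvalue_root_char_poly[OF A] by simp
  moreover have "char_poly A = map_poly of_int (char_poly B)"
    unfolding A_def by (rule of_int_hom.char_poly_hom[OF B])
  moreover have "lead_coeff (char_poly B) = 1"
    using degree_monic_char_poly[OF B] by auto
  ultimately show ?thesis
    by (auto simp: algebraic_int_altdef_ipoly)
qed

lemma algebraic_int_power_reduce:
  assumes "algebraic_int x"
  obtains m where "m > 0" "x ^ m \<in> zmod.span ((\<lambda>i. x ^ i) ` {..<m})"
proof -
  obtain p where p: "poly (map_poly of_int p) x = 0" "lead_coeff p = 1"
    using assms by (auto simp: algebraic_int_altdef_ipoly)
  define m where "m = degree p"
  have "m > 0"
    using p by (intro Nat.gr0I) (auto simp: m_def elim!: degree_eq_zeroE)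
  have "(\<Sum>i\<le>m. of_int (coeff p i) * x ^ i) = 0"
    using p(1) by (simp add: poly_altdef m_def degree_map_poly coeff_map_poly)
  then have "x ^ m = - (\<Sum>i<m. of_int (coeff p i) * x ^ i)"
    using p(2) by (simp add: lessThan_Suc_atMost[symmetric] m_def add_eq_0_iff)
  also have "\<dots> \<in> zmod.span ((\<lambda>i. x ^ i) ` {..<m})"
    by (intro zmod.span_neg zmod.span_sum zmod.span_scale zmod.span_base) auto
  finally show thesis using that \<open>m > 0\<close> by blast
qed

lemma algebraic_int_of_power_relation:
  assumes m: "m > 0" and rel: "x ^ m = (\<Sum>i<m. of_int (c i) * x ^ i)"
  shows "algebraic_int (x::complex)"
proof (rule algebraic_int_if_stabilizes_fg)
  let ?W = "(\<lambda>i. x ^ i) ` {..<m}"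
  show "1 \<in> ?W" using m by (force intro: image_eqI[of _ _ 0])
  fix w assume "w \<in> ?W"
  then obtain i where i: "i < m" "w = x ^ i" by auto
  show "x * w \<in> zmod.span ?W"
  proof (cases "Suc i < m")
    case True
    then show ?thesis using i by (intro zmod.span_base) (force intro: image_eqI[of _ _ "Suc i"])
  next
    case False
    then have "x * w = (\<Sum>i<m. of_int (c i) * x ^ i)"
      using i rel by (metis Suc_lessI power_Suc)
    also have "\<dots> \<in> zmod.span ?W"
      by (intro zmod.span_sum zmod.span_scale zmod.span_base) auto
    finally show ?thesis .
  qed
qed auto

text \<open>The monomials \<open>x ^ i * y ^ j\<close> below both degrees generate a group stable
  under \<open>x\<close> and under \<open>y\<close>, hence under their sum and product.\<close>

lemma algebraic_int_plus_times:
  assumes "algebraic_int (x::complex)" "algebraic_int y"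
  shows "algebraic_int (x + y) \<and> algebraic_int (x * y)"
proof -
  obtain m where m: "m > 0" "x ^ m \<in> zmod.span ((\<lambda>i. x ^ i) ` {..<m})"
    using assms(1) by (rule algebraic_int_power_reduce)
  obtain n where n: "n > 0" "y ^ n \<in> zmod.span ((\<lambda>i. y ^ i) ` {..<n})"
    using assms(2) by (rule algebraic_int_power_reduce)
  define W where "W = (\<lambda>(i,j). x ^ i * y ^ j) ` ({..<m} \<times> {..<n})"
  have fin: "finite W" by (simp add: W_def)
  have one: "1 \<in> W" unfolding W_def using m n by (force intro: image_eqI[of _ _ "(0,0)"])
  \<comment> \<open>Multiplication by a fixed \<open>w\<close> is additive, so it suffices to know
    where it sends the generators.\<close>
  have mul: "u * w \<in> zmod.span T'"
    if "u \<in> zmod.span T" "\<And>t. t \<in> T \<Longrightarrow> t * w \<in> zmod.span T'" for u w T T'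
    using that(1)
  proof (induction rule: zmod.span_induct_alt)
    case base then show ?case by (simp add: zmod.span_zero)
  next
    case (step c a b)
    then show ?case using that(2)[of a]
      by (simp add: distrib_right mult.assoc zmod.span_add zmod.span_scale)
  qed
  have xW: "x * w \<in> zmod.span W" if "w \<in> W" for w
  proof -
    obtain i j where ij: "i < m" "j < n" "w = x ^ i * y ^ j" using \<open>w \<in> W\<close> unfolding W_def by auto
    show ?thesis
    proof (cases "Suc i < m")
      case True
      then have "x * w \<in> W" using ij by (force simp: W_def intro: image_eqI[of _ _ "(Suc i,j)"])
      then show ?thesis by (rule zmod.span_base)
    next
      case False
      then have "x * w = x ^ m * y ^ j"
        using ij by (metis Suc_lessI mult.assoc power_Suc)
      also have "\<dots> \<in> zmod.span W"
        using ij by (intro mul[OF m(2)] zmod.span_base) (auto simp: W_def)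
      finally show ?thesis .
    qed
  qed
  have yW: "y * w \<in> zmod.span W" if "w \<in> W" for w
  proof -
    obtain i j where ij: "i < m" "j < n" "w = x ^ i * y ^ j" using \<open>w \<in> W\<close> unfolding W_def by auto
    show ?thesis
    proof (cases "Suc j < n")
      case True
      then have "y * w \<in> W" using ij by (force simp: W_def intro: image_eqI[of _ _ "(i,Suc j)"])
      then show ?thesis by (rule zmod.span_base)
    next
      case False
      then have "y * w = y ^ n * x ^ i"
        using ij by (metis Suc_lessI mult.assoc mult.commute power_Suc)
      also have "\<dots> \<in> zmod.span W"
        using ij by (intro mul[OF n(2)] zmod.span_base) (auto simp: W_def mult.commute)
      finally show ?thesis .
    qed
  qed
  have "algebraic_int (x + y)"
    by (rule algebraic_int_if_stabilizes_fg[OF fin one])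
       (auto simp: distrib_right intro!: zmod.span_add xW yW)
  moreover have "(x * y) * w \<in> zmod.span W" if "w \<in> W" for w
    using mul[OF yW[OF that], of x W] xW by (simp add: mult_ac)
  then have "algebraic_int (x * y)"
    by (intro algebraic_int_if_stabilizes_fg[OF fin one]) auto
  ultimately show ?thesis by blast
qed

end

lemma algebraic_int_plus: "algebraic_int (x::complex) \<Longrightarrow> algebraic_int y \<Longrightarrow> algebraic_int (x + y)"
  and algebraic_int_times: "algebraic_int (x::complex) \<Longrightarrow> algebraic_int y \<Longrightarrow> algebraic_int (x * y)"
  using algebraic_int_plus_times by blast+

section \<open>Galois number fields\<close>

unbundle no m_inv_syntax

section \<open>Linear algebra over the rationals and common denominators\<close>

interpretation qv: Vector_Spaces.vector_space qscale
  by unfold_locales (auto simp: qscale_def algebra_simps of_rat_add of_rat_mult)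

text \<open>Gaussian elimination: an equation either has only zero coefficients or has a pivot
  \<open>u0\<close>, which is eliminated from the other equations and solved for at the end.\<close>

lemma underdetermined_system:
  fixes a :: "'e \<Rightarrow> 'u \<Rightarrow> 'f::field"
  assumes "finite E" "finite U" "card E < card U"
  shows "\<exists>c. (\<exists>u\<in>U. c u \<noteq> 0) \<and> (\<forall>e\<in>E. (\<Sum>u\<in>U. a e u * c u) = 0)"
  using assms
proof (induction E arbitrary: U a rule: finite_induct)
  case empty
  then have "U \<noteq> {}" by auto
  then show ?case by (intro exI[of _ "\<lambda>_. 1"]) auto
next
  case (insert e E)
  show ?case
  proof (cases "\<forall>u\<in>U. a e u = 0")
    case True
    have "card E < card U" using insert by simp
    from insert.IH[OF insert.prems(1) this, of a] True show ?thesis by auto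
  next
    case False
    then obtain u0 where u0: "u0 \<in> U" "a e u0 \<noteq> 0" by auto
    define V where "V = U - {u0}"
    have V: "finite V" "card E < card V" "u0 \<notin> V" "U = insert u0 V"
      using insert u0 by (auto simp: V_def)
    obtain c where c: "\<exists>u\<in>V. c u \<noteq> 0"
      "\<And>e'. e' \<in> E \<Longrightarrow> (\<Sum>u\<in>V. (a e' u - a e' u0 * a e u / a e u0) * c u) = 0"
      using insert.IH[OF V(1,2), of "\<lambda>e' u. a e' u - a e' u0 * a e u / a e u0"] by blast
    define s where "s = (\<Sum>u\<in>V. a e u * c u)"
    define d where "d = c(u0 := - s / a e u0)"
    have dV: "(\<Sum>u\<in>V. a e' u * d u) = (\<Sum>u\<in>V. a e' u * c u)" for e'
      using V(3) by (intro sum.cong) (auto simp: d_def)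
    have "(\<Sum>u\<in>U. a e' u * d u) = 0" if "e' \<in> insert e E" for e'
    proof (cases "e' = e")
      case True
      then show ?thesis using V u0 by (simp add: dV s_def) (simp add: d_def s_def)
    next
      case False
      have "(\<Sum>u\<in>V. a e' u * c u) - a e' u0 / a e u0 * s
          = (\<Sum>u\<in>V. (a e' u - a e' u0 * a e u / a e u0) * c u)"
        by (simp add: s_def left_diff_distrib sum_subtractf sum_distrib_left mult.assoc)
      also have "\<dots> = 0" using c(2) False that by blast
      finally show ?thesis using V u0 by (simp add: dV) (simp add: d_def)
    qed
    moreover have "\<exists>u\<in>U. d u \<noteq> 0" using c(1) V(3,4) by (auto simp: d_def)
    ultimately show ?thesis by blast
  qed
qed

lemma common_denominator:
  assumes "finite I"
  shows "\<exists>D::nat. D > 0 \<and> (\<forall>i\<in>I. \<exists>z::int. of_nat D * r i = (of_int z :: rat))"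
  using assms
proof (induction rule: finite_induct)
  case empty then show ?case by (intro exI[of _ 1]) auto
next
  case (insert j I)
  then obtain D where D: "D > 0" "\<forall>i\<in>I. \<exists>z::int. of_nat D * r i = (of_int z :: rat)" by blast
  obtain a b where ab: "b > 0" "r j = of_int a / of_int b"
    by (cases "r j") (auto simp: Fract_of_int_quotient)
  show ?case
  proof (intro exI[of _ "D * nat b"] conjI ballI)
    show "D * nat b > 0" using D ab by simp
    fix i assume "i \<in> insert j I"
    then consider "i = j" | "i \<in> I" by blast
    then show "\<exists>z::int. of_nat (D * nat b) * r i = (of_int z :: rat)"
    proof cases
      case 1
      then show ?thesis using ab by (intro exI[of _ "int D * a"]) simp
    next
      case 2
      then obtain z where "of_nat D * r i = (of_int z :: rat)" using D by blast
      then show ?thesis using ab by (intro exI[of _ "z * b"]) (simp add: mult_ac)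
    qed
  qed
qed

lemma algebraic_int_diff:
  "algebraic_int (x::complex) \<Longrightarrow> algebraic_int y \<Longrightarrow> algebraic_int (x - y)"
  using algebraic_int_plus[of x "- y"] by simp

locale galois_field =
  fixes k :: "complex set"
  assumes galois: "galois_nf k"
begin

abbreviation G where "G \<equiv> nf_auts k"
abbreviation \<O> where "\<O> \<equiv> ring_of_integers k"

lemma subfield: "subfield_C k"
  using galois by (simp add: galois_nf_def number_field_def)

lemma k_0 [simp, intro]: "0 \<in> k" and k_1 [simp, intro]: "1 \<in> k"
  and k_add [intro]: "x \<in> k \<Longrightarrow> y \<in> k \<Longrightarrow> x + y \<in> k"
  and k_mult [intro]: "x \<in> k \<Longrightarrow> y \<in> k \<Longrightarrow> x * y \<in> k"
  and k_minus [intro]: "x \<in> k \<Longrightarrow> - x \<in> k"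
  and k_inverse [intro]: "x \<in> k \<Longrightarrow> inverse x \<in> k"
  using subfield by (auto simp: subfield_C_def)

lemma k_diff [intro]: "x \<in> k \<Longrightarrow> y \<in> k \<Longrightarrow> x - y \<in> k"
  using k_add[of x "- y"] k_minus[of y] by simp

lemma k_divide [intro]: "x \<in> k \<Longrightarrow> y \<in> k \<Longrightarrow> x / y \<in> k"
  using k_mult[of x "inverse y"] k_inverse[of y] by (simp add: field_simps)

lemma k_power [intro]: "x \<in> k \<Longrightarrow> x ^ n \<in> k"
  by (induction n) auto

lemma k_powi [intro]: "x \<in> k \<Longrightarrow> x powi n \<in> k"
  by (auto simp: power_int_def)

lemma k_of_nat [simp, intro]: "of_nat n \<in> k"
  by (induction n) auto

lemma k_of_int [simp, intro]: "of_int n \<in> k"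
  by (cases n rule: int_cases2) auto

lemma k_of_rat [simp, intro]: "of_rat q \<in> k"
  by (cases q) (auto simp: Fract_of_int_quotient of_rat_divide)

lemma k_sum [intro]: "(\<And>i. i \<in> I \<Longrightarrow> f i \<in> k) \<Longrightarrow> sum f I \<in> k"
  by (induction I rule: infinite_finite_induct) auto

lemma k_prod [intro]: "(\<And>i. i \<in> I \<Longrightarrow> f i \<in> k) \<Longrightarrow> prod f I \<in> k"
  by (induction I rule: infinite_finite_induct) auto

lemma O_k: "x \<in> \<O> \<Longrightarrow> x \<in> k"
  and O_int: "x \<in> \<O> \<Longrightarrow> algebraic_int x"
  by (auto simp: ring_of_integers_def)

lemma O_0 [simp, intro]: "0 \<in> \<O>" and O_1 [simp, intro]: "1 \<in> \<O>"
  and O_of_nat [simp, intro]: "of_nat n \<in> \<O>" and O_of_int [simp, intro]: "of_int z \<in> \<O>"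
  and O_add [intro]: "x \<in> \<O> \<Longrightarrow> y \<in> \<O> \<Longrightarrow> x + y \<in> \<O>"
  and O_mult [intro]: "x \<in> \<O> \<Longrightarrow> y \<in> \<O> \<Longrightarrow> x * y \<in> \<O>"
  and O_minus [intro]: "x \<in> \<O> \<Longrightarrow> - x \<in> \<O>"
  and O_diff [intro]: "x \<in> \<O> \<Longrightarrow> y \<in> \<O> \<Longrightarrow> x - y \<in> \<O>"
  by (auto simp: ring_of_integers_def intro: algebraic_int_plus algebraic_int_times algebraic_int_diff)

lemma O_power [intro]: "x \<in> \<O> \<Longrightarrow> x ^ n \<in> \<O>"
  by (induction n) auto

lemma O_sum [intro]: "(\<And>i. i \<in> I \<Longrightarrow> f i \<in> \<O>) \<Longrightarrow> sum f I \<in> \<O>"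
  by (induction I rule: infinite_finite_induct) auto

lemma O_prod [intro]: "(\<And>i. i \<in> I \<Longrightarrow> f i \<in> \<O>) \<Longrightarrow> prod f I \<in> \<O>"
  by (induction I rule: infinite_finite_induct) auto

lemma aut_k [intro]: "\<sigma> \<in> G \<Longrightarrow> x \<in> k \<Longrightarrow> \<sigma> x \<in> k"
  and aut_add: "\<sigma> \<in> G \<Longrightarrow> x \<in> k \<Longrightarrow> y \<in> k \<Longrightarrow> \<sigma> (x + y) = \<sigma> x + \<sigma> y"
  and aut_mult: "\<sigma> \<in> G \<Longrightarrow> x \<in> k \<Longrightarrow> y \<in> k \<Longrightarrow> \<sigma> (x * y) = \<sigma> x * \<sigma> y"
  and aut_1: "\<sigma> \<in> G \<Longrightarrow> \<sigma> 1 = 1"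
  and aut_outside: "\<sigma> \<in> G \<Longrightarrow> x \<notin> k \<Longrightarrow> \<sigma> x = x"
  and aut_image: "\<sigma> \<in> G \<Longrightarrow> \<sigma> ` k = k"
  by (auto simp: nf_auts_def)

lemma aut_0: "\<sigma> \<in> G \<Longrightarrow> \<sigma> 0 = 0"
  using aut_add[of \<sigma> 0 0] by simp

lemma aut_minus: "\<sigma> \<in> G \<Longrightarrow> x \<in> k \<Longrightarrow> \<sigma> (- x) = - \<sigma> x"
  using aut_add[of \<sigma> x "- x"] aut_0[of \<sigma>] by (auto simp: add_eq_0_iff k_minus)

lemma aut_diff: "\<sigma> \<in> G \<Longrightarrow> x \<in> k \<Longrightarrow> y \<in> k \<Longrightarrow> \<sigma> (x - y) = \<sigma> x - \<sigma> y"
  using aut_add[of \<sigma> x "- y"] aut_minus[of \<sigma> y] by (auto simp: k_minus)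

lemma aut_eq_0: assumes "\<sigma> \<in> G" "x \<in> k" shows "\<sigma> x = 0 \<longleftrightarrow> x = 0"
proof
  assume "\<sigma> x = 0"
  show "x = 0"
  proof (rule ccontr)
    assume "x \<noteq> 0"
    then have "\<sigma> (x * inverse x) = 1" using assms by (simp add: aut_1)
    then show False using aut_mult[of \<sigma> x "inverse x"] assms \<open>\<sigma> x = 0\<close> by auto
  qed
qed (use assms aut_0 in auto)

lemma aut_inverse: assumes "\<sigma> \<in> G" "x \<in> k" shows "\<sigma> (inverse x) = inverse (\<sigma> x)"
proof (cases "x = 0")
  case False
  then have "\<sigma> x * \<sigma> (inverse x) = 1"
    using aut_mult[of \<sigma> x "inverse x"] assms by (auto simp: aut_1)
  then show ?thesis by (simp add: inverse_unique)
qed (use assms aut_0[of \<sigma>] in auto)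

lemma aut_divide: "\<sigma> \<in> G \<Longrightarrow> x \<in> k \<Longrightarrow> y \<in> k \<Longrightarrow> \<sigma> (x / y) = \<sigma> x / \<sigma> y"
  by (simp add: divide_inverse aut_mult aut_inverse k_inverse)

lemma aut_power: "\<sigma> \<in> G \<Longrightarrow> x \<in> k \<Longrightarrow> \<sigma> (x ^ n) = \<sigma> x ^ n"
  by (induction n) (auto simp: aut_1 aut_mult k_power)

lemma aut_powi: "\<sigma> \<in> G \<Longrightarrow> x \<in> k \<Longrightarrow> \<sigma> (x powi n) = \<sigma> x powi n"
  by (auto simp: power_int_def aut_power aut_inverse k_inverse)

lemma aut_of_nat: "\<sigma> \<in> G \<Longrightarrow> \<sigma> (of_nat n) = of_nat n"
  by (induction n) (auto simp: aut_0 aut_1 aut_add)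

lemma aut_of_int: "\<sigma> \<in> G \<Longrightarrow> \<sigma> (of_int n) = of_int n"
  by (cases n rule: int_cases2) (auto simp: aut_of_nat aut_minus)

lemma aut_of_rat: "\<sigma> \<in> G \<Longrightarrow> \<sigma> (of_rat q) = of_rat q"
  by (cases q) (auto simp: Fract_of_int_quotient of_rat_divide aut_divide aut_of_int)

lemma aut_sum: "\<sigma> \<in> G \<Longrightarrow> (\<And>i. i \<in> I \<Longrightarrow> f i \<in> k) \<Longrightarrow> \<sigma> (sum f I) = (\<Sum>i\<in>I. \<sigma> (f i))"
  by (induction I rule: infinite_finite_induct) (auto simp: aut_0 aut_add k_sum)

lemma aut_prod: "\<sigma> \<in> G \<Longrightarrow> (\<And>i. i \<in> I \<Longrightarrow> f i \<in> k) \<Longrightarrow> \<sigma> (prod f I) = (\<Prod>i\<in>I. \<sigma> (f i))"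
  by (induction I rule: infinite_finite_induct) (auto simp: aut_1 aut_mult k_prod)

text \<open>Automorphisms are the identity outside \<open>k\<close>, so they are bijections of all
  complex numbers and \<open>inv\<close> gives their group inverses.\<close>

lemma bij_aut: assumes "\<sigma> \<in> G" shows "bij \<sigma>"
proof (rule bijI)
  show "inj \<sigma>"
  proof (rule injI)
    fix x y assume eq: "\<sigma> x = \<sigma> y"
    show "x = y"
    proof (cases "x \<in> k \<and> y \<in> k")
      case True
      then have "\<sigma> (x - y) = 0" using assms eq by (simp add: aut_diff)
      then show ?thesis using aut_eq_0[of \<sigma> "x - y"] assms True by auto
    next
      case False
      then show ?thesis using assms eq aut_outside[of \<sigma>] aut_k[of \<sigma>] by metis
    qed
  qed
  show "surj \<sigma>"
    using aut_image[OF assms] aut_outside[OF assms] by (metis UNIV_I imageE surj_def)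
qed

lemma id_in_G: "(\<lambda>x. x) \<in> G"
  by (auto simp: nf_auts_def)

lemma comp_in_G: assumes "\<sigma> \<in> G" "\<tau> \<in> G" shows "\<sigma> \<circ> \<tau> \<in> G"
proof -
  have "(\<sigma> \<circ> \<tau>) ` k = k" using assms by (metis aut_image image_comp)
  then show ?thesis
    by (subst nf_auts_def) (use assms in \<open>simp add: aut_k aut_add aut_mult aut_1 aut_outside\<close>)
qed

lemma inv_in_G: assumes "\<sigma> \<in> G" shows "inv \<sigma> \<in> G"
proof -
  have b: "inj \<sigma>" "surj \<sigma>" using bij_aut[OF assms] by (auto simp: bij_def)
  have im: "inv \<sigma> ` k = k" using aut_image[OF assms] b by (metis image_inv_f_f)
  have s: "\<sigma> (inv \<sigma> x) = x" for x using b by (simp add: surj_f_inv_f)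
  have i: "inv \<sigma> x = y" if "\<sigma> y = x" for x y using b that by (simp add: inv_f_eq)
  have kk: "inv \<sigma> x \<in> k" if "x \<in> k" for x using im that by auto
  show ?thesis unfolding nf_auts_def
    using assms by (simp add: im i aut_add aut_mult kk s aut_1 aut_outside)
qed

lemma k_finite_basis: "\<exists>B. finite B \<and> B \<subseteq> k \<and> k \<subseteq> qv.span B"
  using galois by (auto simp: galois_nf_def number_field_def)

lemma card_G: "card G = nf_degree k"
  using galois by (simp add: galois_nf_def)

lemma k_basis_exists:
  assumes "qv.independent A" "A \<subseteq> k"
  obtains B where "A \<subseteq> B" "B \<subseteq> k" "qv.independent B" "k \<subseteq> qv.span B" "finite B" "card B = card G"
proof -
  obtain B where B: "A \<subseteq> B" "B \<subseteq> k" "qv.independent B" "k \<subseteq> qv.span B"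
    using qv.maximal_independent_subset_extend[OF assms(2,1)] by blast
  obtain F where F: "finite F" "k \<subseteq> qv.span F" using k_finite_basis by blast
  have "finite B" using qv.independent_span_bound[OF F(1) B(3)] B(2) F(2) by blast
  moreover have "card B = card G"
    using qv.basis_card_eq_dim[OF B(2,4,3)] by (simp add: card_G nf_degree_def)
  ultimately show thesis using that B by blast
qed

lemma independent_finite_card:
  assumes "qv.independent A" "A \<subseteq> k" shows "finite A \<and> card A \<le> card G"
  using k_basis_exists[OF assms] by (metis card_mono finite_subset)

lemma finite_G: "finite G"
proof -
  have "qv.independent {1::complex}" by simp
  then have "card {1::complex} \<le> card G" using independent_finite_card by blast
  \<comment> \<open>An infinite set has \<open>card\<close> equal to 0, so the lower bound 1 already
    excludes it.\<close>
  then show ?thesis by (metis card.infinite card_1_singleton_iff not_one_le_zero One_nat_def)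
qed

lemma k_rat_combination:
  assumes "finite B" "k \<subseteq> qv.span B" "x \<in> k"
  obtains r where "x = (\<Sum>b\<in>B. of_rat (r b) * b)"
proof -
  have "x \<in> qv.span B" using assms by blast
  then show thesis using that unfolding qv.span_finite[OF assms(1)] by (auto simp: qscale_def)
qed

text \<open>A relation evaluated at \<open>y * x\<close>, minus \<open>\<tau> y\<close> times the
  relation at \<open>x\<close>, no longer involves \<open>\<tau>\<close>. Choosing \<open>y\<close>
  with \<open>\<sigma> y \<noteq> \<tau> y\<close> keeps the coefficient of \<open>\<sigma>\<close>
  visible, so induction forces it to vanish.\<close>

lemma dedekind_independence:
  assumes "finite F" "F \<subseteq> G" "\<And>x. x \<in> k \<Longrightarrow> (\<Sum>\<sigma>\<in>F. c \<sigma> * \<sigma> x) = 0"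
  shows "\<forall>\<sigma>\<in>F. c \<sigma> = 0"
  using assms
proof (induction F arbitrary: c rule: finite_induct)
  case (insert \<tau> F)
  have \<tau>: "\<tau> \<in> G" and F: "F \<subseteq> G" using insert by auto
  have c0: "c \<sigma> = 0" if \<sigma>: "\<sigma> \<in> F" for \<sigma>
  proof -
    have ne: "\<sigma> \<noteq> \<tau>" using that insert by auto
    have "\<exists>y\<in>k. \<sigma> y \<noteq> \<tau> y"
    proof (rule ccontr)
      assume "\<not> (\<exists>y\<in>k. \<sigma> y \<noteq> \<tau> y)"
      then have "\<sigma> = \<tau>" using aut_outside[of \<sigma>] aut_outside[of \<tau>] \<sigma> F \<tau> by (intro ext) (metis subsetD)
      then show False using ne by simp
    qed
    then obtain y where y: "y \<in> k" "\<sigma> y \<noteq> \<tau> y" by blast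
    have "(\<Sum>\<rho>\<in>F. (c \<rho> * (\<rho> y - \<tau> y)) * \<rho> x) = 0" if x: "x \<in> k" for x
    proof -
      have 1: "c \<tau> * \<tau> (y * x) + (\<Sum>\<rho>\<in>F. c \<rho> * \<rho> (y * x)) = 0"
        using insert.prems(2)[of "y * x"] insert.hyps x y by auto
      have 2: "c \<tau> * \<tau> x + (\<Sum>\<rho>\<in>F. c \<rho> * \<rho> x) = 0"
        using insert.prems(2)[of x] insert.hyps x by auto
      have "(\<Sum>\<rho>\<in>F. c \<rho> * \<rho> (y * x)) = (\<Sum>\<rho>\<in>F. c \<rho> * (\<rho> y * \<rho> x))"
        using F x y by (intro sum.cong) (auto simp: aut_mult)
      then have 3: "(\<Sum>\<rho>\<in>F. c \<rho> * (\<rho> y * \<rho> x)) = - (c \<tau> * \<tau> y * \<tau> x)"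
        using 1 x y \<tau> by (simp add: aut_mult add_eq_0_iff2 mult.assoc)
      have "(\<Sum>\<rho>\<in>F. (c \<rho> * (\<rho> y - \<tau> y)) * \<rho> x)
          = (\<Sum>\<rho>\<in>F. c \<rho> * (\<rho> y * \<rho> x)) - \<tau> y * (\<Sum>\<rho>\<in>F. c \<rho> * \<rho> x)"
        by (simp add: sum_distrib_left sum_subtractf[symmetric] algebra_simps)
      also have "(\<Sum>\<rho>\<in>F. c \<rho> * \<rho> x) = - (c \<tau> * \<tau> x)"
        using 2 by (simp add: add_eq_0_iff)
      finally show ?thesis using 3 by simp
    qed
    then have "\<forall>\<rho>\<in>F. c \<rho> * (\<rho> y - \<tau> y) = 0" by (intro insert.IH F)
    then show ?thesis using y \<sigma> by auto
  qed
  moreover have "c \<tau> = 0"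
    using insert.prems(2)[of 1] insert.hyps c0 \<tau> by (simp add: aut_1)
  ultimately show ?case by auto
qed auto

text \<open>If some irrational \<open>a\<close> were fixed, a basis through \<open>1, a\<close> with \<open>a\<close> left out would already
  generate \<open>k\<close> over \<open>\<rat>(a)\<close>, and fewer than \<open>card G\<close> equations would force a relation
  between the automorphisms.\<close>

lemma fixed_field:
  assumes a: "a \<in> k" and fixed: "\<And>\<sigma>. \<sigma> \<in> G \<Longrightarrow> \<sigma> a = a"
  shows "a \<in> \<rat>"
proof (rule ccontr)
  assume nr: "a \<notin> \<rat>"
  have "a \<notin> qv.span {1}"
    using nr by (auto simp: qv.span_singleton qscale_def)
  then have ind: "qv.independent {a, 1}" by (intro qv.independent_insertI) (simp_all add: qv.independent_empty)
  then obtain B where B: "{a, 1} \<subseteq> B" "B \<subseteq> k" "k \<subseteq> qv.span B" "finite B" "card B = card G"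
    using k_basis_exists[OF ind] a by (metis empty_subsetI insert_subset k_1)
  have "card (B - {a}) < card G" using B by (metis card_Diff1_less insert_subset)
  then obtain c where c: "\<exists>\<sigma>\<in>G. c \<sigma> \<noteq> 0" "\<And>b. b \<in> B - {a} \<Longrightarrow> (\<Sum>\<sigma>\<in>G. \<sigma> b * c \<sigma>) = 0"
    using underdetermined_system[of "B - {a}" G "\<lambda>b \<sigma>. \<sigma> b"] B(4) finite_G by auto
  have "a \<noteq> 1" using nr by auto
  then have 1: "(\<Sum>\<sigma>\<in>G. c \<sigma> * \<sigma> 1) = 0" using c(2)[of 1] B by (simp add: mult.commute)
  have "(\<Sum>\<sigma>\<in>G. c \<sigma> * \<sigma> a) = (\<Sum>\<sigma>\<in>G. c \<sigma> * \<sigma> 1) * a"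
    by (simp add: sum_distrib_right fixed aut_1)
  then have cB: "(\<Sum>\<sigma>\<in>G. c \<sigma> * \<sigma> b) = 0" if "b \<in> B" for b
    using 1 c(2)[of b] that by (cases "b = a") (auto simp: mult.commute)
  have "(\<Sum>\<sigma>\<in>G. c \<sigma> * \<sigma> x) = 0" if x: "x \<in> k" for x
  proof -
    obtain r where r: "x = (\<Sum>b\<in>B. of_rat (r b) * b)"
      using k_rat_combination[OF B(4,3) x] .
    have \<sigma>x: "\<sigma> x = (\<Sum>b\<in>B. of_rat (r b) * \<sigma> b)" if "\<sigma> \<in> G" for \<sigma>
      unfolding r using that B(2)
      by (subst aut_sum) (auto simp: aut_mult aut_of_rat intro!: sum.cong)
    have "(\<Sum>\<sigma>\<in>G. c \<sigma> * \<sigma> x) = (\<Sum>\<sigma>\<in>G. \<Sum>b\<in>B. of_rat (r b) * (c \<sigma> * \<sigma> b))"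
    proof (rule sum.cong)
      fix \<sigma> assume "\<sigma> \<in> G"
      from \<sigma>x[OF this] show "c \<sigma> * \<sigma> x = (\<Sum>b\<in>B. of_rat (r b) * (c \<sigma> * \<sigma> b))"
        by (simp add: sum_distrib_left mult.left_commute)
    qed simp
    also have "\<dots> = (\<Sum>b\<in>B. of_rat (r b) * (\<Sum>\<sigma>\<in>G. c \<sigma> * \<sigma> b))"
      by (subst sum.swap) (simp add: sum_distrib_left)
    finally show ?thesis using cB by simp
  qed
  then have "\<forall>\<sigma>\<in>G. c \<sigma> = 0" by (intro dedekind_independence finite_G) auto
  with c(1) show False by blast
qed

lemma aut_algebraic_int:
  assumes "\<sigma> \<in> G" "x \<in> k" "algebraic_int x" shows "algebraic_int (\<sigma> x)"
proof -
  obtain p where p: "poly (map_poly of_int p) x = 0" "lead_coeff p = 1"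
    using assms(3) by (auto simp: algebraic_int_altdef_ipoly)
  have "poly (map_poly of_int p) (\<sigma> x) = \<sigma> (poly (map_poly of_int p) x)"
    using assms by (simp add: poly_altdef degree_map_poly coeff_map_poly aut_sum aut_mult aut_of_int
        aut_power k_mult k_power)
  then show ?thesis using p assms by (auto simp: algebraic_int_altdef_ipoly aut_0)
qed

lemma aut_O [intro]: "\<sigma> \<in> G \<Longrightarrow> x \<in> \<O> \<Longrightarrow> \<sigma> x \<in> \<O>"
  using aut_algebraic_int by (auto simp: ring_of_integers_def)

lemma O_rat: "x \<in> \<O> \<Longrightarrow> x \<in> \<rat> \<Longrightarrow> x \<in> \<int>"
  using rational_algebraic_int_is_int O_int by blast

section \<open>The norm to the rationals\<close>

definition nm :: "complex \<Rightarrow> complex" where "nm x = (\<Prod>\<sigma>\<in>G. \<sigma> x)"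

lemma nm_mult: "x \<in> k \<Longrightarrow> y \<in> k \<Longrightarrow> nm (x * y) = nm x * nm y"
  unfolding nm_def prod.distrib[symmetric] by (intro prod.cong) (auto simp: aut_mult)

lemma nm_eq_0: "x \<in> k \<Longrightarrow> nm x = 0 \<longleftrightarrow> x = 0"
  using finite_G id_in_G by (auto simp: nm_def aut_eq_0 prod_zero_iff)

lemma nm_fixed: assumes "x \<in> k" "\<tau> \<in> G" shows "\<tau> (nm x) = nm x"
proof -
  have b: "\<tau> \<circ> (inv \<tau> \<circ> \<rho>) = \<rho>" "inv \<tau> \<circ> (\<tau> \<circ> \<rho>) = \<rho>" for \<rho> :: "complex \<Rightarrow> complex"
    using bij_aut[OF assms(2)] by (auto simp: fun_eq_iff bij_def surj_f_inv_f)
  have "\<tau> (nm x) = (\<Prod>\<sigma>\<in>G. (\<tau> \<circ> \<sigma>) x)"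
    using assms by (simp add: nm_def aut_prod aut_k)
  also have "\<dots> = nm x" unfolding nm_def
    by (rule prod.reindex_bij_witness[of _ "\<lambda>\<rho>. inv \<tau> \<circ> \<rho>" "\<lambda>\<rho>. \<tau> \<circ> \<rho>"])
       (use assms b comp_in_G inv_in_G in auto)
  finally show ?thesis .
qed

lemma nm_Rats: "x \<in> k \<Longrightarrow> nm x \<in> \<rat>"
  by (intro fixed_field nm_fixed) (auto simp: nm_def)

lemma nm_Ints: "x \<in> \<O> \<Longrightarrow> nm x \<in> \<int>"
  by (intro O_rat nm_Rats) (auto simp: nm_def O_k)

lemma cmod_nm_nat: assumes "x \<in> \<O>" obtains n :: nat where "cmod (nm x) = of_nat n"
proof -
  obtain z where "nm x = of_int z" using nm_Ints[OF assms] by (auto elim: Ints_cases)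
  then show thesis using that[of "nat \<bar>z\<bar>"] by simp
qed

lemma cmod_nm_ge_1: assumes "x \<in> \<O>" "x \<noteq> 0" shows "cmod (nm x) \<ge> 1"
proof -
  obtain n where n: "cmod (nm x) = of_nat n" using cmod_nm_nat assms by blast
  have "nm x \<noteq> 0" using nm_eq_0 assms O_k by blast
  then have "n \<noteq> 0" using n by (metis norm_eq_zero of_nat_0)
  then show ?thesis using n by simp
qed

lemma cmod_nm_less_1:
  assumes "\<And>\<sigma>. \<sigma> \<in> G \<Longrightarrow> cmod (\<sigma> x) < 1" shows "cmod (nm x) < 1"
proof -
  have "cmod (nm x) = (\<Prod>\<sigma>\<in>G. cmod (\<sigma> x))" by (simp add: nm_def prod_norm)
  also have "\<dots> = cmod x * (\<Prod>\<sigma>\<in>G - {\<lambda>x. x}. cmod (\<sigma> x))"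
    using finite_G id_in_G by (subst prod.remove[where x = "\<lambda>x. x"]) auto
  also have "\<dots> \<le> cmod x * 1"
    using assms by (intro mult_left_mono prod_le_1) (auto intro: less_imp_le)
  also have "\<dots> < 1" using assms[OF id_in_G] by simp
  finally show ?thesis .
qed

lemma small_O_eq_0: "x \<in> \<O> \<Longrightarrow> (\<And>\<sigma>. \<sigma> \<in> G \<Longrightarrow> cmod (\<sigma> x) < 1) \<Longrightarrow> x = 0"
  using cmod_nm_ge_1[of x] cmod_nm_less_1[of x] by force

text \<open>The norm of \<open>x\<close> is a nonzero integer, and the conjugates other than
  \<open>x\<close> itself multiply to the cofactor; a sign makes the integer positive. This is how
  nonzero ideals acquire a positive integer.\<close>

lemma O_dvd_nat:
  assumes "x \<in> \<O>" "x \<noteq> 0"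
  obtains n y where "n > 0" "y \<in> \<O>" "of_nat n = x * y"
proof -
  obtain z where z: "nm x = of_int z" using nm_Ints[OF assms(1)] by (auto elim: Ints_cases)
  have z0: "z \<noteq> 0" using nm_eq_0[of x] O_k assms z by auto
  define y where "y = (\<Prod>\<sigma>\<in>G - {\<lambda>x. x}. \<sigma> x)"
  have y: "y \<in> \<O>" unfolding y_def using assms by blast
  have "nm x = x * y" unfolding nm_def y_def
    using finite_G id_in_G by (subst prod.remove[where x = "\<lambda>x. x"]) auto
  then have xy: "x * y = of_int z" using z by simp
  have "of_nat (nat \<bar>z\<bar>) = (of_int (sgn z * z) :: complex)"
    by (simp add: sgn_if)
  then have "of_nat (nat \<bar>z\<bar>) = x * (of_int (sgn z) * y)"
    by (simp add: mult.left_commute xy)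
  then show thesis using z0 y by (intro that[of "nat \<bar>z\<bar>" "of_int (sgn z) * y"]) auto
qed

end

section \<open>Finiteness from bounded conjugates\<close>

context galois_field
begin

text \<open>Independent powers of \<open>x\<close> cannot outnumber the degree. Taking the least
  dependent exponent also makes the lower powers pairwise distinct, so that a combination of the set
  of powers becomes a sum over exponents.\<close>

lemma power_in_span_lower_powers:
  assumes "x \<in> k"
  obtains d r where "d > 0" "x ^ d = (\<Sum>i<d. of_rat (r i) * x ^ i)"
proof -
  let ?W = "\<lambda>d. (\<lambda>i. x ^ i) ` {..<d}"
  have ind: "qv.independent (?W d) \<and> inj_on (\<lambda>i. x ^ i) {..<d}"
    if "\<And>i. i < d \<Longrightarrow> x ^ i \<notin> qv.span (?W i)" for d
    using that
  proof (induction d)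
    case (Suc d)
    then have "x ^ d \<notin> qv.span (?W d)" "qv.independent (?W d)" "inj_on (\<lambda>i. x ^ i) {..<d}" by auto
    moreover from this(1) have "x ^ d \<notin> ?W d" by (metis qv.span_base)
    ultimately show ?case by (auto simp: lessThan_Suc qv.independent_insert)
  qed (auto simp: qv.independent_empty)
  have "\<exists>d. x ^ d \<in> qv.span (?W d)"
  proof (rule ccontr)
    assume "\<nexists>d. x ^ d \<in> qv.span (?W d)"
    then have "qv.independent (?W (Suc (card G))) \<and> inj_on (\<lambda>i. x ^ i) {..<Suc (card G)}"
      by (intro ind) simp
    then have "qv.independent (?W (Suc (card G)))" and inj: "inj_on (\<lambda>i. x ^ i) {..<Suc (card G)}"
      by simp_all
    then have "card (?W (Suc (card G))) \<le> card G"
      using independent_finite_card[of "?W (Suc (card G))"] assms by (simp add: image_subset_iff k_power)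
    then show False using card_image[OF inj] by simp
  qed
  then obtain d where d: "x ^ d \<in> qv.span (?W d)" "\<And>i. i < d \<Longrightarrow> x ^ i \<notin> qv.span (?W i)"
    using exists_least_iff[of "\<lambda>d. x ^ d \<in> qv.span (?W d)"] by blast
  have inj: "inj_on (\<lambda>i. x ^ i) {..<d}" using ind[OF d(2)] by simp
  have "d > 0" using d(1) by (intro Nat.gr0I) auto
  obtain u where "x ^ d = (\<Sum>w\<in>?W d. of_rat (u w) * w)"
    using d(1) by (auto simp: qv.span_finite qscale_def)
  then have "x ^ d = (\<Sum>i<d. of_rat (u (x ^ i)) * x ^ i)"
    by (simp add: sum.reindex[OF inj])
  then show thesis using that[of d "\<lambda>i. u (x ^ i)"] \<open>d > 0\<close> by blast
qed

lemma k_integral_multiple: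
  assumes "x \<in> k"
  obtains D :: nat where "D > 0" "of_nat D * x \<in> \<O>"
proof -
  obtain d r where d: "d > 0" "x ^ d = (\<Sum>i<d. of_rat (r i) * x ^ i)"
    using power_in_span_lower_powers[OF assms] .
  obtain D :: nat where D: "D > 0" "\<And>i. i \<in> {..<d} \<Longrightarrow> \<exists>z::int. of_nat D * r i = (of_int z :: rat)"
    using common_denominator[of "{..<d}" r] by auto
  then obtain z :: "nat \<Rightarrow> int" where z: "\<And>i. i < d \<Longrightarrow> of_nat D * r i = of_int (z i)"
    by (metis lessThan_iff)
  have z': "of_nat D * of_rat (r i) = (of_int (z i) :: complex)" if "i < d" for i
    using arg_cong[OF z[OF that], of "of_rat :: rat \<Rightarrow> complex"] by (simp add: of_rat_mult)
  have "(of_nat D * x) ^ d = (\<Sum>i<d. of_nat D ^ d * (of_rat (r i) * x ^ i))"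
    by (simp add: power_mult_distrib d(2) sum_distrib_left)
  also have "\<dots> = (\<Sum>i<d. of_int (int D ^ (d - Suc i) * z i) * (of_nat D * x) ^ i)"
  proof (rule sum.cong)
    fix i assume "i \<in> {..<d}"
    then have i: "i < d" by simp
    \<comment> \<open>Of the \<open>d\<close> factors \<open>D\<close>, one clears the coefficient
      and \<open>i\<close> of them go into \<open>x ^ i\<close>; since \<open>i < d\<close>, the
      remaining \<open>d - Suc i\<close> are a genuine natural number.\<close>
    have "of_nat D ^ d = (of_nat D ^ (d - Suc i) * of_nat D * of_nat D ^ i :: complex)"
      using i by (metis Suc_leI add_Suc_right le_add_diff_inverse2 mult.assoc power_Suc power_add)
    then have "of_nat D ^ d * (of_rat (r i) * x ^ i)
        = of_nat D ^ (d - Suc i) * (of_nat D * of_rat (r i)) * (of_nat D * x) ^ i"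
      by (simp add: power_mult_distrib mult_ac)
    then show "of_nat D ^ d * (of_rat (r i) * x ^ i)
        = of_int (int D ^ (d - Suc i) * z i) * (of_nat D * x) ^ i"
      unfolding z'[OF i] by simp
  qed simp
  finally have "algebraic_int (of_nat D * x)"
    by (rule algebraic_int_of_power_relation[OF d(1)])
  then show thesis using that D assms by (auto simp: ring_of_integers_def)
qed

lemma integral_spanning_set:
  obtains B where "finite B" "B \<subseteq> \<O>" "k \<subseteq> qv.span B"
proof -
  obtain B where B: "finite B" "B \<subseteq> k" "k \<subseteq> qv.span B" using k_finite_basis by blast
  have "\<forall>b\<in>B. \<exists>D::nat. D > 0 \<and> of_nat D * b \<in> \<O>" using B(2) k_integral_multiple by blast
  then obtain D :: "complex \<Rightarrow> nat" where D: "\<And>b. b \<in> B \<Longrightarrow> D b > 0 \<and> of_nat (D b) * b \<in> \<O>"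
    by metis
  let ?B = "(\<lambda>b. of_nat (D b) * b) ` B"
  have "b \<in> qv.span ?B" if "b \<in> B" for b
  proof -
    have "b = qscale (1 / of_nat (D b)) (of_nat (D b) * b)"
      using D[OF that] by (simp add: qscale_def of_rat_divide)
    also have "\<dots> \<in> qv.span ?B" using that by (intro qv.span_scale qv.span_base) auto
    finally show ?thesis .
  qed
  then have "qv.span B \<subseteq> qv.span ?B" by (intro qv.span_minimal) auto
  then show thesis using that[of ?B] B D by blast
qed

text \<open>Rounding down the rational coordinates over an integral spanning set leaves fractional
  parts in [0, 1), so each conjugate is bounded by the sum of the conjugates of the spanning
  elements. The summand 1 in \<open>C\<close> keeps it positive.\<close>

lemma bounded_representatives:
  obtains C where "C > 0" "\<And>x. x \<in> k \<Longrightarrow> \<exists>w\<in>\<O>. \<forall>\<sigma>\<in>G. cmod (\<sigma> (x - w)) \<le> C"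
proof -
  obtain B where B: "finite B" "B \<subseteq> \<O>" "k \<subseteq> qv.span B" using integral_spanning_set .
  have Bk: "B \<subseteq> k" using B O_k by blast
  define C where "C = 1 + (\<Sum>b\<in>B. \<Sum>\<sigma>\<in>G. cmod (\<sigma> b))"
  have "C > 0" unfolding C_def by (intro add_pos_nonneg sum_nonneg) auto
  moreover have "\<exists>w\<in>\<O>. \<forall>\<sigma>\<in>G. cmod (\<sigma> (x - w)) \<le> C" if x: "x \<in> k" for x
  proof -
    obtain r where r: "x = (\<Sum>b\<in>B. of_rat (r b) * b)"
      using k_rat_combination[OF B(1,3) x] .
    define w where "w = (\<Sum>b\<in>B. of_int \<lfloor>r b\<rfloor> * b)"
    have w: "w \<in> \<O>" unfolding w_def using B(2) by (intro O_sum O_mult) auto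
    have "x - w = (\<Sum>b\<in>B. of_rat (frac (r b)) * b)"
      unfolding r w_def frac_def sum_subtractf[symmetric]
      by (intro sum.cong) (auto simp: of_rat_diff algebra_simps)
    then have "cmod (\<sigma> (x - w)) \<le> C" if "\<sigma> \<in> G" for \<sigma>
    proof -
      assume eq: "x - w = (\<Sum>b\<in>B. of_rat (frac (r b)) * b)"
      have "\<sigma> (x - w) = (\<Sum>b\<in>B. of_rat (frac (r b)) * \<sigma> b)"
        unfolding eq using that Bk
        by (subst aut_sum) (auto simp: aut_mult aut_of_rat intro!: sum.cong)
      also have "cmod \<dots> \<le> (\<Sum>b\<in>B. cmod (of_rat (frac (r b)) * \<sigma> b))" by (rule norm_sum)
      also have "\<dots> \<le> (\<Sum>b\<in>B. \<Sum>\<sigma>\<in>G. cmod (\<sigma> b))"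
      proof (rule sum_mono)
        fix b assume "b \<in> B"
        have "cmod (of_rat (frac (r b))) = \<bar>of_rat (frac (r b)) :: real\<bar>"
          by (cases "frac (r b)") (simp add: of_rat_rat norm_divide)
        also have "\<dots> \<le> 1"
          using frac_ge_0[of "r b"] frac_lt_1[of "r b"] by (simp add: less_imp_le)
        finally have "cmod (of_rat (frac (r b)) * \<sigma> b) \<le> cmod (\<sigma> b)"
          by (simp add: norm_mult mult_left_le_one_le)
        also have "\<dots> \<le> (\<Sum>\<sigma>\<in>G. cmod (\<sigma> b))" using finite_G that by (intro member_le_sum) auto
        finally show "cmod (of_rat (frac (r b)) * \<sigma> b) \<le> (\<Sum>\<sigma>\<in>G. cmod (\<sigma> b))" .
      qed
      finally show ?thesis by (simp add: C_def)
    qed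
    then show ?thesis using w by blast
  qed
  ultimately show thesis using that by blast
qed

text \<open>Boxes for the pigeonhole principle: every conjugate is located in a grid of squares of
  side 1/2. Inside one square, real and imaginary parts differ by less than 1/2 each, hence the
  numbers by less than 1, which is the threshold of \<open>small_O_eq_0\<close>.\<close>

lemma cells:
  obtains F and cell :: "complex \<Rightarrow> (complex \<Rightarrow> complex) \<Rightarrow> int \<times> int"
  where "finite F" "\<And>x. x \<in> k \<Longrightarrow> (\<And>\<sigma>. \<sigma> \<in> G \<Longrightarrow> cmod (\<sigma> x) \<le> C) \<Longrightarrow> cell x \<in> F"
    "\<And>x y \<sigma>. x \<in> k \<Longrightarrow> y \<in> k \<Longrightarrow> cell x = cell y \<Longrightarrow> \<sigma> \<in> G \<Longrightarrow> cmod (\<sigma> (x - y)) < 1"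
proof
  let ?K = "\<lceil>2 * C\<rceil> + 1"
  let ?F = "G \<rightarrow>\<^sub>E ({- ?K..?K} \<times> {- ?K..?K})"
  let ?cell = "\<lambda>x. restrict (\<lambda>\<sigma>. (\<lfloor>2 * Re (\<sigma> x)\<rfloor>, \<lfloor>2 * Im (\<sigma> x)\<rfloor>)) G"
  show "finite ?F" using finite_G by (intro finite_PiE) auto
  have fl: "\<lfloor>2 * t\<rfloor> \<in> {- ?K..?K}" if "\<bar>t\<bar> \<le> C" for t :: real
    using that by (auto simp: abs_le_iff; linarith)
  show "?cell x \<in> ?F" if "x \<in> k" "\<And>\<sigma>. \<sigma> \<in> G \<Longrightarrow> cmod (\<sigma> x) \<le> C" for x
  proof (rule restrict_PiE_iff[THEN iffD2], intro ballI)
    fix \<sigma> assume "\<sigma> \<in> G"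
    then have "cmod (\<sigma> x) \<le> C" using that by blast
    then have "\<bar>Re (\<sigma> x)\<bar> \<le> C" "\<bar>Im (\<sigma> x)\<bar> \<le> C"
      using abs_Re_le_cmod abs_Im_le_cmod order_trans by blast+
    then show "(\<lfloor>2 * Re (\<sigma> x)\<rfloor>, \<lfloor>2 * Im (\<sigma> x)\<rfloor>) \<in> {- ?K..?K} \<times> {- ?K..?K}"
      using fl by blast
  qed
  show "cmod (\<sigma> (x - y)) < 1" if "x \<in> k" "y \<in> k" "?cell x = ?cell y" "\<sigma> \<in> G" for x y \<sigma>
  proof -
    have "?cell x \<sigma> = ?cell y \<sigma>" using that by simp
    then have e: "\<lfloor>2 * Re (\<sigma> x)\<rfloor> = \<lfloor>2 * Re (\<sigma> y)\<rfloor>" "\<lfloor>2 * Im (\<sigma> x)\<rfloor> = \<lfloor>2 * Im (\<sigma> y)\<rfloor>"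
      using that(4) by (simp_all only: restrict_apply' prod.inject)
    have "\<bar>s - t\<bar> < 1 / 2" if "\<lfloor>2 * s\<rfloor> = \<lfloor>2 * t\<rfloor>" for s t :: real
      using that by linarith
    from this[OF e(1)] this[OF e(2)] have "\<bar>Re (\<sigma> (x - y))\<bar> < 1 / 2" "\<bar>Im (\<sigma> (x - y))\<bar> < 1 / 2"
      using that by (simp_all add: aut_diff)
    then show ?thesis using cmod_le[of "\<sigma> (x - y)"] by linarith
  qed
qed

lemma finite_bounded_O: "finite {x \<in> \<O>. \<forall>\<sigma>\<in>G. cmod (\<sigma> x) \<le> C}" (is "finite ?X")
proof -
  obtain F cell where F: "finite F" "\<And>x. x \<in> k \<Longrightarrow> (\<And>\<sigma>. \<sigma> \<in> G \<Longrightarrow> cmod (\<sigma> x) \<le> C) \<Longrightarrow> cell x \<in> F"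
    and cell: "\<And>x y \<sigma>. x \<in> k \<Longrightarrow> y \<in> k \<Longrightarrow> cell x = (cell y :: (complex \<Rightarrow> complex) \<Rightarrow> int \<times> int) \<Longrightarrow> \<sigma> \<in> G \<Longrightarrow> cmod (\<sigma> (x - y)) < 1"
    using cells[of C] by blast
  have "inj_on cell ?X"
  proof (rule inj_onI)
    fix x y assume "x \<in> ?X" "y \<in> ?X" "cell x = cell y"
    then have "x - y = 0" using cell O_k by (intro small_O_eq_0) auto
    then show "x = y" by simp
  qed
  moreover have "cell ` ?X \<subseteq> F" using F(2) O_k by auto
  ultimately show ?thesis using F(1) by (rule inj_on_finite)
qed

text \<open>Subtract a bounded representative from \<open>x / m\<close> and multiply back by
  \<open>m\<close>: the remainder is integral with conjugates at most \<open>m * C\<close>, and such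
  integers are finite in number.\<close>

lemma finite_residues:
  assumes "m > 0"
  obtains R where "finite R" "R \<subseteq> \<O>" "\<And>x. x \<in> \<O> \<Longrightarrow> \<exists>r\<in>R. \<exists>y\<in>\<O>. x = r + of_nat m * y"
proof -
  obtain C where C: "C > 0" "\<And>x. x \<in> k \<Longrightarrow> \<exists>w\<in>\<O>. \<forall>\<sigma>\<in>G. cmod (\<sigma> (x - w)) \<le> C"
    using bounded_representatives by blast
  let ?R = "{x \<in> \<O>. \<forall>\<sigma>\<in>G. cmod (\<sigma> x) \<le> m * C}"
  have "\<exists>r\<in>?R. \<exists>y\<in>\<O>. x = r + of_nat m * y" if x: "x \<in> \<O>" for x
  proof -
    have xm: "x / of_nat m \<in> k" using x O_k by auto
    then obtain w where w: "w \<in> \<O>" "\<And>\<sigma>. \<sigma> \<in> G \<Longrightarrow> cmod (\<sigma> (x / of_nat m - w)) \<le> C"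
      using C(2)[OF xm] by metis
    have eq: "x - of_nat m * w = of_nat m * (x / of_nat m - w)"
      using assms by (simp add: field_simps)
    have "cmod (\<sigma> (x - of_nat m * w)) \<le> m * C" if s: "\<sigma> \<in> G" for \<sigma>
    proof -
      have "\<sigma> (x - of_nat m * w) = of_nat m * \<sigma> (x / of_nat m - w)"
        unfolding eq using s w(1) xm O_k by (subst aut_mult) (auto simp: aut_of_nat)
      then show ?thesis using w(2)[OF s] by (simp add: norm_mult mult_left_mono)
    qed
    then have "x - of_nat m * w \<in> ?R" using x w by auto
    then show ?thesis using w(1) by (intro bexI[of _ "x - of_nat m * w"] bexI[of _ w]) auto
  qed
  then show thesis using that[of ?R] finite_bounded_O by blast
qed

lemma residue_pigeonhole:
  fixes f :: "nat \<Rightarrow> complex"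
  assumes "m > 0" and f: "\<And>i. f i \<in> \<O>"
  obtains i j y where "i < j" "y \<in> \<O>" "f i - f j = of_nat m * y"
proof -
  obtain R where R: "finite R" "R \<subseteq> \<O>" "\<And>x. x \<in> \<O> \<Longrightarrow> \<exists>r\<in>R. \<exists>y\<in>\<O>. x = r + of_nat m * y"
    using finite_residues[OF assms(1)] by blast
  obtain r y where ry: "\<And>i. r i \<in> R" "\<And>i. y i \<in> \<O>" "\<And>i. f i = r i + of_nat m * y i"
    using R(3)[OF f] by metis
  have "\<not> inj r" using R(1) ry(1) by (metis inj_on_finite image_subsetI infinite_UNIV_nat)
  then obtain i j where ij: "i \<noteq> j" "r i = r j" by (auto simp: inj_on_def)
  have "f a - f b = of_nat m * (y a - y b)" if "r a = r b" for a b
    using ry(3)[of a] ry(3)[of b] that by (simp add: algebra_simps)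
  then show thesis using ij that[of i j "y i - y j"] that[of j i "y j - y i"] ry(2)
    by (metis O_diff linorder_neqE_nat)
qed

text \<open>Substitute for Euclidean division. There are more multiples of \<open>a\<close> by 0 up
  to \<open>M\<close> than cells, so two of them, reduced modulo integers, share a cell, and their
  difference is the required approximation. The number of cells, hence \<open>M\<close>, does not
  depend on \<open>a\<close>.\<close>

lemma hurwitz:
  obtains M :: nat where "M > 0"
    "\<And>a. a \<in> k \<Longrightarrow> \<exists>t\<in>{1..M}. \<exists>w\<in>\<O>. \<forall>\<sigma>\<in>G. cmod (\<sigma> (of_nat t * a - w)) < 1"
proof -
  obtain C where C: "\<And>x. x \<in> k \<Longrightarrow> \<exists>w\<in>\<O>. \<forall>\<sigma>\<in>G. cmod (\<sigma> (x - w)) \<le> C"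
    using bounded_representatives by blast
  obtain F cell where F: "finite F" "\<And>x. x \<in> k \<Longrightarrow> (\<And>\<sigma>. \<sigma> \<in> G \<Longrightarrow> cmod (\<sigma> x) \<le> C) \<Longrightarrow> cell x \<in> F"
    and cell: "\<And>x y \<sigma>. x \<in> k \<Longrightarrow> y \<in> k \<Longrightarrow> cell x = (cell y :: (complex \<Rightarrow> complex) \<Rightarrow> int \<times> int) \<Longrightarrow> \<sigma> \<in> G \<Longrightarrow> cmod (\<sigma> (x - y)) < 1"
    using cells[of C] by blast
  let ?M = "Suc (card F)"
  have "\<exists>t\<in>{1..?M}. \<exists>w\<in>\<O>. \<forall>\<sigma>\<in>G. cmod (\<sigma> (of_nat t * a - w)) < 1" if a: "a \<in> k" for a
  proof -
    have "\<forall>t::nat. \<exists>w\<in>\<O>. \<forall>\<sigma>\<in>G. cmod (\<sigma> (of_nat t * a - w)) \<le> C" using C[OF k_mult[OF k_of_nat a]] by simp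
    then obtain w where w: "\<And>t. w t \<in> \<O>" "\<And>t \<sigma>. \<sigma> \<in> G \<Longrightarrow> cmod (\<sigma> (of_nat t * a - w t)) \<le> C"
      by metis
    let ?f = "\<lambda>t. cell (of_nat t * a - w t)"
    have ka: "of_nat t * a - w t \<in> k" for t using a w(1) O_k by blast
    have "?f ` {..?M} \<subseteq> F" by (intro image_subsetI F(2) ka w(2))
    then have "card (?f ` {..?M}) < card {..?M}"
      using F(1) by (metis card_atMost card_mono le_imp_less_Suc le_SucI)
    then have "\<not> inj_on ?f {..?M}" by (rule pigeonhole)
    then have "\<exists>i j. i < j \<and> j \<le> ?M \<and> ?f i = ?f j"
      unfolding inj_on_def by (metis atMost_iff linorder_neqE_nat)
    then obtain i j where ij: "i < j" "j \<le> ?M" "?f i = ?f j" by blast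
    have "of_nat (j - i) * a - (w j - w i) = (of_nat j * a - w j) - (of_nat i * a - w i)"
      using ij(1) by (simp add: of_nat_diff algebra_simps)
    then have "cmod (\<sigma> (of_nat (j - i) * a - (w j - w i))) < 1" if "\<sigma> \<in> G" for \<sigma>
      using cell[OF ka ka ij(3)[symmetric] that] by (simp only:)
    then show ?thesis using ij w(1) by (intro bexI[of _ "j - i"] bexI[of _ "w j - w i"]) auto
  qed
  then show thesis using that[of ?M] by blast
qed

section \<open>Ideals of the ring of integers\<close>

definition O_ideal :: "complex set \<Rightarrow> bool" where
  "O_ideal I \<longleftrightarrow> I \<subseteq> \<O> \<and> 0 \<in> I \<and> (\<forall>x\<in>I. \<forall>y\<in>I. x + y \<in> I) \<and> (\<forall>a\<in>\<O>. \<forall>x\<in>I. a * x \<in> I)"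

lemma O_ideal_diff: "O_ideal I \<Longrightarrow> x \<in> I \<Longrightarrow> y \<in> I \<Longrightarrow> x - y \<in> I"
  unfolding O_ideal_def by (metis O_1 O_minus diff_conv_add_uminus mult_minus1)

text \<open>An ideal containing \<open>m\<close> is a union of residue classes modulo
  \<open>m\<close>, so it is determined by its intersection with the finite residue system
  \<open>R\<close>.\<close>

lemma finite_O_ideals:
  assumes "m > 0" shows "finite {I. O_ideal I \<and> of_nat m \<in> I}" (is "finite ?X")
proof -
  obtain R where R: "finite R" "R \<subseteq> \<O>" "\<And>x. x \<in> \<O> \<Longrightarrow> \<exists>r\<in>R. \<exists>y\<in>\<O>. x = r + of_nat m * y"
    using finite_residues[OF assms] by blast
  have sub: "I \<subseteq> J" if I: "O_ideal I" "of_nat m \<in> I" and J: "O_ideal J" "of_nat m \<in> J"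
    and eq: "I \<inter> R = J \<inter> R" for I J
  proof
    fix x assume x: "x \<in> I"
    then have "x \<in> \<O>" using I by (auto simp: O_ideal_def)
    then obtain r y where ry: "r \<in> R" "y \<in> \<O>" "x = r + of_nat m * y" using R(3) by blast
    have "of_nat m * y \<in> I" using ry(2) I by (metis O_ideal_def mult.commute)
    then have "r \<in> I" using O_ideal_diff[OF I(1) x, of "of_nat m * y"] ry(3) by simp
    then have "r \<in> J" using eq ry by blast
    moreover have "of_nat m * y \<in> J" using ry(2) J by (metis O_ideal_def mult.commute)
    ultimately show "x \<in> J" using J(1) ry(3) by (auto simp: O_ideal_def)
  qed
  have "inj_on (\<lambda>I. I \<inter> R) ?X"
    by (rule inj_onI) (use sub in blast)
  moreover have "(\<lambda>I. I \<inter> R) ` ?X \<subseteq> Pow R" by auto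
  ultimately show ?thesis using R(1) by (meson finite_Pow_iff inj_on_finite)
qed

lemma nz_prime_ideal_iff:
  "nz_prime_ideal k P \<longleftrightarrow> O_ideal P \<and> P \<noteq> {0} \<and> 1 \<notin> P \<and>
     (\<forall>a\<in>\<O>. \<forall>b\<in>\<O>. a * b \<in> P \<longrightarrow> a \<in> P \<or> b \<in> P)" (is "?A \<longleftrightarrow> ?B")
proof -
  have "P = \<O> \<longleftrightarrow> 1 \<in> P" if "O_ideal P"
    using that unfolding O_ideal_def by (metis O_1 mult.right_neutral subsetI subset_antisym)
  then show ?thesis unfolding nz_prime_ideal_def Let_def O_ideal_def by blast
qed

text \<open>A nonzero ideal contains a positive integer, so only finitely many ideals contain it and
  a maximal proper one exists by finiteness. Maximality makes it prime: if \<open>a\<close> and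
  \<open>b\<close> lie outside, each generates 1 together with \<open>P\<close>, and multiplying the
  two expressions puts 1 into \<open>P\<close>.\<close>

lemma prime_ideal_above:
  assumes I: "O_ideal I" "I \<noteq> {0}" "1 \<notin> I"
  obtains P where "nz_prime_ideal k P" "I \<subseteq> P"
proof -
  obtain x where x: "x \<in> I" "x \<noteq> 0" using I by (auto simp: O_ideal_def)
  then have "x \<in> \<O>" using I by (auto simp: O_ideal_def)
  then obtain n y where ny: "n > 0" "y \<in> \<O>" "of_nat n = x * y" using O_dvd_nat x by blast
  then have nI: "of_nat n \<in> I" using I x by (metis O_ideal_def mult.commute)
  let ?X = "{J. O_ideal J \<and> I \<subseteq> J \<and> 1 \<notin> J}"
  have "?X \<subseteq> {J. O_ideal J \<and> of_nat n \<in> J}" using nI by blast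
  then have "finite ?X" using finite_O_ideals[OF ny(1)] finite_subset by blast
  moreover have "I \<in> ?X" using I by blast
  ultimately obtain P where P: "P \<in> ?X" "\<And>J. J \<in> ?X \<Longrightarrow> P \<subseteq> J \<Longrightarrow> J = P"
    by (metis (no_types, lifting) finite_has_maximal2)
  have Pi: "O_ideal P" using P by blast
  have "a \<in> P \<or> b \<in> P" if ab: "a \<in> \<O>" "b \<in> \<O>" "a * b \<in> P" for a b
  proof (rule ccontr)
    assume no: "\<not> (a \<in> P \<or> b \<in> P)"
    have gen: "\<exists>s\<in>\<O>. \<exists>q\<in>P. 1 = s * c + q" if c: "c \<in> \<O>" "c \<notin> P" for c
    proof -
      let ?J = "{s * c + q | s q. s \<in> \<O> \<and> q \<in> P}"
      have "O_ideal ?J"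
        unfolding O_ideal_def
      proof (intro conjI ballI)
        show "?J \<subseteq> \<O>" using c Pi by (auto simp: O_ideal_def)
        show "0 \<in> ?J" using Pi by (force simp: O_ideal_def intro: exI[of _ 0])
        fix x assume "x \<in> ?J"
        then obtain s q where x: "x = s * c + q" "s \<in> \<O>" "q \<in> P" by blast
        { fix y assume "y \<in> ?J"
          then obtain s' q' where y: "y = s' * c + q'" "s' \<in> \<O>" "q' \<in> P" by blast
          have "x + y = (s + s') * c + (q + q')" using x y by (simp add: algebra_simps)
          moreover have "q + q' \<in> P" using x y Pi by (auto simp: O_ideal_def)
          ultimately show "x + y \<in> ?J" using x y by blast }
      next
        fix t x assume t: "t \<in> \<O>" and "x \<in> ?J"
        then obtain s q where x: "x = s * c + q" "s \<in> \<O>" "q \<in> P" by blast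
        have "t * x = (t * s) * c + t * q" using x by (simp add: algebra_simps)
        moreover have "t * q \<in> P" using x t Pi by (auto simp: O_ideal_def)
        ultimately show "t * x \<in> ?J" using x t by blast
      qed
      moreover have PJ: "P \<subseteq> ?J" by (force intro: exI[of _ 0])
      moreover have "c \<in> ?J" using Pi by (force simp: O_ideal_def intro: exI[of _ 1] exI[of _ 0])
      ultimately have "1 \<in> ?J" using P c(2) by blast
      then show ?thesis by blast
    qed
    obtain s q where 1: "s \<in> \<O>" "q \<in> P" "1 = s * a + q" using gen[of a] ab no by blast
    obtain s' q' where 2: "s' \<in> \<O>" "q' \<in> P" "1 = s' * b + q'" using gen[of b] ab no by blast
    have O: "q \<in> \<O>" "q' \<in> \<O>" using 1 2 Pi by (auto simp: O_ideal_def)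
    have "1 = (s * a + q) * (s' * b + q')" using 1 2 by simp
    also have "\<dots> = (s * s') * (a * b) + ((s * a) * q' + (s' * b + q') * q)"
      by (simp add: algebra_simps)
    also have "\<dots> \<in> P"
      using Pi 1(1,2) 2(1,2) ab O unfolding O_ideal_def by (metis (no_types, lifting) O_add O_mult)
    finally show False using P by blast
  qed
  then have "nz_prime_ideal k P" unfolding nz_prime_ideal_iff using Pi P x by blast
  then show thesis using that P by blast
qed

end

section \<open>Orders at primes and the class group\<close>

context galois_field
begin

lemma
  assumes "nz_prime_ideal k P"
  shows prime_O: "x \<in> P \<Longrightarrow> x \<in> \<O>"
    and prime_0: "0 \<in> P"
    and prime_1: "1 \<notin> P"
    and prime_add: "x \<in> P \<Longrightarrow> y \<in> P \<Longrightarrow> x + y \<in> P"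
    and prime_mult: "a \<in> \<O> \<Longrightarrow> x \<in> P \<Longrightarrow> a * x \<in> P"
    and prime_prime: "a \<in> \<O> \<Longrightarrow> b \<in> \<O> \<Longrightarrow> a * b \<in> P \<Longrightarrow> a \<in> P \<or> b \<in> P"
  using assms unfolding nz_prime_ideal_iff O_ideal_def by auto

lemma prime_mult': "nz_prime_ideal k P \<Longrightarrow> x \<in> P \<Longrightarrow> a \<in> \<O> \<Longrightarrow> x * a \<in> P"
  using prime_mult[of P a x] by (simp add: mult.commute)

lemma prime_power:
  assumes P: "nz_prime_ideal k P" and x: "x \<in> \<O>" and "x ^ n \<in> P"
  shows "x \<in> P"
  using assms(3)
proof (induction n)
  case 0
  then show ?case using prime_1[OF P] by simp
next
  case (Suc n)
  then have "x \<in> P \<or> x ^ n \<in> P" using prime_prime[OF P x O_power[OF x]] by simp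
  then show ?case using Suc.IH by blast
qed

lemma prime_power_in: "nz_prime_ideal k P \<Longrightarrow> x \<in> P \<Longrightarrow> n > 0 \<Longrightarrow> x ^ n \<in> P"
  using prime_mult'[of P x "x ^ (n - 1)"] prime_O[of P x] O_power[of x "n - 1"]
  by (simp add: power_eq_if)

lemma prime_contains_nat:
  assumes "nz_prime_ideal k P" obtains n :: nat where "n > 0" "of_nat n \<in> P"
proof -
  obtain x where x: "x \<in> P" "x \<noteq> 0" using assms prime_0 by (auto simp: nz_prime_ideal_iff)
  then obtain n y where "n > 0" "y \<in> \<O>" "of_nat n = x * y"
    using O_dvd_nat[OF prime_O[OF assms]] by metis
  then show thesis using that prime_mult'[OF assms x(1)] by metis
qed

text \<open>The residue ring is finite, so the powers of \<open>x\<close> repeat.\<close>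

lemma power_times_one_minus_power:
  assumes m: "m > 0" and x: "x \<in> \<O>"
  obtains i j y where "y \<in> \<O>" "j > 0" "x ^ i * (1 - x ^ j) = of_nat m * y"
proof -
  have xO: "x ^ i \<in> \<O>" for i using x by (rule O_power)
  obtain i j y where ij: "i < j" "y \<in> \<O>" "x ^ i - x ^ j = of_nat m * y"
    using residue_pigeonhole[of m "\<lambda>i. x ^ i", OF m xO] by metis
  have "x ^ i * (1 - x ^ (j - i)) = x ^ i - x ^ j"
    using ij(1) by (simp add: algebra_simps flip: power_add)
  then show thesis using that[of y "j - i" i] ij by simp
qed

text \<open>For \<open>x\<close> in \<open>Q\<close>, the repeating powers put
  \<open>x ^ i * (1 - x ^ j)\<close> into \<open>P\<close>. The second factor is outside
  \<open>Q\<close>, hence outside \<open>P\<close>, so primality leaves \<open>x\<close> in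
  \<open>P\<close>.\<close>

lemma prime_maximal:
  assumes P: "nz_prime_ideal k P" and Q: "nz_prime_ideal k Q" and sub: "P \<subseteq> Q"
  shows "P = Q"
proof
  show "Q \<subseteq> P"
  proof
    fix x assume x: "x \<in> Q"
    have xO: "x \<in> \<O>" using Q x by (rule prime_O)
    obtain m :: nat where m: "m > 0" "of_nat m \<in> P" using prime_contains_nat[OF P] .
    obtain i j y where y: "y \<in> \<O>" "j > 0" "x ^ i * (1 - x ^ j) = of_nat m * y"
      using power_times_one_minus_power[OF m(1) xO] .
    have "x ^ i * (1 - x ^ j) \<in> P" unfolding y(3) using prime_mult'[OF P m(2) y(1)] .
    moreover have "1 - x ^ j \<notin> P"
    proof
      assume "1 - x ^ j \<in> P"
      then have "1 - x ^ j + x ^ j \<in> Q"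
        using sub prime_power_in[OF Q x y(2)] prime_add[OF Q] by blast
      then show False using prime_1[OF Q] by simp
    qed
    ultimately have "x ^ i \<in> P" using prime_prime[OF P, of "x ^ i" "1 - x ^ j"] xO by auto
    then show "x \<in> P" using prime_power[OF P xO] by blast
  qed
qed (rule sub)

text \<open>Two of the integers \<open>t ^ j * m\<close> agree modulo \<open>m\<close>; dividing by
  \<open>m\<close>, the difference of two powers of \<open>t\<close> is integral. This is a monic
  equation for \<open>t\<close> over the algebraic integers.\<close>

lemma integral_if_powers_bounded:
  assumes t: "t \<in> k" and m: "m > 0" and b: "\<And>j. t ^ j * of_nat m \<in> \<O>"
  shows "t \<in> \<O>"
proof -
  obtain i j y where ij: "i < j" "y \<in> \<O>" "t ^ i * of_nat m - t ^ j * of_nat m = of_nat m * y"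
    using residue_pigeonhole[of m "\<lambda>j. t ^ j * of_nat m", OF m b] by metis
  have "of_nat m * (t ^ j - t ^ i) = of_nat m * (- y)"
    using ij(3) by (simp add: algebra_simps)
  then have eq: "t ^ j - t ^ i = - y" using m by (simp only: mult_cancel_left) simp
  let ?p = "monom 1 j - monom 1 i :: complex poly"
  have deg: "degree ?p = j"
    using ij(1) by (subst diff_conv_add_uminus, subst degree_add_eq_left) (auto simp: degree_monom_eq)
  have "algebraic_int t"
  proof (rule algebraic_int_root)
    show "algebraic_int (- y)" using ij(2) O_int by simp
    show "poly ?p t = - y" using eq by (simp add: poly_monom)
    show "\<forall>i. coeff ?p i \<in> \<int>" by auto
    show "lead_coeff ?p = 1" unfolding deg using ij(1) by simp
    show "degree ?p > 0" unfolding deg using ij(1) by simp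
  qed
  then show ?thesis using t by (simp add: ring_of_integers_def)
qed

text \<open>Such a \<open>t\<close> has order \<open>-1\<close> at \<open>P\<close> and nonnegative order elsewhere. Measuring orders by powers of
  \<open>t\<close> instead of a uniformizer keeps the products inside \<open>\<O>\<close>, so no localization is needed.\<close>

definition couniformizer :: "complex set \<Rightarrow> complex \<Rightarrow> bool" where
  "couniformizer P t \<longleftrightarrow> t \<in> k \<and> (\<forall>x\<in>P. t * x \<in> \<O>) \<and> (\<exists>x\<in>P. t * x \<notin> P)"

text \<open>With \<open>m\<close> a positive integer in \<open>P\<close>, the prime \<open>P\<close> is the annihilator modulo \<open>m\<close> of some \<open>b\<close>
  (one whose annihilator is maximal among those inside \<open>P\<close>), and \<open>b / m\<close> is the desired element.\<close>

lemma couniformizer_exists: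
  assumes P: "nz_prime_ideal k P"
  shows "\<exists>t. couniformizer P t"
proof -
  obtain m :: nat where m: "m > 0" "of_nat m \<in> P" using prime_contains_nat[OF P] .
  define Ann where "Ann b = {x \<in> \<O>. \<exists>y\<in>\<O>. x * b = of_nat m * y}" for b
  have Ann_ideal: "O_ideal (Ann b) \<and> of_nat m \<in> Ann b" if b: "b \<in> \<O>" for b
  proof -
    have "0 \<in> Ann b" unfolding Ann_def using O_0 by fastforce
    moreover have "x + x' \<in> Ann b" if xx: "x \<in> Ann b" "x' \<in> Ann b" for x x'
    proof -
      obtain y y' where "y \<in> \<O>" "y' \<in> \<O>" "x * b = of_nat m * y" "x' * b = of_nat m * y'"
        using xx unfolding Ann_def by auto
      then have "(x + x') * b = of_nat m * (y + y')" "y + y' \<in> \<O>" by (auto simp: algebra_simps)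
      then show ?thesis using that unfolding Ann_def by blast
    qed
    moreover have "a * x \<in> Ann b" if ax: "a \<in> \<O>" "x \<in> Ann b" for a x
    proof -
      obtain y where "y \<in> \<O>" "x * b = of_nat m * y" using ax unfolding Ann_def by auto
      then have "(a * x) * b = of_nat m * (a * y)" "a * y \<in> \<O>"
        using that by (auto simp: mult_ac)
      then show ?thesis using that unfolding Ann_def by blast
    qed
    moreover have "of_nat m \<in> Ann b" using b by (auto simp: Ann_def)
    moreover have "Ann b \<subseteq> \<O>" by (auto simp: Ann_def)
    ultimately show ?thesis unfolding O_ideal_def by blast
  qed
  let ?X = "Ann ` {b \<in> \<O>. Ann b \<subseteq> P}"
  have "?X \<subseteq> {I. O_ideal I \<and> of_nat m \<in> I}" using Ann_ideal by auto
  then have "finite ?X" using finite_O_ideals[OF m(1)] finite_subset by blast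
  moreover have "Ann 1 \<subseteq> P" using prime_mult'[OF P m(2)] by (auto simp: Ann_def)
  then have "Ann 1 \<in> ?X" using O_1 by blast
  ultimately obtain A where A: "A \<in> ?X" "\<And>A'. A' \<in> ?X \<Longrightarrow> A \<subseteq> A' \<Longrightarrow> A' = A"
    using finite_has_maximal2[of ?X "Ann 1"] by (metis (no_types, lifting))
  then obtain b where b: "b \<in> \<O>" "Ann b \<subseteq> P" "A = Ann b" by blast
  have max: "Ann b' = Ann b" if "b' \<in> \<O>" "Ann b' \<subseteq> P" "Ann b \<subseteq> Ann b'" for b'
    using A(2)[of "Ann b'"] that b(3) by blast
  have sub: "Ann b \<subseteq> Ann (s * b)" if "s \<in> \<O>" for s
  proof
    fix x assume "x \<in> Ann b"
    then obtain y where "x \<in> \<O>" "y \<in> \<O>" "x * b = of_nat m * y" by (auto simp: Ann_def)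
    then have "x * (s * b) = of_nat m * (s * y)" "s * y \<in> \<O>" using that by (auto simp: mult_ac)
    then show "x \<in> Ann (s * b)" using \<open>x \<in> \<O>\<close> unfolding Ann_def by blast
  qed
  have in_Ann_mult: "t * s \<in> Ann b" if "t \<in> Ann (s * b)" "s \<in> \<O>" for s t
    using that by (auto simp: Ann_def mult.assoc)
  \<comment> \<open>Since \<open>P\<close> is prime and excludes \<open>s\<close>, the larger
    annihilator is still inside \<open>P\<close>, and maximality forces equality.\<close>
  have Ann_s: "Ann (s * b) = Ann b" if s: "s \<in> \<O>" "s \<notin> P" for s
  proof (rule max)
    show "Ann (s * b) \<subseteq> P"
    proof
      fix t assume t: "t \<in> Ann (s * b)"
      then have "t * s \<in> P" using in_Ann_mult s(1) b(2) by blast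
      moreover have "t \<in> \<O>" using t by (auto simp: Ann_def)
      ultimately show "t \<in> P" using prime_prime[OF P _ s(1)] s(2) by blast
    qed
  qed (use s b sub in auto)
  have PA: "x \<in> Ann b" if x: "x \<in> P" for x
  proof -
    have xO: "x \<in> \<O>" using P x by (rule prime_O)
    obtain i j y where y: "y \<in> \<O>" "j > 0" "x ^ i * (1 - x ^ j) = of_nat m * y"
      using power_times_one_minus_power[OF m(1) xO] .
    have "1 - x ^ j \<notin> P"
      using prime_add[OF P _ prime_power_in[OF P x y(2)], of "1 - x ^ j"] prime_1[OF P] by auto
    then have "Ann ((1 - x ^ j) * b) = Ann b" using xO by (intro Ann_s) auto
    moreover have "x ^ i \<in> Ann ((1 - x ^ j) * b)"
    proof -
      have "x ^ i * ((1 - x ^ j) * b) = of_nat m * (y * b)" using y(3) by (metis mult.assoc)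
      moreover have "y * b \<in> \<O>" using y(1) b(1) by (rule O_mult)
      ultimately show ?thesis using xO O_power unfolding Ann_def by blast
    qed
    ultimately have "\<exists>i. x ^ i \<in> Ann b" by auto
    then obtain i where i: "x ^ i \<in> Ann b" "\<And>i'. i' < i \<Longrightarrow> x ^ i' \<notin> Ann b"
      using exists_least_iff[of "\<lambda>i. x ^ i \<in> Ann b"] by blast
    have "i \<noteq> 0" using i(1) b(2) prime_1[OF P] by (metis power_0 subsetD)
    then obtain j where j: "i = Suc j" by (cases i) auto
    show ?thesis
    proof (cases "Ann (x * b) \<subseteq> P")
      case True
      then have "Ann (x * b) = Ann b" using xO b sub by (intro max) auto
      moreover have "x ^ j \<in> Ann (x * b)"
        using i(1) xO O_power unfolding Ann_def j by (auto simp: mult_ac)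
      ultimately show ?thesis using i(2)[of j] j by auto
    next
      case False
      then obtain s where s: "s \<in> Ann (x * b)" "s \<notin> P" by blast
      then have "s \<in> \<O>" by (auto simp: Ann_def)
      moreover have "x \<in> Ann (s * b)" using s(1) xO by (auto simp: Ann_def mult_ac)
      ultimately show ?thesis using Ann_s s(2) by blast
    qed
  qed
  define t where "t = b / of_nat m"
  have m0: "(of_nat m :: complex) \<noteq> 0" using m(1) by simp
  have tk: "t \<in> k" using b O_k by (auto simp: t_def)
  have tO: "t * x \<in> \<O>" if x: "x \<in> P" for x
  proof -
    obtain y where "y \<in> \<O>" "x * b = of_nat m * y" using PA[OF x] by (auto simp: Ann_def)
    then show ?thesis using m0 by (simp add: t_def mult.commute)
  qed
  have tnO: "t \<notin> \<O>"
  proof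
    assume "t \<in> \<O>"
    moreover have "1 * b = of_nat m * t" using m0 by (simp add: t_def)
    ultimately have "1 \<in> Ann b" unfolding Ann_def using O_1 by blast
    then show False using b(2) prime_1[OF P] by blast
  qed
  \<comment> \<open>If \<open>t\<close> mapped \<open>P\<close> into itself, all
    \<open>t ^ j * m\<close> would be integral, and \<open>t\<close> with them.\<close>
  have "\<exists>x\<in>P. t * x \<notin> P"
  proof (rule ccontr)
    assume "\<not> (\<exists>x\<in>P. t * x \<notin> P)"
    then have step: "t * x \<in> P" if "x \<in> P" for x using that by blast
    have "t ^ j * of_nat m \<in> P" for j
      by (induction j) (auto simp: m(2) mult.assoc intro: step)
    then have "t \<in> \<O>" using prime_O[OF P] by (intro integral_if_powers_bounded[OF tk m(1)]) blast
    then show False using tnO by blast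
  qed
  then show ?thesis using tk tO unfolding couniformizer_def by blast
qed

section \<open>Local units and the order at a prime\<close>

definition loc_units :: "complex set \<Rightarrow> complex set" where
  "loc_units P = {a / b | a b. a \<in> \<O> \<and> a \<notin> P \<and> b \<in> \<O> \<and> b \<notin> P}"

lemma loc_units_mult:
  assumes P: "nz_prime_ideal k P" and "x \<in> loc_units P" "y \<in> loc_units P"
  shows "x * y \<in> loc_units P"
proof -
  obtain a b a' b' where
    "x = a / b" "a \<in> \<O>" "a \<notin> P" "b \<in> \<O>" "b \<notin> P" "y = a' / b'" "a' \<in> \<O>" "a' \<notin> P" "b' \<in> \<O>" "b' \<notin> P"
    using assms(2,3) unfolding loc_units_def by blast
  then have "x * y = (a * a') / (b * b')" "a * a' \<in> \<O>" "a * a' \<notin> P" "b * b' \<in> \<O>" "b * b' \<notin> P"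
    using prime_prime[OF P] by auto
  then show ?thesis unfolding loc_units_def by blast
qed

lemma loc_units_inverse:
  assumes "x \<in> loc_units P" shows "inverse x \<in> loc_units P"
proof -
  obtain a b where "x = a / b" "a \<in> \<O>" "a \<notin> P" "b \<in> \<O>" "b \<notin> P"
    using assms unfolding loc_units_def by blast
  moreover from this have "inverse x = b / a" by simp
  ultimately show ?thesis unfolding loc_units_def by blast
qed

lemma O_minus_P_loc_units:
  assumes "nz_prime_ideal k P" "x \<in> \<O>" "x \<notin> P" shows "x \<in> loc_units P"
proof -
  have "x = x / 1" by simp
  then show ?thesis unfolding loc_units_def using assms prime_1[of P] O_1 by blast
qed

lemma loc_units_O:
  assumes P: "nz_prime_ideal k P" and "x \<in> loc_units P" "x \<in> \<O>" shows "x \<notin> P"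
proof
  assume x: "x \<in> P"
  obtain a b where ab: "x = a / b" "a \<in> \<O>" "a \<notin> P" "b \<in> \<O>" "b \<notin> P"
    using assms unfolding loc_units_def by blast
  then have "b \<noteq> 0" using prime_0[OF P] by auto
  then have "a = b * x" using ab by simp
  then show False using prime_mult[OF P ab(4) x] ab(3) by simp
qed

lemma loc_units_power:
  assumes P: "nz_prime_ideal k P" and "x \<in> loc_units P" shows "x ^ n \<in> loc_units P"
proof (induction n)
  case 0
  then show ?case using O_minus_P_loc_units[OF P, of 1] prime_1[OF P] by auto
qed (auto intro: loc_units_mult[OF P] assms)

lemma couniformizer_uniformizer:
  assumes "couniformizer P t" obtains z where "z \<in> P" "t * z \<in> \<O>" "t * z \<notin> P"
  using assms unfolding couniformizer_def by blast

lemma couniformizer_k: "couniformizer P t \<Longrightarrow> t \<in> k"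
  unfolding couniformizer_def by blast

lemma couniformizer_nonzero:
  assumes "nz_prime_ideal k P" "couniformizer P t" shows "t \<noteq> 0"
  using couniformizer_uniformizer[OF assms(2)] prime_0[OF assms(1)] by (metis mult_zero_left)

text \<open>Writing \<open>t ^ i = a / b\<close> gives \<open>b * (t * z) ^ i = a * z ^ i\<close>.
  For positive \<open>i\<close> the right side lies in \<open>P\<close> because \<open>z\<close>
  does, while the left side is a product of elements outside \<open>P\<close>.\<close>

lemma couniformizer_power_unit:
  assumes P: "nz_prime_ideal k P" and t: "couniformizer P t" and u: "t ^ i \<in> loc_units P"
  shows "i = 0"
proof (rule ccontr)
  assume i: "i \<noteq> 0"
  obtain z where z: "z \<in> P" "t * z \<in> \<O>" "t * z \<notin> P" using couniformizer_uniformizer[OF t] .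
  obtain a b where ab: "t ^ i = a / b" "a \<in> \<O>" "a \<notin> P" "b \<in> \<O>" "b \<notin> P"
    using u unfolding loc_units_def by blast
  then have "b \<noteq> 0" using prime_0[OF P] by auto
  then have "b * (t * z) ^ i = a * z ^ i" using ab(1) by (simp add: power_mult_distrib)
  also have "\<dots> \<in> P" using prime_mult[OF P ab(2) prime_power_in[OF P z(1)]] i by simp
  finally have "(t * z) ^ i \<in> P" using prime_prime[OF P ab(4), of "(t * z) ^ i"] ab(5) z(2) by blast
  then show False using prime_power[OF P z(2)] z(3) by blast
qed

lemma couniformizer_powi_unit:
  assumes P: "nz_prime_ideal k P" and t: "couniformizer P t" and u: "t powi i \<in> loc_units P"
  shows "i = 0"
proof (cases "i \<ge> 0")
  case True
  then show ?thesis using couniformizer_power_unit[OF P t, of "nat i"] u by (simp add: power_int_def)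
next
  case False
  have "inverse (t powi i) \<in> loc_units P" by (rule loc_units_inverse[OF u])
  then have "t ^ nat (- i) \<in> loc_units P" using False by (simp add: power_int_def power_inverse)
  then show ?thesis using couniformizer_power_unit[OF P t, of "nat (- i)"] False by simp
qed

text \<open>Multiply by \<open>t\<close> as long as the result stays in \<open>P\<close>. If this
  never ended, all \<open>t ^ j * x\<close> would be integral, hence all \<open>t ^ j * n\<close>
  for a positive integer \<open>n\<close> divisible by \<open>x\<close>; then \<open>t\<close> would
  be integral and could not move an element of \<open>P\<close> out of \<open>P\<close>.\<close>

lemma couniformizer_order_O:
  assumes P: "nz_prime_ideal k P" and t: "couniformizer P t" and x: "x \<in> \<O>" "x \<noteq> 0"
  obtains j where "t ^ j * x \<in> \<O>" "t ^ j * x \<notin> P"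
proof (cases "\<exists>j. t ^ j * x \<in> \<O> \<and> t ^ j * x \<notin> P")
  case False
  have step: "t * y \<in> \<O>" if "y \<in> P" for y using t that unfolding couniformizer_def by blast
  have all: "t ^ j * x \<in> \<O>" for j
  proof (induction j)
    case (Suc j)
    then have "t ^ j * x \<in> P" using False by blast
    then show ?case using step by (simp add: mult.assoc)
  qed (use x in simp)
  obtain n y where n: "n > 0" "y \<in> \<O>" "of_nat n = x * y" using O_dvd_nat[OF x] .
  have "t ^ j * of_nat n \<in> \<O>" for j
    unfolding n(3) using O_mult[OF all[of j] n(2)] by (simp add: mult.assoc)
  then have "t \<in> \<O>" using integral_if_powers_bounded[OF couniformizer_k[OF t] n(1)] by blast
  then show ?thesis
    using couniformizer_uniformizer[OF t] prime_mult[OF P] by metis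
qed (use that in blast)

text \<open>Multiplying by a couniformizer lowers the order by one, so the exponent that turns
  \<open>x\<close> into a local unit is the order itself, with its usual sign. The arbitrary choice
  of \<open>t\<close> is harmless because two couniformizers differ by a local unit.\<close>

definition ord_at :: "complex set \<Rightarrow> complex \<Rightarrow> int" where
  "ord_at P x = (THE j. x * (SOME t. couniformizer P t) powi j \<in> loc_units P)"

text \<open>The quotient is \<open>(t' * z) / (t * z)\<close>. Its numerator avoids \<open>P\<close>
  because \<open>(t' * z) * (t * z')\<close> equals the product of \<open>t * z\<close> and
  \<open>t' * z'\<close>, both outside \<open>P\<close>.\<close>

lemma couniformizer_quotient:
  assumes P: "nz_prime_ideal k P" and t: "couniformizer P t" and t': "couniformizer P t'"
  shows "t' / t \<in> loc_units P"
proof -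
  obtain z where z: "z \<in> P" "t * z \<in> \<O>" "t * z \<notin> P" using couniformizer_uniformizer[OF t] .
  obtain z' where z': "z' \<in> P" "t' * z' \<in> \<O>" "t' * z' \<notin> P" using couniformizer_uniformizer[OF t'] .
  have w: "t' * z \<in> \<O>" "t * z' \<in> \<O>" using z z' t t' unfolding couniformizer_def by blast+
  have "(t' * z) * (t * z') = (t * z) * (t' * z')" by simp
  then have "(t' * z) * (t * z') \<notin> P" using prime_prime[OF P z(2) z'(2)] z(3) z'(3) by metis
  then have "t' * z \<notin> P" using prime_mult'[OF P _ w(2)] by blast
  moreover have "z \<noteq> 0" using z(3) prime_0[OF P] by auto
  then have "t' / t = (t' * z) / (t * z)" by simp
  ultimately show ?thesis unfolding loc_units_def using w(1) z(2,3) by blast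
qed

lemma loc_units_powi:
  "nz_prime_ideal k P \<Longrightarrow> x \<in> loc_units P \<Longrightarrow> x powi n \<in> loc_units P"
  by (auto simp: power_int_def intro: loc_units_power loc_units_inverse)

lemma ord_at_eqI:
  assumes P: "nz_prime_ideal k P" and t: "couniformizer P t" and j: "x * t powi j \<in> loc_units P"
  shows "ord_at P x = j"
proof -
  define s where "s = (SOME t. couniformizer P t)"
  have s: "couniformizer P s" unfolding s_def using couniformizer_exists[OF P] by (rule someI_ex)
  have nz: "s \<noteq> 0" "t \<noteq> 0" using couniformizer_nonzero[OF P] s t by auto
  \<comment> \<open>Passing from \<open>t\<close> to the chosen \<open>s\<close> changes the
    expression only by a power of the local unit \<open>s / t\<close>.\<close>
  have "x * s powi j = (x * t powi j) * (s / t) powi j"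
    using nz by (simp add: power_int_divide_distrib)
  also have "\<dots> \<in> loc_units P"
    using loc_units_mult[OF P j loc_units_powi[OF P couniformizer_quotient[OF P t s]]] .
  finally have sj: "x * s powi j \<in> loc_units P" .
  have x0: "x \<noteq> 0"
  proof
    assume "x = 0"
    then have "0 \<in> loc_units P" using sj by simp
    then show False using loc_units_O[OF P] prime_0[OF P] O_0 by blast
  qed
  have uniq: "i = j" if i: "x * s powi i \<in> loc_units P" for i
  proof -
    have "(x * s powi i) * inverse (x * s powi j) \<in> loc_units P"
      using loc_units_mult[OF P i loc_units_inverse[OF sj]] .
    also have "(x * s powi i) * inverse (x * s powi j) = s powi (i - j)"
      using nz x0 by (simp add: power_int_diff field_simps)
    finally have "i - j = 0" by (rule couniformizer_powi_unit[OF P s])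
    then show ?thesis by simp
  qed
  show ?thesis unfolding ord_at_def s_def[symmetric] by (rule the_equality) (rule sj, rule uniq)
qed

lemma ord_at_ex:
  assumes P: "nz_prime_ideal k P" and t: "couniformizer P t" and x: "x \<in> k" "x \<noteq> 0"
  shows "x * t powi ord_at P x \<in> loc_units P"
proof -
  obtain D :: nat where D: "D > 0" "of_nat D * x \<in> \<O>" using k_integral_multiple[OF x(1)] .
  have nz: "t \<noteq> 0" using couniformizer_nonzero[OF P t] .
  obtain i where i: "t ^ i * (of_nat D * x) \<in> \<O>" "t ^ i * (of_nat D * x) \<notin> P"
    using couniformizer_order_O[OF P t D(2)] x(2) D(1) by (metis mult_eq_0_iff of_nat_0_eq_iff less_irrefl)
  obtain j where j: "t ^ j * of_nat D \<in> \<O>" "t ^ j * of_nat D \<notin> P"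
    using couniformizer_order_O[OF P t O_of_nat[of D]] D(1) by (metis of_nat_0_eq_iff less_irrefl)
  \<comment> \<open>The order of the quotient of \<open>D * x\<close> by \<open>D\<close> is the
    difference of the two exponents found for integral elements.\<close>
  have "x * t powi (int i - int j) = (t ^ i * (of_nat D * x)) / (t ^ j * of_nat D)"
    using nz D by (simp add: power_int_diff)
  then have "x * t powi (int i - int j) \<in> loc_units P"
    unfolding loc_units_def using i j by blast
  then show ?thesis using ord_at_eqI[OF P t] by metis
qed

lemma ord_at_mult:
  assumes P: "nz_prime_ideal k P" and x: "x \<in> k" "x \<noteq> 0" and y: "y \<in> k" "y \<noteq> 0"
  shows "ord_at P (x * y) = ord_at P x + ord_at P y"
proof -
  obtain t where t: "couniformizer P t" using couniformizer_exists[OF P] by blast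
  have nz: "t \<noteq> 0" using couniformizer_nonzero[OF P t] .
  have "(x * t powi ord_at P x) * (y * t powi ord_at P y) \<in> loc_units P"
    by (intro loc_units_mult[OF P] ord_at_ex[OF P t] x y)
  then show ?thesis using nz by (intro ord_at_eqI[OF P t]) (simp add: power_int_add mult_ac)
qed

lemma ord_at_eq_0_iff:
  assumes P: "nz_prime_ideal k P" and x: "x \<in> k" "x \<noteq> 0"
  shows "ord_at P x = 0 \<longleftrightarrow> x \<in> loc_units P"
proof -
  obtain t where t: "couniformizer P t" using couniformizer_exists[OF P] by blast
  show ?thesis using ord_at_ex[OF P t x] ord_at_eqI[OF P t, of x 0] by auto
qed

lemma ord_at_1: "nz_prime_ideal k P \<Longrightarrow> ord_at P 1 = 0"
  using ord_at_eq_0_iff[of P 1] O_minus_P_loc_units[of P 1] prime_1[of P] by auto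

lemma ord_at_inverse:
  assumes P: "nz_prime_ideal k P" and x: "x \<in> k" "x \<noteq> 0"
  shows "ord_at P (inverse x) = - ord_at P x"
  using ord_at_mult[OF P x k_inverse[OF x(1)]] x ord_at_1[OF P] by simp

lemma ord_at_power:
  assumes P: "nz_prime_ideal k P" and x: "x \<in> k" "x \<noteq> 0"
  shows "ord_at P (x ^ n) = int n * ord_at P x"
  by (induction n) (use x in \<open>simp_all add: ord_at_1[OF P] ord_at_mult[OF P] k_power algebra_simps\<close>)

lemma ord_at_powi:
  assumes P: "nz_prime_ideal k P" and x: "x \<in> k" "x \<noteq> 0"
  shows "ord_at P (x powi n) = n * ord_at P x"
  using x by (auto simp: power_int_def ord_at_power[OF P] ord_at_inverse[OF P] k_inverse)

lemma ord_at_prod: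
  assumes P: "nz_prime_ideal k P" and "finite I" and "\<And>i. i \<in> I \<Longrightarrow> f i \<in> k \<and> f i \<noteq> 0"
  shows "ord_at P (\<Prod>i\<in>I. f i) = (\<Sum>i\<in>I. ord_at P (f i))"
  using assms(2,3)
  by (induction I rule: finite_induct) (simp_all add: ord_at_1[OF P] ord_at_mult[OF P] k_prod prod_zero_iff)

lemma ord_at_O:
  assumes P: "nz_prime_ideal k P" and x: "x \<in> \<O>" "x \<noteq> 0"
  shows "ord_at P x \<ge> 0" and "ord_at P x = 0 \<longleftrightarrow> x \<notin> P"
proof -
  obtain t where t: "couniformizer P t" using couniformizer_exists[OF P] by blast
  obtain j where j: "t ^ j * x \<in> \<O>" "t ^ j * x \<notin> P" using couniformizer_order_O[OF P t x] .
  have "ord_at P x = int j"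
    using O_minus_P_loc_units[OF P j] by (intro ord_at_eqI[OF P t]) (simp add: mult.commute)
  then show "ord_at P x \<ge> 0" by simp
  show "ord_at P x = 0 \<longleftrightarrow> x \<notin> P"
    using ord_at_eq_0_iff[OF P O_k[OF x(1)] x(2)] O_minus_P_loc_units[OF P x(1)] loc_units_O[OF P _ x(1)] by blast
qed

lemma ord_at_couniformizer:
  assumes P: "nz_prime_ideal k P" and t: "couniformizer P t" shows "ord_at P t = - 1"
  using couniformizer_nonzero[OF P t] O_minus_P_loc_units[OF P O_1 prime_1[OF P]]
  by (intro ord_at_eqI[OF P t]) simp

lemma ord_at_nonneg_iff:
  assumes P: "nz_prime_ideal k P" and x: "x \<in> k" "x \<noteq> 0"
  shows "ord_at P x \<ge> 0 \<longleftrightarrow> x \<in> loc_ring k P"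
proof
  assume "x \<in> loc_ring k P"
  then obtain a b where ab: "x = a / b" "a \<in> \<O>" "b \<in> \<O>" "b \<notin> P" unfolding loc_ring_def by blast
  have b0: "b \<noteq> 0" "a \<noteq> 0" using x ab by auto
  have "ord_at P a = ord_at P x + ord_at P b"
    using ord_at_mult[OF P x O_k[OF ab(3)] b0(1)] ab b0 by simp
  then show "ord_at P x \<ge> 0"
    using ord_at_O[OF P ab(2) b0(2)] ord_at_O[OF P ab(3) b0(1)] ab(4) by simp
next
  assume "ord_at P x \<ge> 0"
  then obtain j where j: "ord_at P x = int j" using nonneg_int_cases by blast
  obtain t where t: "couniformizer P t" using couniformizer_exists[OF P] by blast
  have nz: "t \<noteq> 0" using couniformizer_nonzero[OF P t] .
  obtain z where z: "z \<in> P" "t * z \<in> \<O>" "t * z \<notin> P" using couniformizer_uniformizer[OF t] .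
  have z0: "z \<noteq> 0" using z(3) prime_0[OF P] by auto
  obtain a b where ab: "x * t ^ j = a / b" "a \<in> \<O>" "a \<notin> P" "b \<in> \<O>" "b \<notin> P"
    using ord_at_ex[OF P t x] unfolding j loc_units_def by auto
  have "x = (a / b) / t ^ j" using ab(1) nz by (metis nonzero_mult_div_cancel_right power_not_zero)
  \<comment> \<open>Expanding by \<open>z ^ j\<close> replaces the possibly nonintegral
    \<open>t ^ j\<close> by \<open>(t * z) ^ j\<close>, which is integral and outside
    \<open>P\<close>.\<close>
  also have "\<dots> = (a * z ^ j) / (b * (t * z) ^ j)" using z0 by (simp add: power_mult_distrib)
  finally have "x = (a * z ^ j) / (b * (t * z) ^ j)" .
  moreover have "a * z ^ j \<in> \<O>" "b * (t * z) ^ j \<in> \<O>" using ab z prime_O[OF P] by auto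
  moreover have "b * (t * z) ^ j \<notin> P"
    using prime_prime[OF P ab(4), of "(t * z) ^ j"] ab(5) prime_power[OF P z(2)] z by blast
  ultimately show "x \<in> loc_ring k P" unfolding loc_ring_def by blast
qed

text \<open>The possible denominators of \<open>x\<close> form a nonzero ideal. Were it proper, it
  would lie in some prime \<open>P\<close>, but nonnegative order at \<open>P\<close> supplies a
  denominator outside \<open>P\<close>.\<close>

lemma integral_if_ord_nonneg:
  assumes x: "x \<in> k" "x \<noteq> 0" and ord: "\<And>P. nz_prime_ideal k P \<Longrightarrow> ord_at P x \<ge> 0"
  shows "x \<in> \<O>"
proof (rule ccontr)
  assume no: "x \<notin> \<O>"
  let ?I = "{d \<in> \<O>. d * x \<in> \<O>}"
  have "O_ideal ?I" unfolding O_ideal_def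
    by (auto simp: distrib_right mult.assoc)
  moreover obtain D :: nat where D: "D > 0" "of_nat D * x \<in> \<O>" using k_integral_multiple[OF x(1)] .
  then have "of_nat D \<in> ?I" "of_nat D \<noteq> (0 :: complex)" by auto
  then have "?I \<noteq> {0}" by blast
  moreover have "1 \<notin> ?I" using no by simp
  ultimately obtain P where P: "nz_prime_ideal k P" "?I \<subseteq> P" using prime_ideal_above by blast
  have "x \<in> loc_ring k P" using ord_at_nonneg_iff[OF P(1) x] ord[OF P(1)] by blast
  then obtain a b where ab: "x = a / b" "a \<in> \<O>" "b \<in> \<O>" "b \<notin> P" unfolding loc_ring_def by blast
  have "b \<noteq> 0" using ab x by auto
  then have "b * x = a" using ab by simp
  then have "b \<in> ?I" using ab by simp
  then show False using P(2) ab(4) by blast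
qed

text \<open>Finiteness of the class group, in the form that some power of \<open>P\<close> is principal. With \<open>\<beta>\<close> of
  minimal norm in the ideal \<open>P ^ m\<close>, Hurwitz' lemma puts \<open>M! / \<beta>\<close> times that ideal inside \<open>\<O>\<close>; it is
  one of the finitely many ideals containing \<open>M!\<close>, so two exponents \<open>m\<close> give the same ideal.\<close>

lemma prime_power_principal:
  assumes P: "nz_prime_ideal k P"
  obtains b where "b \<in> \<O>" "b \<noteq> 0" "ord_at P b > 0"
    "\<And>Q. nz_prime_ideal k Q \<Longrightarrow> Q \<noteq> P \<Longrightarrow> ord_at Q b = 0"
proof -
  obtain t where t: "couniformizer P t" using couniformizer_exists[OF P] by blast
  have nz: "t \<noteq> 0" using couniformizer_nonzero[OF P t] .
  have tk: "t \<in> k" using couniformizer_k[OF t] .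
  obtain z where z: "z \<in> P" "t * z \<in> \<O>" "t * z \<notin> P" using couniformizer_uniformizer[OF t] .
  have z0: "z \<noteq> 0" using z(3) prime_0[OF P] by auto
  \<comment> \<open>The ideal \<open>P ^ m\<close> without ideal products: at primes other than
    \<open>P\<close> the factor \<open>t ^ m\<close> imposes no condition on an integral
    \<open>x\<close>, and at \<open>P\<close> it asks for order at least \<open>m\<close>.\<close>
  define I where "I m = {x \<in> \<O>. t ^ m * x \<in> \<O>}" for m
  have I_O: "x \<in> \<O>" if "x \<in> I m" for x m using that by (simp add: I_def)
  have I_diff: "x - y \<in> I m" if "x \<in> I m" "y \<in> I m" for x y m
    using that by (auto simp: I_def right_diff_distrib)
  have I_add: "x + y \<in> I m" if "x \<in> I m" "y \<in> I m" for x y m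
    using that by (auto simp: I_def distrib_left)
  have I_mult: "a * x \<in> I m" if "a \<in> \<O>" "x \<in> I m" for a x m
    using that O_mult[of a "t ^ m * x"] by (auto simp: I_def mult.left_commute)
  have I_0: "0 \<in> I m" for m by (simp add: I_def)
  have I_P: "s ^ m \<in> I m" if s: "s \<in> P" for s m
  proof -
    have "t * s \<in> \<O>" using t s unfolding couniformizer_def by blast
    then have "(t * s) ^ m \<in> \<O>" by (rule O_power)
    then show ?thesis using prime_O[OF P s] O_power by (simp add: I_def power_mult_distrib)
  qed
  obtain M :: nat where M: "M > 0"
    "\<And>a. a \<in> k \<Longrightarrow> \<exists>r\<in>{1..M}. \<exists>w\<in>\<O>. \<forall>\<sigma>\<in>G. cmod (\<sigma> (of_nat r * a - w)) < 1"
    using hurwitz by blast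
  have "\<exists>\<beta>. \<beta> \<in> I m \<and> \<beta> \<noteq> 0 \<and> (\<forall>x\<in>I m. \<exists>y\<in>\<O>. of_nat (fact M) * x = \<beta> * y)" for m
  proof -
    define N where "N x = nat \<lfloor>cmod (nm x)\<rfloor>" for x
    have N: "cmod (nm x) = of_nat (N x)" if "x \<in> \<O>" for x
      using cmod_nm_nat[OF that] unfolding N_def by (metis floor_of_nat nat_int)
    have "\<exists>\<beta>. \<beta> \<in> I m \<and> \<beta> \<noteq> 0" using I_P[OF z(1), of m] z0 by (intro exI[of _ "z ^ m"]) auto
    then obtain \<beta> where \<beta>: "\<beta> \<in> I m" "\<beta> \<noteq> 0" "\<And>x. x \<in> I m \<Longrightarrow> x \<noteq> 0 \<Longrightarrow> N \<beta> \<le> N x"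
      using ex_has_least_nat[of "\<lambda>x. x \<in> I m \<and> x \<noteq> 0" _ N] by blast
    have \<beta>k: "\<beta> \<in> k" using \<beta>(1) I_O O_k by blast
    have "\<exists>y\<in>\<O>. of_nat (fact M) * x = \<beta> * y" if x: "x \<in> I m" for x
    proof -
      have xk: "x \<in> k" using x I_O O_k by blast
      have xb: "x / \<beta> \<in> k" using xk \<beta>k by blast
      obtain r w where r: "r \<in> {1..M}" and w: "w \<in> \<O>"
        and small: "\<And>\<sigma>. \<sigma> \<in> G \<Longrightarrow> cmod (\<sigma> (of_nat r * (x / \<beta>) - w)) < 1"
        using M(2)[OF xb] by metis
      \<comment> \<open>The remainder of dividing \<open>r * x\<close> by \<open>\<beta>\<close>.
        Its norm is smaller than the minimal one, so it is zero.\<close>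
      define d where "d = of_nat r * x - w * \<beta>"
      have d: "d \<in> I m" unfolding d_def using x \<beta>(1) w by (intro I_diff I_mult) auto
      have "d = (of_nat r * (x / \<beta>) - w) * \<beta>" using \<beta>(2) by (simp add: d_def field_simps)
      moreover have "of_nat r * (x / \<beta>) - w \<in> k" using xb w O_k by blast
      ultimately have "cmod (nm d) = cmod (nm (of_nat r * (x / \<beta>) - w)) * cmod (nm \<beta>)"
        using \<beta>k by (simp add: nm_mult norm_mult)
      also have "\<dots> < 1 * cmod (nm \<beta>)"
        using cmod_nm_less_1[OF small] nm_eq_0[OF \<beta>k] \<beta>(2) by (intro mult_strict_right_mono) auto
      finally have "N d < N \<beta>" using N I_O d \<beta>(1) by simp
      then have "d = 0" using \<beta>(3)[OF d] by force
      then have eq: "of_nat r * x = w * \<beta>" by (simp add: d_def)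
      have "r dvd fact M" using r by (intro dvd_fact) auto
      then obtain q where q: "fact M = r * q" by blast
      have "of_nat (fact M) * x = \<beta> * (of_nat q * w)"
        unfolding q of_nat_mult using eq by (simp add: mult_ac)
      then show ?thesis using w by blast
    qed
    then show ?thesis using \<beta> by blast
  qed
  then obtain \<beta> where \<beta>: "\<And>m. \<beta> m \<in> I m" "\<And>m. \<beta> m \<noteq> 0"
    and quot: "\<And>m x. x \<in> I m \<Longrightarrow> \<exists>y\<in>\<O>. of_nat (fact M) * x = \<beta> m * y"
    by metis
  \<comment> \<open>This is the ideal \<open>I m\<close> multiplied by
    \<open>M! / \<beta> m\<close>. It contains \<open>M!\<close>, as the image of
    \<open>\<beta> m\<close>.\<close>
  define J where "J m = {y \<in> \<O>. \<exists>x\<in>I m. of_nat (fact M) * x = \<beta> m * y}" for m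
  have J: "O_ideal (J m) \<and> of_nat (fact M) \<in> J m" for m
  proof -
    have "of_nat (fact M) * \<beta> m = \<beta> m * of_nat (fact M)" by (rule mult.commute)
    then have "of_nat (fact M) \<in> J m" unfolding J_def using \<beta>(1)[of m] O_of_nat by blast
    moreover have "0 \<in> J m" unfolding J_def using I_0[of m] by auto
    moreover have "y + y' \<in> J m" if yy: "y \<in> J m" "y' \<in> J m" for y y'
    proof -
      obtain x x' where xx: "x \<in> I m" "x' \<in> I m" "of_nat (fact M) * x = \<beta> m * y" "of_nat (fact M) * x' = \<beta> m * y'"
        using yy unfolding J_def by blast
      then have "of_nat (fact M) * (x + x') = \<beta> m * (y + y')" by (simp only: distrib_left)
      then show ?thesis using xx I_add yy unfolding J_def by blast
    qed
    moreover have "a * y \<in> J m" if ay: "a \<in> \<O>" "y \<in> J m" for a y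
    proof -
      obtain x where xx: "x \<in> I m" "of_nat (fact M) * x = \<beta> m * y" using ay unfolding J_def by blast
      then have "of_nat (fact M) * (a * x) = \<beta> m * (a * y)" by (simp only: mult.left_commute)
      then show ?thesis using xx I_mult ay unfolding J_def by blast
    qed
    moreover have "J m \<subseteq> \<O>" by (auto simp: J_def)
    ultimately show ?thesis unfolding O_ideal_def by blast
  qed
  have "finite (range J)"
    using finite_O_ideals[of "fact M"] J by (intro finite_subset[OF _ finite_O_ideals[of "fact M"]]) auto
  then have "\<not> inj J" using finite_imageD infinite_UNIV_nat by blast
  then have "\<exists>m m'. m < m' \<and> J m = J m'" unfolding inj_on_def by (metis linorder_neqE_nat)
  then obtain m m' where mm: "m < m'" "J m = J m'" by blast
  \<comment> \<open>Equal normalized ideals mean that multiplication by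
    \<open>\<beta> j / \<beta> i\<close> carries \<open>I i\<close> into \<open>I j\<close>.\<close>
  have transfer: "\<beta> j / \<beta> i * x \<in> I j" if eq: "J i = J j" and x: "x \<in> I i" for i j x
  proof -
    obtain y where y: "y \<in> \<O>" "of_nat (fact M) * x = \<beta> i * y" using quot[OF x] by blast
    then have "y \<in> J j" using x eq[symmetric] unfolding J_def by blast
    then obtain x' where x': "x' \<in> I j" "of_nat (fact M) * x' = \<beta> j * y" unfolding J_def by blast
    have "of_nat (fact M) * (\<beta> j / \<beta> i * x) = \<beta> j / \<beta> i * (\<beta> i * y)"
      using y(2) by (metis mult.left_commute)
    also have "\<dots> = of_nat (fact M) * x'" using \<beta>(2) x'(2) by simp
    finally have "\<beta> j / \<beta> i * x = x'"
      using mult_cancel_left[of "of_nat (fact M)" "\<beta> j / \<beta> i * x" x'] by simp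
    then show ?thesis using x'(1) by simp
  qed
  define b where "b = \<beta> m' / \<beta> m"
  have b0: "b \<noteq> 0" using \<beta>(2) by (simp add: b_def)
  have bk: "b \<in> k" unfolding b_def using \<beta>(1) I_O O_k by blast
  have inv_b: "inverse b = \<beta> m / \<beta> m'" by (simp add: b_def)
  have "ord_at P b > 0"
  proof -
    have zk: "z \<in> k" using prime_O[OF P z(1)] O_k by blast
    have "ord_at P (t * z) = 0" using ord_at_O(2)[OF P z(2)] z(3) nz z0 by simp
    then have oz: "ord_at P z = 1"
      using ord_at_mult[OF P tk nz zk z0] ord_at_couniformizer[OF P t] by simp
    \<comment> \<open>The element \<open>z\<close> has order 1 at \<open>P\<close>, so comparing
      orders gives \<open>ord_at P b \<ge> m' - m\<close>, which is positive.\<close>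
    have "b * z ^ m \<in> I m'" using transfer[OF mm(2) I_P[OF z(1)]] by (simp add: b_def)
    then have "t ^ m' * (b * z ^ m) \<in> \<O>" by (simp add: I_def)
    then have "0 \<le> ord_at P (t ^ m' * (b * z ^ m))" using nz z0 b0 by (intro ord_at_O(1)[OF P]) auto
    also have "\<dots> = - int m' + (ord_at P b + int m)"
      using nz z0 b0 bk tk zk oz ord_at_couniformizer[OF P t]
      by (simp add: ord_at_mult[OF P] ord_at_power[OF P] k_power k_mult)
    finally show ?thesis using mm(1) by linarith
  qed
  moreover have ordQ: "ord_at Q b = 0" if Q: "nz_prime_ideal k Q" "Q \<noteq> P" for Q
  proof -
    \<comment> \<open>An element \<open>s\<close> of \<open>P\<close> outside \<open>Q\<close> has
      order 0 at \<open>Q\<close>. Its powers lie in the ideals \<open>I m\<close> and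
      \<open>I m'\<close>, so transferring them in both directions bounds the order of
      \<open>b\<close> at \<open>Q\<close> from below and from above.\<close>
    have "\<not> P \<subseteq> Q" using prime_maximal[OF P Q(1)] Q(2) by blast
    then obtain s where s: "s \<in> P" "s \<notin> Q" by blast
    have sO: "s \<in> \<O>" using prime_O[OF P s(1)] .
    have sk: "s \<in> k" using sO O_k by blast
    have s0: "s \<noteq> 0" using s(2) prime_0[OF Q(1)] by auto
    have os: "ord_at Q s = 0" using ord_at_O(2)[OF Q(1) sO s0] s(2) by simp
    have ge: "ord_at Q c \<ge> 0" if c: "c * s ^ i \<in> \<O>" "c \<in> k" "c \<noteq> 0" for c i
      using ord_at_O(1)[OF Q(1) c(1)] c s0 sk os
      by (simp add: ord_at_mult[OF Q(1)] ord_at_power[OF Q(1)] k_power)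
    have "b * s ^ m \<in> \<O>" using I_O[OF transfer[OF mm(2) I_P[OF s(1)]]] by (simp add: b_def)
    moreover have "inverse b * s ^ m' \<in> \<O>"
      using I_O[OF transfer[OF mm(2)[symmetric] I_P[OF s(1)]]] by (simp add: inv_b)
    ultimately have "ord_at Q b \<ge> 0" "ord_at Q (inverse b) \<ge> 0"
      using ge bk b0 k_inverse by auto
    then show ?thesis using ord_at_inverse[OF Q(1) bk b0] by simp
  qed
  moreover have "b \<in> \<O>"
    using calculation by (intro integral_if_ord_nonneg bk b0) (metis order_less_imp_le order_refl)
  ultimately show thesis using that b0 by blast
qed

end

section \<open>Characters of the torus\<close>

lemma torus_nonzero: "t \<in> torus \<Longrightarrow> t $ v \<noteq> 0"
  by (metis (mono_tags, lifting) mem_Collect_eq norm_zero torus_def zero_neq_one)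

lemma torus_mult: "s \<in> torus \<Longrightarrow> t \<in> torus \<Longrightarrow> s * t \<in> (torus :: (complex ^ 'v::finite) set)"
  by (simp add: torus_def norm_mult)

lemma closed_torus: "closed (torus :: (complex ^ 'v::finite) set)"
  unfolding torus_def by (intro closed_Collect_all closed_Collect_eq continuous_intros)

lemma compact_torus: "compact (torus :: (complex ^ 'v::finite) set)"
proof -
  have "norm t \<le> (\<Sum>v\<in>(UNIV :: 'v set). 1)" if "t \<in> torus" for t :: "complex ^ 'v"
    using norm_le_l1_cart[of "\<chi> v. norm (t $ v)"] that
    by (simp add: torus_def norm_vec_def)
  then have "bounded (torus :: (complex ^ 'v) set)" by (auto simp: bounded_iff)
  then show ?thesis using closed_torus by (simp add: compact_eq_bounded_closed)
qed

lemma char_mu_mult: "char_mu \<mu> (s * t) = char_mu \<mu> s * char_mu \<mu> (t :: complex ^ 'v::finite)"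
  by (simp add: char_mu_def power_int_mult_distrib prod.distrib)

lemma char_mu_one: "char_mu \<mu> (1 :: complex ^ 'v::finite) = 1"
  by (simp add: char_mu_def)

lemma char_mu_power: "char_mu \<mu> (t ^ n :: complex ^ 'v::finite) = char_mu \<mu> t ^ n"
  by (induction n) (simp_all add: char_mu_one char_mu_mult)

lemma char_mu_add:
  "t \<in> torus \<Longrightarrow> char_mu (\<mu> + \<nu>) t = char_mu \<mu> t * char_mu \<nu> (t :: complex ^ 'v::finite)"
  using torus_nonzero[of t] by (simp add: char_mu_def power_int_add prod.distrib)

lemma char_mu_0: "char_mu 0 (t :: complex ^ 'v::finite) = 1"
  by (simp add: char_mu_def)

lemma norm_char_mu: "t \<in> torus \<Longrightarrow> cmod (char_mu \<mu> (t :: complex ^ 'v::finite)) = 1"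
  by (simp add: char_mu_def torus_def prod_norm[symmetric] norm_power_int)

lemma continuous_on_char_mu: "continuous_on torus (char_mu (\<mu> :: int ^ 'v::finite))"
  unfolding char_mu_def by (intro continuous_intros) (simp add: torus_nonzero)

lemma char_mu_axis:
  "char_mu (axis w n :: int ^ 'v::finite) t = (t $ w) powi n"
proof -
  have "char_mu (axis w n :: int ^ 'v) t = (\<Prod>v\<in>UNIV. if v = w then (t $ w) powi n else 1)"
    unfolding char_mu_def by (intro prod.cong) (auto simp: axis_def)
  then show ?thesis by simp
qed

text \<open>Real-valued, because Stone-Weierstrass is applied in its form for rings of real
  functions; the coefficients stay complex. Only values on the torus are prescribed.\<close>

definition trig_poly :: "(complex ^ 'v::finite \<Rightarrow> real) set" where
  "trig_poly = {f. \<exists>F c. finite F \<and> (\<forall>x\<in>torus. complex_of_real (f x) = (\<Sum>\<mu>\<in>F. c \<mu> * char_mu \<mu> x))}"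

text \<open>The index family may repeat a character, as happens for sums and products; equal
  characters are collected into one coefficient.\<close>

lemma trig_polyI:
  assumes "finite I" "\<And>x. x \<in> torus \<Longrightarrow> complex_of_real (f x) = (\<Sum>i\<in>I. c i * char_mu (g i) x)"
  shows "f \<in> trig_poly"
proof -
  have "(\<Sum>i\<in>I. c i * char_mu (g i) x) = (\<Sum>\<mu>\<in>g ` I. (\<Sum>i | i \<in> I \<and> g i = \<mu>. c i) * char_mu \<mu> x)" for x
    unfolding sum.image_gen[OF assms(1), of "\<lambda>i. c i * char_mu (g i) x" g] sum_distrib_right
    by (intro sum.cong) auto
  then show ?thesis unfolding trig_poly_def using assms
    by (intro CollectI exI[of _ "g ` I"] exI[of _ "\<lambda>\<mu>. \<Sum>i | i \<in> I \<and> g i = \<mu>. c i"]) auto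
qed

lemma trig_poly_function_ring:
  "function_ring_on (trig_poly :: (complex ^ 'v::finite \<Rightarrow> real) set) torus"
proof
  fix f :: "complex ^ 'v \<Rightarrow> real"
  assume "f \<in> trig_poly"
  then obtain F c where F: "finite F"
    and f: "\<And>x. x \<in> torus \<Longrightarrow> complex_of_real (f x) = (\<Sum>\<mu>\<in>F. c \<mu> * char_mu \<mu> x)"
    unfolding trig_poly_def by blast
  have "continuous_on torus (\<lambda>x :: complex ^ 'v. Re (\<Sum>\<mu>\<in>F. c \<mu> * char_mu \<mu> x))"
    by (intro continuous_intros continuous_on_char_mu)
  also have "?this \<longleftrightarrow> continuous_on torus f"
    by (intro continuous_on_cong) (auto simp: f[symmetric])
  finally show "continuous_on torus f" .
  fix g :: "complex ^ 'v \<Rightarrow> real"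
  assume "g \<in> trig_poly"
  then obtain F' c' where F': "finite F'"
    and g: "\<And>x. x \<in> torus \<Longrightarrow> complex_of_real (g x) = (\<Sum>\<mu>\<in>F'. c' \<mu> * char_mu \<mu> x)"
    unfolding trig_poly_def by blast
  show "(\<lambda>x. f x + g x) \<in> trig_poly"
  proof (rule trig_polyI[where I = "F <+> F'" and g = "case_sum id id" and c = "case_sum c c'"])
    fix x :: "complex ^ 'v" assume "x \<in> torus"
    then show "complex_of_real (f x + g x)
        = (\<Sum>i\<in>F <+> F'. (case_sum c c' i) * char_mu (case_sum id id i) x)"
      using F F' by (simp add: f g sum.Plus)
  qed (use F F' in auto)
  show "(\<lambda>x. f x * g x) \<in> trig_poly"
  proof (rule trig_polyI[where I = "F \<times> F'" and g = "\<lambda>(\<mu>, \<nu>). \<mu> + \<nu>" and c = "\<lambda>(\<mu>, \<nu>). c \<mu> * c' \<nu>"])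
    fix x :: "complex ^ 'v" assume "x \<in> torus"
    then show "complex_of_real (f x * g x)
        = (\<Sum>i\<in>F \<times> F'. (case i of (\<mu>, \<nu>) \<Rightarrow> c \<mu> * c' \<nu>) * char_mu (case i of (\<mu>, \<nu>) \<Rightarrow> \<mu> + \<nu>) x)"
      unfolding of_real_mult f[OF \<open>x \<in> torus\<close>] g[OF \<open>x \<in> torus\<close>] sum_product sum.cartesian_product
      by (intro sum.cong) (auto simp: char_mu_add)
  qed (use F F' in auto)
next
  fix r :: real
  show "(\<lambda>_. r) \<in> (trig_poly :: (complex ^ 'v \<Rightarrow> real) set)"
    by (rule trig_polyI[where I = "{()}" and g = "\<lambda>_. 0" and c = "\<lambda>_. of_real r"])
       (auto simp: char_mu_0)
next
  fix x y :: "complex ^ 'v"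
  assume "x \<in> torus" "y \<in> torus" "x \<noteq> y"
  then obtain v where "x $ v \<noteq> y $ v" by (auto simp: vec_eq_iff)
  then have ne: "Re (x $ v) \<noteq> Re (y $ v) \<or> Im (x $ v) \<noteq> Im (y $ v)" by (simp add: complex_eq_iff)
  have cnj: "cnj (z $ v) = inverse (z $ v)" if "z \<in> torus" for z :: "complex ^ 'v"
  proof -
    have "z $ v * cnj (z $ v) = 1" using that by (simp add: torus_def complex_norm_square[symmetric])
    then show ?thesis by (metis inverse_unique)
  qed
  \<comment> \<open>On the unit circle conjugation is inversion, so real and imaginary part of a
    coordinate are combinations of the characters with exponent 1 and -1 there. These two functions
    separate points.\<close>
  let ?g = "\<lambda>b :: bool. axis v (if b then 1 else - 1) :: int ^ 'v"
  have re: "(\<lambda>z :: complex ^ 'v. Re (z $ v)) \<in> trig_poly"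
  proof (rule trig_polyI[where I = UNIV and g = ?g and c = "\<lambda>_. 1 / 2"])
    fix z :: "complex ^ 'v" assume "z \<in> torus"
    from cnj[OF this] show "complex_of_real (Re (z $ v)) = (\<Sum>b\<in>UNIV. 1 / 2 * char_mu (?g b) z)"
      by (simp add: UNIV_bool char_mu_axis power_int_minus complex_eq_iff flip: cnj)
  qed simp
  have im: "(\<lambda>z :: complex ^ 'v. Im (z $ v)) \<in> trig_poly"
  proof (rule trig_polyI[where I = UNIV and g = ?g and c = "\<lambda>b. if b then - \<i> / 2 else \<i> / 2"])
    fix z :: "complex ^ 'v" assume "z \<in> torus"
    from cnj[OF this] show "complex_of_real (Im (z $ v))
        = (\<Sum>b\<in>UNIV. (if b then - \<i> / 2 else \<i> / 2) * char_mu (?g b) z)"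
      by (simp add: UNIV_bool char_mu_axis power_int_minus complex_eq_iff flip: cnj)
  qed simp
  from ne show "\<exists>f\<in>trig_poly. f x \<noteq> f y"
    by (elim disjE) (rule bexI[OF _ re], assumption, rule bexI[OF _ im], assumption)
qed (rule compact_torus)

text \<open>A stand-in for integration against a probability measure on \<open>A\<close>: linear,
  dependent only on the values on \<open>A\<close>, and sending functions with values in a closed
  disc to a point of that disc. Invariance is not part of it; \<open>mean_functional\<close>
  supplies what is used of it, approximately and for finitely many characters.\<close>

definition mean_on :: "(complex ^ 'v::finite) set \<Rightarrow> ((complex ^ 'v \<Rightarrow> complex) \<Rightarrow> complex) \<Rightarrow> bool" where
  "mean_on A m \<longleftrightarrow>
     (\<forall>f g. m (\<lambda>x. f x + g x) = m f + m g) \<and> (\<forall>c f. m (\<lambda>x. c * f x) = c * m f) \<and>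
     (\<forall>f g. (\<forall>x\<in>A. f x = g x) \<longrightarrow> m f = m g) \<and>
     (\<forall>f z d. (\<forall>x\<in>A. cmod (f x - z) \<le> d) \<longrightarrow> cmod (m f - z) \<le> d)"

lemma
  assumes "mean_on A m"
  shows mean_on_add: "m (\<lambda>x. f x + g x) = m f + m g"
    and mean_on_scale: "m (\<lambda>x. c * f x) = c * m f"
    and mean_on_cong: "(\<And>x. x \<in> A \<Longrightarrow> f x = g x) \<Longrightarrow> m f = m g"
    and mean_on_bound: "(\<And>x. x \<in> A \<Longrightarrow> cmod (f x - z) \<le> d) \<Longrightarrow> cmod (m f - z) \<le> d"
  using assms unfolding mean_on_def by auto

text \<open>Translating by powers of some \<open>a \<in> A\<close> with \<open>char_mu \<mu> a \<noteq> 1\<close> and averaging makes the mean of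
  \<open>char_mu \<mu>\<close> small, without increasing the means of the other characters.\<close>

lemma mean_functional:
  fixes A :: "(complex ^ 'v::finite) set"
  assumes A: "A \<subseteq> torus" "1 \<in> A" "\<And>x y. x \<in> A \<Longrightarrow> y \<in> A \<Longrightarrow> x * y \<in> A"
    and F: "finite F" and e: "e > 0"
  shows "\<exists>m. mean_on A m \<and> (\<forall>\<mu>\<in>F. (\<exists>x\<in>A. char_mu \<mu> x \<noteq> 1) \<longrightarrow> cmod (m (char_mu \<mu>)) < e)"
  using F
proof (induction F rule: finite_induct)
  case empty
  show ?case by (rule exI[of _ "\<lambda>f. f 1"]) (use A(2) in \<open>auto simp: mean_on_def\<close>)
next
  case (insert \<mu> F)
  then obtain m where m: "mean_on A m"
    and m_small: "\<And>\<nu>. \<nu> \<in> F \<Longrightarrow> \<exists>x\<in>A. char_mu \<nu> x \<noteq> 1 \<Longrightarrow> cmod (m (char_mu \<nu>)) < e"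
    by auto
  note m_add = mean_on_add[OF m] and m_scale = mean_on_scale[OF m]
    and m_cong = mean_on_cong[OF m] and m_bound = mean_on_bound[OF m]
  show ?case
  proof (cases "\<exists>a\<in>A. char_mu \<mu> a \<noteq> 1")
    case False
    then show ?thesis using m m_small by (intro exI[of _ m]) auto
  next
    case True
    then obtain a where a: "a \<in> A" "char_mu \<mu> a \<noteq> 1" by blast
    define w where "w = char_mu \<mu> a"
    have w: "w \<noteq> 1" "cmod w = 1" using a A(1) norm_char_mu by (auto simp: w_def)
    \<comment> \<open>The geometric sum of the powers of \<open>w\<close> has absolute value at most
      \<open>2 / cmod (1 - w)\<close> for any length, so dividing by this \<open>n\<close> brings it
      below \<open>e\<close>.\<close>
    obtain n :: nat where n: "2 / (cmod (1 - w) * e) < of_nat n" using reals_Archimedean2 by blast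
    have "0 < 2 / (cmod (1 - w) * e)" using w e by simp
    then have n0: "n > 0" using n by (intro Nat.gr0I) auto
    have aj: "a ^ j \<in> A" for j by (induction j) (auto simp: A a)
    define m' where "m' f = (\<Sum>j<n. m (\<lambda>x. f (a ^ j * x))) / of_nat n" for f
    \<comment> \<open>Every character is an eigenvector of averaging over translates, with
      eigenvalue of absolute value at most 1 by \<open>avg\<close>.\<close>
    have eval: "m' (char_mu \<nu>) = (\<Sum>j<n. char_mu \<nu> a ^ j) / of_nat n * m (char_mu \<nu>)" for \<nu>
      unfolding m'_def by (simp add: char_mu_mult char_mu_power m_scale sum_distrib_right)
    have avg: "cmod (\<Sum>j<n. char_mu \<nu> a ^ j) \<le> of_nat n" for \<nu>
    proof -
      have "cmod (\<Sum>j<n. char_mu \<nu> a ^ j) \<le> (\<Sum>j<n. cmod (char_mu \<nu> a ^ j))" by (rule norm_sum)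
      also have "\<dots> = of_nat n" using a A(1) by (simp add: norm_power norm_char_mu subset_iff)
      finally show ?thesis .
    qed
    have dec: "cmod (m' (char_mu \<nu>)) \<le> cmod (m (char_mu \<nu>))" for \<nu>
    proof -
      have "cmod (m' (char_mu \<nu>)) = cmod (\<Sum>j<n. char_mu \<nu> a ^ j) / of_nat n * cmod (m (char_mu \<nu>))"
        by (simp add: eval norm_mult norm_divide)
      also have "\<dots> \<le> 1 * cmod (m (char_mu \<nu>))"
        using avg[of \<nu>] n0 by (intro mult_right_mono) (auto simp: divide_le_eq_1)
      finally show ?thesis by simp
    qed
    have small: "cmod (m' (char_mu \<mu>)) < e"
    proof -
      have "(\<Sum>j<n. w ^ j) = (1 - w ^ n) / (1 - w)" using w(1) by (simp add: sum_gp_strict)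
      then have "cmod (\<Sum>j<n. w ^ j) = cmod (1 - w ^ n) / cmod (1 - w)" by (simp add: norm_divide)
      also have "\<dots> \<le> 2 / cmod (1 - w)"
        using norm_triangle_ineq4[of 1 "w ^ n"] w(2) by (intro divide_right_mono) (auto simp: norm_power)
      also have "\<dots> < e * of_nat n"
        using n e w(1) by (simp add: field_simps)
      finally have "cmod (\<Sum>j<n. w ^ j) / of_nat n < e" using n0 by (simp add: field_simps)
      moreover have "cmod (m (char_mu \<mu>) - 0) \<le> 1" using A(1)
        by (intro m_bound) (simp add: norm_char_mu subset_iff)
      moreover have "cmod (m' (char_mu \<mu>)) = cmod (\<Sum>j<n. w ^ j) / of_nat n * cmod (m (char_mu \<mu>))"
        by (simp add: eval norm_mult norm_divide w_def)
      moreover have "cmod (\<Sum>j<n. w ^ j) / of_nat n * cmod (m (char_mu \<mu>)) \<le> cmod (\<Sum>j<n. w ^ j) / of_nat n"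
        using calculation(2) by (intro mult_left_le) auto
      ultimately show ?thesis by linarith
    qed
    have bound: "cmod (m' f - z) \<le> d" if f: "\<forall>x\<in>A. cmod (f x - z) \<le> d" for f z d
    proof -
      have "m' f - z = (\<Sum>j<n. m (\<lambda>x. f (a ^ j * x)) - z) / of_nat n"
        using n0 by (simp add: m'_def sum_subtractf field_simps)
      then have "cmod (m' f - z) = cmod (\<Sum>j<n. m (\<lambda>x. f (a ^ j * x)) - z) / of_nat n"
        by (simp add: norm_divide)
      also have "cmod (\<Sum>j<n. m (\<lambda>x. f (a ^ j * x)) - z) \<le> of_nat (card {..<n}) * d"
        using f A(3) aj by (intro sum_norm_bound m_bound) auto
      finally show ?thesis using n0 by (simp add: divide_right_mono field_simps)
    qed
    show ?thesis
      unfolding mean_on_def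
    proof (intro exI[of _ m'] conjI allI impI ballI)
      show "m' (\<lambda>x. f x + g x) = m' f + m' g" for f g
        by (simp add: m'_def m_add sum.distrib add_divide_distrib)
      show "m' (\<lambda>x. c * f x) = c * m' f" for c f
        by (simp add: m'_def m_scale sum_distrib_left)
      show "m' f = m' g" if "\<forall>x\<in>A. f x = g x" for f g
        unfolding m'_def using that A(3) aj by (intro arg_cong2[of _ _ _ _ "(/)"] sum.cong m_cong) auto
      show "cmod (m' f - z) \<le> d" if "\<forall>x\<in>A. cmod (f x - z) \<le> d" for f z d using bound[OF that] .
      show "cmod (m' (char_mu \<nu>)) < e" if "\<nu> \<in> insert \<mu> F" "\<exists>x\<in>A. char_mu \<nu> x \<noteq> 1" for \<nu>
        using that small m_small[of \<nu>] dec[of \<nu>] by fastforce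
    qed
  qed
qed

section \<open>Separation of a closed subgroup from a point by a character\<close>

lemma closure_mult_closed:
  fixes A :: "(complex ^ 'v::finite) set"
  assumes "\<And>x y. x \<in> A \<Longrightarrow> y \<in> A \<Longrightarrow> x * y \<in> A" "x \<in> closure A" "y \<in> closure A"
  shows "x * y \<in> closure A"
proof -
  obtain f g where f: "\<And>n. f n \<in> A" "f \<longlonglongrightarrow> x" and g: "\<And>n. g n \<in> A" "g \<longlonglongrightarrow> y"
    using assms(2,3) unfolding closure_sequential by blast
  have "(\<lambda>n. f n * g n) \<longlonglongrightarrow> x * y"
    using f(2) g(2) by (intro vec_tendstoI) (auto intro!: tendsto_intros tendsto_vec_nth)
  then show ?thesis unfolding closure_sequential using f(1) g(1) assms(1)
    by (intro exI[of _ "\<lambda>n. f n * g n"]) simp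
qed

lemma closure_inverse_closed:
  fixes A :: "(complex ^ 'v::finite) set"
  assumes A: "A \<subseteq> torus" "\<And>x. x \<in> A \<Longrightarrow> \<exists>y\<in>A. x * y = 1" and x: "x \<in> closure A"
  shows "\<exists>y\<in>closure A. x * y = 1"
proof -
  define iv :: "complex ^ 'v \<Rightarrow> complex ^ 'v" where "iv x = (\<chi> v. inverse (x $ v))" for x
  have uniq: "y = iv x" if "x * y = 1" for x y
    using that by (simp add: iv_def vec_eq_iff) (metis inverse_unique)
  obtain f where f: "\<And>n. f n \<in> A" "f \<longlonglongrightarrow> x" using x unfolding closure_sequential by blast
  have xt: "x \<in> torus" using x A(1) closed_torus closure_minimal by blast
  have "(\<lambda>n. iv (f n)) \<longlonglongrightarrow> iv x"
    unfolding iv_def using f(2) torus_nonzero[OF xt]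
    by (intro vec_tendstoI) (auto intro!: tendsto_intros tendsto_vec_nth)
  moreover have "iv (f n) \<in> A" for n using A(2)[OF f(1)] uniq by metis
  ultimately have "iv x \<in> closure A" unfolding closure_sequential
    by (intro exI[of _ "\<lambda>n. iv (f n)"]) simp
  moreover have "x * iv x = 1" using torus_nonzero[OF xt] by (simp add: iv_def vec_eq_iff)
  ultimately show ?thesis by blast
qed

text \<open>If every character trivial on \<open>A\<close> were trivial at \<open>t\<close>, a
  trigonometric polynomial \<open>f\<close> and its translate by \<open>t\<close> would have almost
  the same mean over \<open>A\<close>: the other characters have almost zero mean. But
  \<open>f\<close> can be chosen near 0 on the closure of \<open>A\<close> and near 1 on its coset
  by \<open>t\<close>, since the two are disjoint.\<close>

lemma separating_character:
  fixes A :: "(complex ^ 'v::finite) set"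
  assumes A: "A \<subseteq> torus" "1 \<in> A" "\<And>x y. x \<in> A \<Longrightarrow> y \<in> A \<Longrightarrow> x * y \<in> A"
    "\<And>x. x \<in> A \<Longrightarrow> \<exists>y\<in>A. x * y = 1"
    and t: "t \<in> torus" "t \<notin> closure A"
  obtains \<mu> where "\<And>x. x \<in> A \<Longrightarrow> char_mu \<mu> x = 1" "char_mu \<mu> t \<noteq> 1"
proof (rule ccontr)
  assume no: "\<not> thesis"
  have triv: "char_mu \<mu> t = 1" if "\<forall>x\<in>A. char_mu \<mu> x = 1" for \<mu>
    using no that \<open>\<And>\<mu>. \<lbrakk>\<And>x. x \<in> A \<Longrightarrow> char_mu \<mu> x = 1; char_mu \<mu> t \<noteq> 1\<rbrakk> \<Longrightarrow> thesis\<close> by blast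
  let ?H = "closure A"
  let ?B = "(\<lambda>x. t * x) ` ?H"
  have H: "?H \<subseteq> torus" using A(1) closed_torus closure_minimal by blast
  have "compact ?H" using H compact_torus by (metis closed_closure compact_Int_closed inf.absorb_iff2)
  moreover have "continuous_on ?H (\<lambda>x. t * x)"
    by (simp add: times_vec_def continuous_on_vec_lambda continuous_intros)
  ultimately have cB: "closed ?B" using compact_continuous_image compact_imp_closed by blast
  have BT: "?B \<subseteq> torus" using H t(1) torus_mult by blast
  have disj: "?H \<inter> ?B = {}"
  proof (rule ccontr)
    assume "?H \<inter> ?B \<noteq> {}"
    then obtain h where h: "h \<in> ?H" "t * h \<in> ?H" by blast
    obtain y where y: "y \<in> ?H" "h * y = 1" using closure_inverse_closed[OF A(1,4) h(1)] by blast
    have "(t * h) * y \<in> ?H" using closure_mult_closed[OF A(3) h(2) y(1)] .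
    then show False using y(2) t(2) by (simp add: mult.assoc)
  qed
  have 1: "1 \<in> ?H" using A(2) closure_subset by blast
  \<comment> \<open>Three errors of 1/4 occur: the mean of \<open>f\<close> against 0, the mean of
    its translate against 1, and the two means against each other. They cannot add up to 1.\<close>
  have e: "0 < (1 / 4 :: real)" "(1 / 4 :: real) < 1" by simp_all
  obtain f where f: "f \<in> trig_poly" "f ` torus \<subseteq> {0..1}" "\<forall>x\<in>?H. f x < 1 / 4" "\<forall>x\<in>?B. f x > 1 - 1 / 4"
    using function_ring_on.two_special[OF trig_poly_function_ring closed_closure H 1 cB BT imageI[OF 1] disj e]
    by blast
  obtain F c where F: "finite F" and fc: "\<And>x. x \<in> torus \<Longrightarrow> complex_of_real (f x) = (\<Sum>\<mu>\<in>F. c \<mu> * char_mu \<mu> x)"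
    using f(1) unfolding trig_poly_def by blast
  \<comment> \<open>Each term carries a factor \<open>char_mu \<mu> t - 1\<close> of absolute value
    at most 2; with means below \<open>1 / (8 * K)\<close> the terms add up to at most 1/4. The
    summand 1 allows division by \<open>K\<close>.\<close>
  define K where "K = 1 + (\<Sum>\<mu>\<in>F. cmod (c \<mu>))"
  have K: "K > 0" unfolding K_def by (intro add_pos_nonneg sum_nonneg) auto
  obtain m where m: "mean_on A m"
    and m_small: "\<And>\<nu>. \<nu> \<in> F \<Longrightarrow> \<exists>x\<in>A. char_mu \<nu> x \<noteq> 1 \<Longrightarrow> cmod (m (char_mu \<nu>)) < 1 / (8 * K)"
    using mean_functional[OF A(1-3) F, of "1 / (8 * K)"] K by auto
  note m_add = mean_on_add[OF m] and m_scale = mean_on_scale[OF m]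
    and m_cong = mean_on_cong[OF m] and m_bound = mean_on_bound[OF m]
  have m_sum: "m (\<lambda>x. \<Sum>\<mu>\<in>F. d \<mu> * char_mu \<mu> x) = (\<Sum>\<mu>\<in>F. d \<mu> * m (char_mu \<mu>))" for d
    using F
  proof (induction F rule: finite_induct)
    case empty
    then show ?case using m_scale[of 0 "\<lambda>_. 0"] by simp
  qed (simp add: m_add m_scale)
  have AT: "x \<in> torus" "t * x \<in> torus" "x \<in> ?H" "t * x \<in> ?B" if "x \<in> A" for x
    using that A(1) t(1) torus_mult closure_subset by blast+
  define z1 where "z1 = (\<Sum>\<mu>\<in>F. c \<mu> * m (char_mu \<mu>))"
  define z2 where "z2 = (\<Sum>\<mu>\<in>F. (c \<mu> * char_mu \<mu> t) * m (char_mu \<mu>))"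
  have "m (\<lambda>x. complex_of_real (f x)) = z1"
    unfolding z1_def m_sum[symmetric] using AT by (intro m_cong) (simp add: fc)
  moreover have "cmod (m (\<lambda>x. complex_of_real (f x)) - 0) \<le> 1 / 4"
  proof (rule m_bound)
    fix x assume "x \<in> A"
    then have "f x < 1 / 4" "f x \<in> {0..1}" using AT(1,3)[of x] f(2,3) by auto
    then show "cmod (complex_of_real (f x) - 0) \<le> 1 / 4" by simp
  qed
  ultimately have z1: "cmod z1 \<le> 1 / 4" by simp
  have "m (\<lambda>x. complex_of_real (f (t * x))) = z2"
    unfolding z2_def m_sum[symmetric] using AT by (intro m_cong) (simp add: fc char_mu_mult mult.assoc)
  moreover have "cmod (m (\<lambda>x. complex_of_real (f (t * x))) - 1) \<le> 1 / 4"
  proof (rule m_bound)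
    fix x assume "x \<in> A"
    then have "f (t * x) > 1 - 1 / 4" "f (t * x) \<in> {0..1}" using AT(2,4)[of x] f(2,4) by auto
    then have "\<bar>f (t * x) - 1\<bar> \<le> 1 / 4" by (auto simp: abs_le_iff)
    then show "cmod (complex_of_real (f (t * x)) - 1) \<le> 1 / 4"
      by (metis norm_of_real of_real_1 of_real_diff real_norm_def)
  qed
  ultimately have z2: "cmod (z2 - 1) \<le> 1 / 4" by simp
  have "cmod (z2 - z1) \<le> 1 / 4"
  proof -
    have "z2 - z1 = (\<Sum>\<mu>\<in>F. (c \<mu> * (char_mu \<mu> t - 1)) * m (char_mu \<mu>))"
      by (simp add: z1_def z2_def sum_subtractf[symmetric] algebra_simps)
    also have "cmod \<dots> \<le> (\<Sum>\<mu>\<in>F. cmod (c \<mu>) * (1 / (4 * K)))"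
    proof (rule sum_norm_le)
      fix \<mu> assume \<mu>: "\<mu> \<in> F"
      show "cmod (c \<mu> * (char_mu \<mu> t - 1) * m (char_mu \<mu>)) \<le> cmod (c \<mu>) * (1 / (4 * K))"
      proof (cases "\<exists>x\<in>A. char_mu \<mu> x \<noteq> 1")
        case False
        then have "char_mu \<mu> t = 1" using triv by blast
        then show ?thesis using K by simp
      next
        case True
        have "cmod (char_mu \<mu> t - 1) \<le> 2"
          using norm_triangle_ineq4[of "char_mu \<mu> t" 1] norm_char_mu[OF t(1)] by simp
        then have "cmod (char_mu \<mu> t - 1) * cmod (m (char_mu \<mu>)) \<le> 2 * (1 / (8 * K))"
          using m_small[OF \<mu> True] by (intro mult_mono) auto
        then have "cmod (c \<mu>) * (cmod (char_mu \<mu> t - 1) * cmod (m (char_mu \<mu>))) \<le> cmod (c \<mu>) * (1 / (4 * K))"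
          by (intro mult_left_mono) auto
        then show ?thesis by (simp add: norm_mult mult.assoc)
      qed
    qed
    also have "\<dots> = (\<Sum>\<mu>\<in>F. cmod (c \<mu>)) * (1 / (4 * K))" by (rule sum_distrib_right[symmetric])
    also have "\<dots> \<le> K * (1 / (4 * K))" using K by (intro mult_right_mono) (auto simp: K_def)
    also have "\<dots> = 1 / 4" using K by simp
    finally show ?thesis .
  qed
  moreover have "(1 :: complex) = (z2 - z1) + z1 - (z2 - 1)" by simp
  then have "1 \<le> cmod (z2 - z1) + cmod z1 + cmod (z2 - 1)"
    by (metis norm_one norm_triangle_ineq norm_triangle_ineq4 add_right_mono order_trans)
  ultimately show False using z1 z2 by linarith
qed

section \<open>Closures of subgroups of the torus\<close>

text \<open>The \<open>d b\<close> are the coordinate functionals of a basis \<open>C\<close>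
  extending \<open>B\<close>; the two relations say that the matrices of \<open>C\<close> and
  \<open>d\<close> are inverse on either side. For \<open>b\<close> in \<open>C - B\<close> the
  functional \<open>d b\<close> annihilates the span of \<open>B\<close>.\<close>

lemma rational_dual_basis:
  fixes B :: "(rat ^ 'v::finite) set"
  assumes "vec.independent B"
  obtains C d where "B \<subseteq> C" "finite C"
    "\<And>b b'. b \<in> C \<Longrightarrow> b' \<in> C \<Longrightarrow> (\<Sum>v\<in>UNIV. d b $ v * b' $ v) = (if b = b' then 1 else 0)"
    "\<And>u v. (\<Sum>b\<in>C. d b $ u * b $ v) = (if u = v then 1 else 0)"
proof -
  obtain C where C: "B \<subseteq> C" "vec.independent C" "UNIV \<subseteq> vec.span C"
    using vec.maximal_independent_subset_extend[OF subset_UNIV assms] by metis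
  have fin: "finite C" using C(2) by (rule vec.finiteI_independent)
  have sp: "x \<in> vec.span C" for x using C(3) by blast
  define d where "d b = (\<chi> u. vec.representation C (axis u 1) b)" for b
  have 1: "(\<Sum>b\<in>C. d b $ u * b $ v) = (if u = v then 1 else 0)" for u v
  proof -
    have "(\<Sum>b\<in>C. vec.representation C (axis u 1) b *s b) = axis u 1"
      by (rule vec.sum_representation_eq[OF C(2) sp fin subset_refl])
    from arg_cong[OF this, of "\<lambda>x. x $ v"] show ?thesis
      by (auto simp: d_def sum_component axis_def)
  qed
  have 2: "(\<Sum>v\<in>UNIV. d b $ v * b' $ v) = (if b = b' then 1 else 0)" if b: "b \<in> C" "b' \<in> C" for b b'
  proof -
    have "vec.representation C b' b = vec.representation C (\<Sum>u\<in>UNIV. b' $ u *s axis u 1) b"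
      by (simp add: basis_expansion)
    also have "\<dots> = (\<Sum>u\<in>UNIV. b' $ u * vec.representation C (axis u 1) b)"
      using C(2) sp by (simp add: vec.representation_sum vec.representation_scale)
    finally have "(\<Sum>v\<in>UNIV. d b $ v * b' $ v) = vec.representation C b' b"
      by (simp add: d_def mult.commute)
    then show ?thesis using vec.representation_basis[OF C(2) b(2)] by auto
  qed
  show thesis using that[OF C(1) fin 2 1] .
qed

text \<open>A rational basis \<open>B\<close> of the span of \<open>E\<close> is also a real basis
  of the solution space. Pairing with the dual basis shows real independence. A solution
  \<open>w\<close> has no coordinate at \<open>b\<close> outside \<open>B\<close>, because that
  coordinate is a pairing with \<open>d b\<close>, and clearing the denominators of
  \<open>d b\<close> gives a vector in \<open>L\<close>.\<close>

lemma dim_real_annihilator: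
  fixes E :: "(rat ^ 'v::finite) set"
  defines "L \<equiv> {\<mu> :: int ^ 'v. \<forall>e\<in>E. (\<Sum>v\<in>UNIV. of_int (\<mu> $ v) * e $ v) = 0}"
  shows "dim {w :: real ^ 'v. \<forall>\<mu>\<in>L. (\<Sum>v\<in>UNIV. of_int (\<mu> $ v) * w $ v) = 0} = rat_span_dim E"
    (is "dim ?W = _")
proof -
  obtain B where B: "B \<subseteq> E" "vec.independent B" "E \<subseteq> vec.span B" "card B = vec.dim E"
    using vec.basis_exists[of E] by blast
  obtain C d where C: "B \<subseteq> C" "finite C"
    and d1: "\<And>b b'. b \<in> C \<Longrightarrow> b' \<in> C \<Longrightarrow> (\<Sum>v\<in>UNIV. d b $ v * b' $ v) = (if b = b' then 1 else 0)"
    and d2: "\<And>u v. (\<Sum>b\<in>C. d b $ u * b $ v) = (if u = v then 1 else 0)"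
    using rational_dual_basis[OF B(2)] by blast
  define rv :: "rat ^ 'v \<Rightarrow> real ^ 'v" where "rv b = (\<chi> v. of_rat (b $ v))" for b
  have inj: "inj rv" by (auto simp: inj_def rv_def vec_eq_iff)
  have finB: "finite B" using C finite_subset by blast
  have rv_pair: "(\<Sum>v\<in>UNIV. rv a $ v * rv b $ v) = of_rat (\<Sum>v\<in>UNIV. a $ v * b $ v)" for a b
    by (simp add: rv_def of_rat_sum of_rat_mult)
  have sub: "rv ` B \<subseteq> ?W"
  proof safe
    fix b \<mu> assume "b \<in> B" "\<mu> \<in> L"
    then have "(\<Sum>v\<in>UNIV. of_int (\<mu> $ v) * b $ v) = 0" using B(1) by (auto simp: L_def)
    from arg_cong[OF this, of "of_rat :: rat \<Rightarrow> real"]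
    show "(\<Sum>v\<in>UNIV. of_int (\<mu> $ v) * rv b $ v) = 0"
      by (simp add: rv_def of_rat_sum of_rat_mult)
  qed
  have indep: "independent (rv ` B)"
  proof (rule independent_if_scalars_zero)
    show "finite (rv ` B)" using finB by simp
    fix f x assume sum0: "(\<Sum>x\<in>rv ` B. f x *\<^sub>R x) = 0" and "x \<in> rv ` B"
    then obtain b where b: "b \<in> B" "x = rv b" by blast
    have "(\<Sum>c\<in>B. f (rv c) *\<^sub>R rv c) = 0"
      using sum0 by (simp add: sum.reindex[OF inj_on_subset[OF inj]])
    then have "0 = (\<Sum>v\<in>UNIV. rv (d b) $ v * (\<Sum>c\<in>B. f (rv c) *\<^sub>R rv c) $ v)" by simp
    also have "\<dots> = (\<Sum>c\<in>B. f (rv c) * (\<Sum>v\<in>UNIV. rv (d b) $ v * rv c $ v))"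
      by (simp add: sum_component sum_distrib_left sum.swap[of _ B] mult_ac)
    also have "\<dots> = (\<Sum>c\<in>B. if c = b then f (rv c) else 0)"
      unfolding rv_pair using d1 b C by (intro sum.cong) (auto simp: subset_iff)
    also have "\<dots> = f x" using b finB by simp
    finally show "f x = 0" by simp
  qed
  have span: "?W \<subseteq> span (rv ` B)"
  proof
    fix w assume w: "w \<in> ?W"
    have expand: "w = (\<Sum>b\<in>C. (\<Sum>u\<in>UNIV. rv (d b) $ u * w $ u) *\<^sub>R rv b)"
    proof (rule vec_eq_iff[THEN iffD2], rule allI)
      fix v
      have "(\<Sum>b\<in>C. (\<Sum>u\<in>UNIV. rv (d b) $ u * w $ u) *\<^sub>R rv b) $ v
          = (\<Sum>b\<in>C. \<Sum>u\<in>UNIV. (rv (d b) $ u * rv b $ v) * w $ u)"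
        by (simp add: sum_component sum_distrib_right mult.assoc mult.left_commute mult.commute[of "rv _ $ v"])
      also have "\<dots> = (\<Sum>u\<in>UNIV. (\<Sum>b\<in>C. rv (d b) $ u * rv b $ v) * w $ u)"
        by (subst sum.swap) (simp add: sum_distrib_right)
      also have "\<dots> = (\<Sum>u\<in>UNIV. of_rat (\<Sum>b\<in>C. d b $ u * b $ v) * w $ u)"
        by (simp add: rv_def of_rat_sum of_rat_mult)
      also have "\<dots> = (\<Sum>u\<in>UNIV. if u = v then w $ u else 0)"
        unfolding d2 by (intro sum.cong) auto
      finally show "w $ v = (\<Sum>b\<in>C. (\<Sum>u\<in>UNIV. rv (d b) $ u * w $ u) *\<^sub>R rv b) $ v" by simp
    qed
    have zero: "(\<Sum>u\<in>UNIV. rv (d b) $ u * w $ u) = 0" if b: "b \<in> C - B" for b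
    proof -
      obtain D :: nat where D: "D > 0" "\<forall>v\<in>UNIV. \<exists>z::int. of_nat D * (d b $ v) = (of_int z :: rat)"
        using common_denominator[of UNIV "\<lambda>v. d b $ v"] by auto
      then have "\<forall>v. \<exists>z::int. of_nat D * (d b $ v) = (of_int z :: rat)" by simp
      then obtain z :: "'v \<Rightarrow> int" where z: "\<And>v. of_nat D * (d b $ v) = (of_int (z v) :: rat)" by metis
      have span0: "(\<Sum>v\<in>UNIV. d b $ v * e $ v) = 0" if "e \<in> vec.span B" for e
        using that
      proof (induction rule: vec.span_induct_alt)
        case base
        then show ?case by simp
      next
        case (step r x y)
        then have "(\<Sum>v\<in>UNIV. d b $ v * x $ v) = 0" using d1[of b x] b C by auto
        moreover have "(\<Sum>v\<in>UNIV. d b $ v * (r *s x + y) $ v)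
            = r * (\<Sum>v\<in>UNIV. d b $ v * x $ v) + (\<Sum>v\<in>UNIV. d b $ v * y $ v)"
          by (simp add: distrib_left sum.distrib sum_distrib_left mult.left_commute)
        ultimately show ?case using step by simp
      qed
      have "(\<chi> v. z v) \<in> L"
      proof -
        have "(\<Sum>v\<in>UNIV. of_int (z v) * e $ v) = 0" if "e \<in> E" for e
        proof -
          have "(\<Sum>v\<in>UNIV. of_int (z v) * e $ v) = of_nat D * (\<Sum>v\<in>UNIV. d b $ v * e $ v)"
            by (simp add: z[symmetric] sum_distrib_left mult.assoc)
          then show ?thesis using span0 that B(3) by auto
        qed
        then show ?thesis by (simp add: L_def)
      qed
      then have "(\<Sum>v\<in>UNIV. of_int (z v) * w $ v) = 0" using w by fastforce
      moreover have "real_of_int (z v) = of_nat D * rv (d b) $ v" for v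
        using arg_cong[OF z[of v], of "of_rat :: rat \<Rightarrow> real"] by (simp add: rv_def of_rat_mult)
      ultimately have "of_nat D * (\<Sum>u\<in>UNIV. rv (d b) $ u * w $ u) = 0"
        by (simp add: sum_distrib_left mult.assoc)
      then show ?thesis using D(1) by simp
    qed
    have "w = (\<Sum>b\<in>B. (\<Sum>u\<in>UNIV. rv (d b) $ u * w $ u) *\<^sub>R rv b)"
      by (subst expand, rule sum.mono_neutral_right[OF C(2,1)]) (use zero in auto)
    also have "\<dots> \<in> span (rv ` B)" by (intro span_sum span_scale span_base) auto
    finally show "w \<in> span (rv ` B)" .
  qed
  have "dim ?W = card (rv ` B)" using basis_card_eq_dim[OF sub span indep] by simp
  also have "\<dots> = card B" by (rule card_image[OF inj_on_subset[OF inj]]) simp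
  also have "\<dots> = rat_span_dim E" using B(4) by (simp add: rat_span_dim_def)
  finally show ?thesis .
qed

section \<open>One-parameter subgroups and the identity component\<close>

lemma char_mu_exp:
  "char_mu \<mu> (\<chi> v. exp (\<i> * of_real (s * w $ v)))
     = exp (\<i> * of_real (s * (\<Sum>v\<in>UNIV. of_int (\<mu> $ v) * (w :: real ^ 'v::finite) $ v)))"
  by (simp add: char_mu_def exp_power_int exp_sum[symmetric] sum_distrib_left mult_ac)

lemma exp_all_multiples_eq_1:
  fixes r :: real
  assumes "\<And>s :: real. exp (\<i> * of_real (s * r)) = 1"
  shows "r = 0"
proof (rule ccontr)
  assume "r \<noteq> 0"
  then have "exp (\<i> * of_real pi) = 1" using assms[of "pi / r"] by simp
  then show False by (simp add: exp_pi_i')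
qed

lemma constant_on_connected_finite_range:
  assumes "connected S" "continuous_on S f" "f ` S \<subseteq> F" "finite F" "a \<in> S" "x \<in> S"
  shows "f x = (f a :: complex)"
proof -
  have "connected (f ` S)" using assms(1,2) connected_continuous_image by blast
  moreover have "finite (f ` S)" using assms(3,4) finite_subset by blast
  ultimately obtain y where "f ` S = {y}"
    using assms(5) by (auto simp: connected_finite_iff_sing)
  then show ?thesis using assms(5,6) by (metis imageI singletonD)
qed

lemma exp_curve_in_torus: "(\<chi> v. exp (\<i> * of_real (s * w $ v))) \<in> torus"
  by (simp add: torus_def)

lemma continuous_exp_curve:
  "continuous_on UNIV (\<lambda>s :: real. \<chi> v. exp (\<i> * of_real (s * (w :: real ^ 'v::finite) $ v)))"
  by (intro continuous_on_vec_lambda continuous_intros)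

text \<open>By separation, the curve in a direction orthogonal to all of \<open>L\<close> stays in
  the closure. Conversely, a character in \<open>L\<close> has finitely many values on the closure,
  so it is constant along any one-parameter subgroup contained there, and on the identity component.
  This identifies the Lie algebra with the solution space of \<open>L\<close>.\<close>

theorem closure_subgroup_of_torus:
  fixes A :: "(complex ^ 'v::finite) set" and E :: "(rat ^ 'v) set"
  assumes A: "A \<subseteq> torus" "1 \<in> A" "\<And>x y. x \<in> A \<Longrightarrow> y \<in> A \<Longrightarrow> x * y \<in> A"
    "\<And>x. x \<in> A \<Longrightarrow> \<exists>y\<in>A. x * y = 1"
    and trivial_orth: "\<And>\<mu> e. (\<And>x. x \<in> A \<Longrightarrow> char_mu \<mu> x = 1) \<Longrightarrow> e \<in> E \<Longrightarrow>
      (\<Sum>v\<in>UNIV. of_int (\<mu> $ v) * e $ v) = 0"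
    and orth_finite: "\<And>\<mu>. (\<And>e. e \<in> E \<Longrightarrow> (\<Sum>v\<in>UNIV. of_int (\<mu> $ v) * e $ v) = 0) \<Longrightarrow>
      finite (char_mu \<mu> ` A)"
  shows "{\<mu>. \<forall>t\<in>connected_component_set (closure A) 1. char_mu \<mu> t = 1}
       = {\<mu>. \<forall>e\<in>E. (\<Sum>v\<in>UNIV. of_int (\<mu> $ v) * e $ v) = 0}"
    and "lie_dim (closure A) = rat_span_dim E"
    and "(\<And>\<mu>. (\<And>e. e \<in> E \<Longrightarrow> (\<Sum>v\<in>UNIV. of_int (\<mu> $ v) * e $ v) = 0) \<Longrightarrow> \<mu> = 0) \<Longrightarrow>
      closure A = torus"
proof -
  let ?H = "closure A"
  let ?ex = "\<lambda>w s. \<chi> v. exp (\<i> * of_real (s * (w :: real ^ 'v) $ v))"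
  define L where "L = {\<mu> :: int ^ 'v. \<forall>e\<in>E. (\<Sum>v\<in>UNIV. of_int (\<mu> $ v) * e $ v) = 0}"
  define W where "W = {w :: real ^ 'v. \<forall>\<mu>\<in>L. (\<Sum>v\<in>UNIV. of_int (\<mu> $ v) * w $ v) = 0}"
  have HT: "?H \<subseteq> torus" using A(1) closed_torus closure_minimal by blast
  have 1: "1 \<in> ?H" using A(2) closure_subset by blast
  have in_H: "t \<in> ?H" if t: "t \<in> torus" and ch: "\<And>\<mu>. \<mu> \<in> L \<Longrightarrow> char_mu \<mu> t = 1" for t
  proof (rule ccontr)
    assume "t \<notin> ?H"
    then obtain \<mu> where "\<And>x. x \<in> A \<Longrightarrow> char_mu \<mu> x = 1" "char_mu \<mu> t \<noteq> 1"
      using separating_character[OF A t] by blast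
    then show False using ch trivial_orth unfolding L_def by blast
  qed
  \<comment> \<open>A finite set of values is closed, so continuity adds no new value on the
    closure.\<close>
  have finH: "finite (char_mu \<mu> ` A)" "char_mu \<mu> ` ?H \<subseteq> char_mu \<mu> ` A" if "\<mu> \<in> L" for \<mu>
  proof -
    show fin: "finite (char_mu \<mu> ` A)" using that by (intro orth_finite) (auto simp: L_def)
    show "char_mu \<mu> ` ?H \<subseteq> char_mu \<mu> ` A"
      using continuous_on_subset[OF continuous_on_char_mu HT] finite_imp_closed[OF fin]
      by (rule image_closure_subset) simp
  qed
  have WH: "W \<subseteq> lie_alg ?H"
  proof
    fix w assume "w \<in> W"
    then show "w \<in> lie_alg ?H"
      unfolding lie_alg_def mem_Collect_eq
      by (intro allI in_H exp_curve_in_torus) (subst char_mu_exp, simp add: W_def)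
  qed
  have HW: "lie_alg ?H \<subseteq> W"
  proof
    fix w assume w: "w \<in> lie_alg ?H"
    have "(\<Sum>v\<in>UNIV. of_int (\<mu> $ v) * w $ v) = 0" if \<mu>: "\<mu> \<in> L" for \<mu>
    proof (rule exp_all_multiples_eq_1)
      fix s :: real
      have ran: "range (?ex w) \<subseteq> ?H" using w by (auto simp: lie_alg_def)
      have "char_mu \<mu> (?ex w s) = char_mu \<mu> (?ex w 0)"
      proof (rule constant_on_connected_finite_range[where S = "range (?ex w)"])
        show "connected (range (?ex w))"
          using connected_continuous_image[OF continuous_exp_curve connected_UNIV] .
        show "continuous_on (range (?ex w)) (char_mu \<mu>)"
          using continuous_on_subset[OF continuous_on_char_mu] ran HT by blast
        show "char_mu \<mu> ` range (?ex w) \<subseteq> char_mu \<mu> ` A" using ran finH(2)[OF \<mu>] by blast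
      qed (rule finH(1)[OF \<mu>], rule rangeI, rule rangeI)
      then show "exp (\<i> * of_real (s * (\<Sum>v\<in>UNIV. of_int (\<mu> $ v) * w $ v))) = 1"
        unfolding char_mu_exp by simp
    qed
    then show "w \<in> W" by (simp add: W_def)
  qed
  have "lie_alg ?H = W" using WH HW by blast
  then show "lie_dim ?H = rat_span_dim E"
    using dim_real_annihilator[of E] unfolding lie_dim_def W_def L_def by simp
  show "?H = torus" if "\<And>\<mu>. (\<And>e. e \<in> E \<Longrightarrow> (\<Sum>v\<in>UNIV. of_int (\<mu> $ v) * e $ v) = 0) \<Longrightarrow> \<mu> = 0"
  proof
    show "torus \<subseteq> ?H"
    proof
      fix t :: "complex ^ 'v" assume "t \<in> torus"
      moreover have "char_mu \<mu> t = 1" if "\<mu> \<in> L" for \<mu>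
        using \<open>\<And>\<mu>. (\<And>e. e \<in> E \<Longrightarrow> (\<Sum>v\<in>UNIV. of_int (\<mu> $ v) * e $ v) = 0) \<Longrightarrow> \<mu> = 0\<close>[of \<mu>] that
        by (auto simp: L_def char_mu_0)
      ultimately show "t \<in> ?H" by (rule in_H)
    qed
  qed (rule HT)
  have "char_mu \<mu> t = 1" if \<mu>: "\<mu> \<in> L" and t: "t \<in> connected_component_set ?H 1" for \<mu> t
  proof -
    have sub: "connected_component_set ?H 1 \<subseteq> ?H" by (rule connected_component_subset)
    have "char_mu \<mu> t = char_mu \<mu> 1"
    proof (rule constant_on_connected_finite_range[where S = "connected_component_set ?H 1"])
      show "continuous_on (connected_component_set ?H 1) (char_mu \<mu>)"
        using continuous_on_subset[OF continuous_on_char_mu] sub HT by blast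
      show "char_mu \<mu> ` connected_component_set ?H 1 \<subseteq> char_mu \<mu> ` A" using sub finH(2)[OF \<mu>] by blast
    qed (use finH(1)[OF \<mu>] t 1 in \<open>auto simp: connected_component_refl\<close>)
    then show ?thesis by (simp add: char_mu_one)
  qed
  \<comment> \<open>Every vector of \<open>E\<close> is orthogonal to \<open>L\<close>, so the curve
    in its direction is a connected subset of the closure through 1. A character trivial on the
    identity component is trivial along this curve, which makes its pairing with the vector
    vanish.\<close>
  moreover have "(\<Sum>v\<in>UNIV. of_int (\<mu> $ v) * e $ v) = 0"
    if \<mu>: "\<forall>t\<in>connected_component_set ?H 1. char_mu \<mu> t = 1" and e: "e \<in> E" for \<mu> e
  proof -
    define w :: "real ^ 'v" where "w = (\<chi> v. of_rat (e $ v))"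
    have pair: "(\<Sum>v\<in>UNIV. of_int (\<nu> $ v) * w $ v) = of_rat (\<Sum>v\<in>UNIV. of_int (\<nu> $ v) * e $ v)" for \<nu> :: "int ^ 'v"
      by (simp add: w_def of_rat_sum of_rat_mult)
    have "w \<in> W" unfolding W_def using e by (auto simp: pair L_def)
    then have ran: "range (?ex w) \<subseteq> ?H" using WH by (auto simp: lie_alg_def)
    have "?ex w 0 = 1" by (simp add: vec_eq_iff)
    then have "1 \<in> range (?ex w)" using rangeI[of "?ex w" 0] by (simp only:)
    moreover have "connected (range (?ex w))"
      using connected_continuous_image[OF continuous_exp_curve connected_UNIV] .
    ultimately have "range (?ex w) \<subseteq> connected_component_set ?H 1"
      using ran by (intro connected_component_maximal)
    then have "char_mu \<mu> (?ex w s) = 1" for s using \<mu> by blast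
    then have "(\<Sum>v\<in>UNIV. of_int (\<mu> $ v) * w $ v) = 0"
      unfolding char_mu_exp by (rule exp_all_multiples_eq_1)
    then show ?thesis by (simp add: pair)
  qed
  ultimately show "{\<mu>. \<forall>t\<in>connected_component_set ?H 1. char_mu \<mu> t = 1}
       = {\<mu>. \<forall>e\<in>E. (\<Sum>v\<in>UNIV. of_int (\<mu> $ v) * e $ v) = 0}"
    unfolding L_def by blast
qed

section \<open>CM fields\<close>

context galois_field
begin

lemma aut_inv: "\<sigma> \<in> G \<Longrightarrow> \<sigma> (inv \<sigma> x) = x"
  using bij_aut by (simp add: bij_is_surj surj_f_inv_f)

lemma mem_aut_image: assumes "\<sigma> \<in> G" shows "y \<in> \<sigma> ` X \<longleftrightarrow> inv \<sigma> y \<in> X"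
proof
  assume "y \<in> \<sigma> ` X"
  then show "inv \<sigma> y \<in> X" using bij_is_inj[OF bij_aut[OF assms]] by auto
next
  assume "inv \<sigma> y \<in> X"
  then have "\<sigma> (inv \<sigma> y) \<in> \<sigma> ` X" by (rule imageI)
  then show "y \<in> \<sigma> ` X" using aut_inv[OF assms] by simp
qed

lemma inv_aut_image:
  assumes "\<sigma> \<in> G" shows "inv \<sigma> ` \<sigma> ` X = X" "\<sigma> ` inv \<sigma> ` X = X"
  using image_inv_f_f[OF bij_is_inj[OF bij_aut[OF assms]]] image_f_inv_f[OF bij_is_surj[OF bij_aut[OF assms]]]
  by blast+

lemma aut_image_eq_iff: "\<sigma> \<in> G \<Longrightarrow> \<sigma> ` X = Y \<longleftrightarrow> X = inv \<sigma> ` Y"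
  using inv_aut_image by metis

lemma prime_image:
  assumes s: "\<sigma> \<in> G" and P: "nz_prime_ideal k P"
  shows "nz_prime_ideal k (\<sigma> ` P)"
proof -
  let ?t = "inv \<sigma>"
  have t: "?t \<in> G" using inv_in_G[OF s] .
  have sub: "x \<in> \<O>" if "x \<in> \<sigma> ` P" for x using that s prime_O[OF P] by blast
  have "\<sigma> ` P \<noteq> {0}"
  proof
    assume "\<sigma> ` P = {0}"
    then have "P = {?t 0}" using inv_aut_image(1)[OF s, of P] by auto
    then show False using P aut_0[OF t] by (simp add: nz_prime_ideal_iff)
  qed
  moreover have "1 \<notin> \<sigma> ` P" using s t prime_1[OF P] by (simp add: mem_aut_image aut_1)
  moreover have "O_ideal (\<sigma> ` P)"
    unfolding O_ideal_def
  proof (intro conjI ballI subsetI)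
    show "0 \<in> \<sigma> ` P" using s t prime_0[OF P] by (simp add: mem_aut_image aut_0)
    fix x assume x: "x \<in> \<sigma> ` P"
    then show "x \<in> \<O>" by (rule sub)
    show "x + y \<in> \<sigma> ` P" if y: "y \<in> \<sigma> ` P" for y
      using prime_add[OF P, of "?t x" "?t y"] s t x y O_k[OF sub[OF x]] O_k[OF sub[OF y]]
      by (simp add: mem_aut_image aut_add)
    show "a * x \<in> \<sigma> ` P" if a: "a \<in> \<O>" for a
      using prime_mult[OF P, of "?t a" "?t x"] s t x O_k[OF sub[OF x]] O_k[OF a] aut_O[OF t a]
      by (simp add: mem_aut_image aut_mult)
  qed
  moreover have "a \<in> \<sigma> ` P \<or> b \<in> \<sigma> ` P" if "a \<in> \<O>" "b \<in> \<O>" "a * b \<in> \<sigma> ` P" for a b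
    using prime_prime[OF P, of "?t a" "?t b"] that s t aut_O[OF t] O_k
    by (simp add: mem_aut_image aut_mult)
  ultimately show ?thesis unfolding nz_prime_ideal_iff by blast
qed

lemma prime_k: "nz_prime_ideal k P \<Longrightarrow> P \<subseteq> k"
  using prime_O O_k by blast

lemma couniformizer_image:
  assumes s: "\<sigma> \<in> G" and P: "nz_prime_ideal k P" and t: "couniformizer P t"
  shows "couniformizer (\<sigma> ` P) (\<sigma> t)"
proof -
  have tk: "t \<in> k" using couniformizer_k[OF t] .
  have mul: "\<sigma> t * \<sigma> x = \<sigma> (t * x)" if "x \<in> P" for x
    using s tk that prime_k[OF P] by (simp add: aut_mult subset_iff)
  obtain z where z: "z \<in> P" "t * z \<notin> P" using t unfolding couniformizer_def by blast
  have "\<sigma> t * \<sigma> z \<notin> \<sigma> ` P"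
    using mul[OF z(1)] z(2) bij_is_inj[OF bij_aut[OF s]] by (simp add: inj_image_mem_iff)
  moreover have "\<sigma> t * y \<in> \<O>" if y: "y \<in> \<sigma> ` P" for y
  proof -
    obtain x where x: "x \<in> P" "y = \<sigma> x" using y by blast
    then have "t * x \<in> \<O>" using t unfolding couniformizer_def by blast
    then show ?thesis using mul x s by simp blast
  qed
  ultimately show ?thesis unfolding couniformizer_def using z(1) s tk by blast
qed

lemma loc_units_image:
  assumes s: "\<sigma> \<in> G" and P: "nz_prime_ideal k P" and x: "x \<in> loc_units P"
  shows "\<sigma> x \<in> loc_units (\<sigma> ` P)"
proof -
  obtain a b where ab: "x = a / b" "a \<in> \<O>" "a \<notin> P" "b \<in> \<O>" "b \<notin> P"
    using x unfolding loc_units_def by blast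
  have "\<sigma> x = \<sigma> a / \<sigma> b" using ab s O_k by (simp add: aut_divide)
  moreover have "\<sigma> a \<notin> \<sigma> ` P" "\<sigma> b \<notin> \<sigma> ` P"
    using ab bij_is_inj[OF bij_aut[OF s]] by (simp_all add: inj_image_mem_iff)
  moreover have "\<sigma> a \<in> \<O>" "\<sigma> b \<in> \<O>" using ab s by (simp_all add: aut_O)
  ultimately show ?thesis unfolding loc_units_def by blast
qed

lemma ord_at_image:
  assumes s: "\<sigma> \<in> G" and P: "nz_prime_ideal k P" and x: "x \<in> k" "x \<noteq> 0"
  shows "ord_at (\<sigma> ` P) (\<sigma> x) = ord_at P x"
proof -
  obtain t where t: "couniformizer P t" using couniformizer_exists[OF P] by blast
  have tk: "t \<in> k" using couniformizer_k[OF t] .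
  have "\<sigma> (x * t powi ord_at P x) \<in> loc_units (\<sigma> ` P)"
    using loc_units_image[OF s P ord_at_ex[OF P t x]] .
  then show ?thesis
    using s x tk by (intro ord_at_eqI[OF prime_image[OF s P] couniformizer_image[OF s P t]])
      (simp add: aut_mult aut_powi k_powi)
qed

lemma ord_at_aut:
  assumes "\<sigma> \<in> G" "nz_prime_ideal k P" "x \<in> k" "x \<noteq> 0"
  shows "ord_at P (\<sigma> x) = ord_at (inv \<sigma> ` P) x"
  using ord_at_image[OF assms(1) prime_image[OF inv_in_G[OF assms(1)] assms(2)] assms(3,4)]
    inv_aut_image(2)[OF assms(1)] by simp

section \<open>Transitivity of the Galois group on the primes above p\<close>

lemma prime_prod:
  assumes P: "nz_prime_ideal k P" and "finite I" "\<And>i. i \<in> I \<Longrightarrow> f i \<in> \<O>" "(\<Prod>i\<in>I. f i) \<in> P"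
  shows "\<exists>i\<in>I. f i \<in> P"
  using assms(2-4)
proof (induction I rule: finite_induct)
  case empty
  then show ?case using prime_1[OF P] by simp
next
  case (insert i I)
  then have "f i \<in> P \<or> (\<Prod>j\<in>I. f j) \<in> P"
    using prime_prime[OF P, of "f i" "\<Prod>j\<in>I. f j"] O_prod[of I f] by auto
  then show ?case using insert by auto
qed

lemma finite_primes_above: "p > 0 \<Longrightarrow> finite (primes_above k p)"
  by (rule finite_subset[OF _ finite_O_ideals[of p]]) (auto simp: primes_above_def nz_prime_ideal_iff)

lemma aut_primes_above:
  assumes s: "\<sigma> \<in> G" and P: "P \<in> primes_above k p" shows "\<sigma> ` P \<in> primes_above k p"
proof -
  have "\<sigma> (of_nat p) \<in> \<sigma> ` P" using P by (intro imageI) (simp add: primes_above_def)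
  then show ?thesis using P prime_image[OF s] s by (simp add: primes_above_def aut_of_nat)
qed

text \<open>Let \<open>P\<close> be the only prime containing \<open>b\<close>. The norm of
  \<open>b\<close> is an integer in \<open>P\<close>, hence a multiple of \<open>p\<close> and so in
  \<open>Q\<close>; therefore some conjugate of \<open>b\<close> lies in \<open>Q\<close>. Moving it
  back, \<open>inv \<sigma>\<close> applied to \<open>Q\<close> is a prime containing
  \<open>b\<close>, which can only be \<open>P\<close>.\<close>

lemma transitive_on_primes_above:
  assumes p: "prime p" and P: "P \<in> primes_above k p" and Q: "Q \<in> primes_above k p"
  obtains \<sigma> where "\<sigma> \<in> G" "\<sigma> ` P = Q"
proof -
  have P': "nz_prime_ideal k P" "of_nat p \<in> P" and Q': "nz_prime_ideal k Q" "of_nat p \<in> Q"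
    using P Q by (auto simp: primes_above_def)
  obtain b where b: "b \<in> \<O>" "b \<noteq> 0" "ord_at P b > 0"
    "\<And>Q. nz_prime_ideal k Q \<Longrightarrow> Q \<noteq> P \<Longrightarrow> ord_at Q b = 0"
    using prime_power_principal[OF P'(1)] by blast
  have bP: "b \<in> P" using ord_at_O(2)[OF P'(1) b(1,2)] b(3) by auto
  obtain z where z: "nm b = of_int z" using nm_Ints[OF b(1)] by (auto elim: Ints_cases)
  have "nm b = b * (\<Prod>\<sigma>\<in>G - {\<lambda>x. x}. \<sigma> b)"
    unfolding nm_def using finite_G id_in_G by (subst prod.remove[where x = "\<lambda>x. x"]) auto
  also have "\<dots> \<in> P" by (rule prime_mult'[OF P'(1) bP O_prod]) (use b(1) in auto)
  finally have zP: "of_int z \<in> P" using z by simp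
  have "int p dvd z"
  proof (rule ccontr)
    assume "\<not> int p dvd z"
    then have "coprime (int p) z" using p by (intro prime_imp_coprime) auto
    then obtain u w where uw: "u * int p + w * z = 1" by (metis bezout_int coprime_imp_gcd_eq_1)
    have "of_int u * of_nat p + of_int w * of_int z \<in> P"
      by (intro prime_add[OF P'(1)] prime_mult[OF P'(1)] zP P'(2)) auto
    also have "of_int u * of_nat p + of_int w * of_int z = (of_int (u * int p + w * z) :: complex)" by simp
    finally show False using uw prime_1[OF P'(1)] by simp
  qed
  then obtain y where "z = int p * y" by blast
  then have "nm b = of_nat p * of_int y" using z by simp
  then have "(\<Prod>\<sigma>\<in>G. \<sigma> b) \<in> Q" using prime_mult'[OF Q'(1,2), of "of_int y"] by (simp add: nm_def)
  then obtain \<sigma> where s: "\<sigma> \<in> G" "\<sigma> b \<in> Q"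
    using prime_prod[OF Q'(1) finite_G, of "\<lambda>\<sigma>. \<sigma> b"] b(1) by blast
  have pr: "nz_prime_ideal k (inv \<sigma> ` Q)" using prime_image[OF inv_in_G[OF s(1)] Q'(1)] .
  have "b \<in> inv \<sigma> ` Q" using s(2) bij_is_inj[OF bij_aut[OF s(1)]] by (metis image_eqI inv_f_f)
  then have "ord_at (inv \<sigma> ` Q) b \<noteq> 0" using ord_at_O(2)[OF pr b(1,2)] by blast
  then have "inv \<sigma> ` Q = P" using b(4)[OF pr] by blast
  then show thesis using that s(1) inv_aut_image(2)[OF s(1), of Q] by blast
qed

end

section \<open>Complex conjugation on a CM field\<close>

lemma real_quadratic_nonreal_root:
  fixes x :: complex
  assumes "x\<^sup>2 = a + b * x" "a \<in> \<real>" "b \<in> \<real>" "x \<notin> \<real>"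
  shows "cnj x = b - x"
proof -
  have "(cnj x)\<^sup>2 = cnj (x\<^sup>2)" by simp
  also have "\<dots> = a + b * cnj x" using assms(2,3) unfolding assms(1) by (simp add: Reals_cnj_iff)
  finally have "(x - cnj x) * (x + cnj x) = (x - cnj x) * b"
    using assms(1) by (simp add: power2_eq_square algebra_simps)
  moreover have "x - cnj x \<noteq> 0" using assms(4) by (metis Reals_cnj_iff right_minus_eq)
  ultimately have "x + cnj x = b" by simp
  then show ?thesis by (simp add: eq_diff_eq add.commute)
qed

locale cm_field =
  fixes k :: "complex set"
  assumes cm: "CM_galois k"

sublocale cm_field \<subseteq> galois_field k
  using cm by unfold_locales (simp add: CM_galois_def)

context cm_field
begin

lemma cm_nonreal: assumes "\<sigma> \<in> G" obtains x where "x \<in> k" "\<sigma> x \<notin> \<real>"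
  using cm assms by (auto simp: CM_galois_def)

text \<open>Any nonreal \<open>x\<close> in \<open>k\<close> works. As \<open>F\<close> is real, a
  basis \<open>B\<close> of \<open>F\<close> and its multiples by \<open>x\<close> are jointly
  independent; they number twice the degree of \<open>F\<close>, which is the degree of
  \<open>k\<close>.\<close>

lemma cm_generator:
  obtains F x where "subfield_C F" "F \<subseteq> k" "\<And>\<sigma> a. \<sigma> \<in> G \<Longrightarrow> a \<in> F \<Longrightarrow> \<sigma> a \<in> \<real>" "x \<in> k" "x \<notin> \<real>"
    "\<And>y. y \<in> k \<Longrightarrow> \<exists>a\<in>F. \<exists>b\<in>F. y = a + b * x"
proof -
  obtain F where F: "subfield_C F" "F \<subseteq> k" "\<And>\<sigma>. \<sigma> \<in> G \<Longrightarrow> \<sigma> ` F \<subseteq> \<real>" "nf_degree k = 2 * nf_degree F"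
    using cm unfolding CM_galois_def by blast
  have FR: "F \<subseteq> \<real>" using F(3)[OF id_in_G] by simp
  have Fcl: "0 \<in> F" "1 \<in> F" "a \<in> F \<Longrightarrow> b \<in> F \<Longrightarrow> a + b \<in> F" "a \<in> F \<Longrightarrow> b \<in> F \<Longrightarrow> a * b \<in> F"
    "a \<in> F \<Longrightarrow> - a \<in> F" "a \<in> F \<Longrightarrow> inverse a \<in> F" for a b
    using F(1) by (auto simp: subfield_C_def)
  have nat: "of_nat n \<in> F" for n by (induction n) (auto intro: Fcl)
  have int: "of_int n \<in> F" for n by (cases n rule: int_cases2) (auto intro: nat Fcl)
  have rat: "of_rat q \<in> F" for q
  proof -
    obtain a b where "q = of_int a / of_int b" by (cases q) (auto simp: Fract_of_int_quotient)
    then have "of_rat q = of_int a / (of_int b :: complex)" by (simp add: of_rat_divide)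
    then show ?thesis using Fcl(4,6) int by (simp add: divide_inverse)
  qed
  have sub: "qv.subspace F" unfolding qv.subspace_def qscale_def using rat Fcl by blast
  obtain x where x: "x \<in> k" "x \<notin> \<real>" using cm_nonreal[OF id_in_G] .
  obtain B where B: "B \<subseteq> F" "qv.independent B" "F \<subseteq> qv.span B" "card B = nf_degree F"
    using qv.basis_exists[of F] unfolding nf_degree_def by metis
  have spB: "qv.span B \<subseteq> F" using qv.span_minimal[OF B(1) sub] .
  have finB: "finite B" using independent_finite_card[OF B(2)] B(1) F(2) by blast
  have x_indep: "a = 0 \<and> b = 0" if "a \<in> F" "b \<in> F" "a + b * x = 0" for a b
  proof (cases "b = 0")
    case False
    then have "x = - a / b" using that by (simp add: field_simps add_eq_0_iff)
    moreover have "a \<in> \<real>" "b \<in> \<real>" using that(1,2) FR by blast+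
    ultimately have "x \<in> \<real>" by simp
    then show ?thesis using x by blast
  qed (use that in auto)
  have x0: "x \<noteq> 0" using x by auto
  let ?xB = "(\<lambda>b. b * x) ` B"
  have inj: "inj_on (\<lambda>b. b * x) B" using x0 by (auto simp: inj_on_def)
  have disj: "B \<inter> ?xB = {}"
  proof (rule ccontr)
    assume "B \<inter> ?xB \<noteq> {}"
    then obtain b where b: "b \<in> B" "b * x \<in> B" by blast
    then have "b * x + (- b) * x = 0" "b * x \<in> F" "- b \<in> F" using B(1) Fcl by auto
    then have "b = 0" using x_indep[of "b * x" "- b"] by simp
    then show False using b(1) B(2) qv.dependent_zero by blast
  qed
  have indep: "qv.independent (B \<union> ?xB)"
  proof (rule qv.independent_if_scalars_zero)
    show "finite (B \<union> ?xB)" using finB by simp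
    fix f y assume sum0: "(\<Sum>v\<in>B \<union> ?xB. qscale (f v) v) = 0" and y: "y \<in> B \<union> ?xB"
    define s1 where "s1 = (\<Sum>b\<in>B. qscale (f b) b)"
    define s2 where "s2 = (\<Sum>b\<in>B. qscale (f (b * x)) b)"
    have "(\<Sum>v\<in>?xB. qscale (f v) v) = s2 * x"
      by (simp add: sum.reindex[OF inj] s2_def qscale_def sum_distrib_right mult.assoc)
    then have "s1 + s2 * x = 0"
      using sum0 finB disj by (simp add: sum.union_disjoint s1_def)
    moreover have "s1 \<in> F" "s2 \<in> F"
      unfolding s1_def s2_def
      by (rule subsetD[OF spB], intro qv.span_sum qv.span_scale qv.span_base, assumption)+
    ultimately have "s1 = 0" "s2 = 0" using x_indep by blast+
    then have "f b = 0" "f (b * x) = 0" if "b \<in> B" for b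
      using qv.independentD[OF B(2) finB subset_refl, of f b]
        qv.independentD[OF B(2) finB subset_refl, of "\<lambda>b. f (b * x)" b] that
      unfolding s1_def s2_def by simp_all
    then show "f y = 0" using y by blast
  qed
  have Uk: "B \<union> ?xB \<subseteq> k" using B(1) F(2) x by blast
  obtain D where D: "B \<union> ?xB \<subseteq> D" "k \<subseteq> qv.span D" "finite D" "card D = card G"
    using k_basis_exists[OF indep Uk] by metis
  have "card (B \<union> ?xB) = card G"
    using finB disj by (simp add: card_Un_disjoint card_image[OF inj] B(4) card_G F(4))
  then have "B \<union> ?xB = D" using D by (intro card_subset_eq) auto
  then have kspan: "k \<subseteq> qv.span (B \<union> ?xB)" using D by simp
  have "\<exists>a\<in>F. \<exists>b\<in>F. y = a + b * x" if y: "y \<in> k" for y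
  proof -
    have "y \<in> qv.span (B \<union> ?xB)" using y kspan by blast
    then show ?thesis
    proof (induction rule: qv.span_induct_alt)
      case base
      show ?case using Fcl(1) by (intro bexI[of _ 0]) auto
    next
      case (step q u w)
      then obtain a b where ab: "a \<in> F" "b \<in> F" "w = a + b * x" by blast
      have "\<exists>a'\<in>F. \<exists>b'\<in>F. u = a' + b' * x"
      proof (cases "u \<in> B")
        case True
        then show ?thesis using B(1) Fcl(1) by (intro bexI[of _ u] bexI[of _ 0]) auto
      next
        case False
        then obtain b' where "b' \<in> B" "u = b' * x" using step by blast
        then show ?thesis using B(1) Fcl(1) by (intro bexI[of _ 0] bexI[of _ b']) auto
      qed
      then obtain a' b' where u: "a' \<in> F" "b' \<in> F" "u = a' + b' * x" by blast
      have "qscale q u + w = (of_rat q * a' + a) + (of_rat q * b' + b) * x"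
        unfolding ab u qscale_def by (simp add: algebra_simps)
      moreover have "of_rat q * a' + a \<in> F" "of_rat q * b' + b \<in> F" using ab u rat Fcl by blast+
      ultimately show ?case by blast
    qed
  qed
  then show thesis using that[of F x] F x by blast
qed

text \<open>The generator satisfies \<open>x^2 = a0 + b0 * x\<close> over the real field
  \<open>F\<close>, so its conjugate is the other root \<open>b0 - x\<close>, which lies in
  \<open>k\<close>. Applying \<open>\<sigma>\<close> gives an equation for \<open>\<sigma> x\<close>
  that again has real coefficients, so conjugation acts on \<open>\<sigma> x\<close> by the same
  formula.\<close>

lemma cnj_k_commute:
  assumes y: "y \<in> k"
  shows "cnj y \<in> k" and "\<sigma> \<in> G \<Longrightarrow> \<sigma> (cnj y) = cnj (\<sigma> y)"
proof -
  obtain F x where F: "subfield_C F" "F \<subseteq> k" "\<And>\<sigma> a. \<sigma> \<in> G \<Longrightarrow> a \<in> F \<Longrightarrow> \<sigma> a \<in> \<real>"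
    and x: "x \<in> k" "x \<notin> \<real>" and gen: "\<And>y. y \<in> k \<Longrightarrow> \<exists>a\<in>F. \<exists>b\<in>F. y = a + b * x"
    using cm_generator by metis
  obtain a b where ab: "a \<in> F" "b \<in> F" "y = a + b * x" using gen[OF y] by blast
  obtain a0 b0 where ab0: "a0 \<in> F" "b0 \<in> F" "x\<^sup>2 = a0 + b0 * x" using gen[OF k_power[OF x(1)]] by blast
  have mem: "a \<in> k" "b \<in> k" "a0 \<in> k" "b0 \<in> k" using ab ab0 F(2) by auto
  have real: "c \<in> \<real>" if "c \<in> F" for c using F(3)[OF id_in_G that] .
  have cx: "cnj x = b0 - x"
    using real_quadratic_nonreal_root[OF ab0(3) real[OF ab0(1)] real[OF ab0(2)] x(2)] .
  have cy: "cnj y = a + b * (b0 - x)"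
    using real[OF ab(1)] real[OF ab(2)] by (simp add: ab(3) cx Reals_cnj_iff)
  then show "cnj y \<in> k" using mem x(1) by auto
  assume s: "\<sigma> \<in> G"
  \<comment> \<open>If \<open>\<sigma> x\<close> were real, so would be all of
    \<open>\<sigma>\<close> applied to \<open>k\<close>, against \<open>k\<close> being totally
    imaginary.\<close>
  have sx: "\<sigma> x \<notin> \<real>"
  proof
    assume r: "\<sigma> x \<in> \<real>"
    obtain z where z: "z \<in> k" "\<sigma> z \<notin> \<real>" using cm_nonreal[OF s] .
    obtain c d where cd: "c \<in> F" "d \<in> F" "z = c + d * x" using gen[OF z(1)] by blast
    then have "c \<in> k" "d \<in> k" using F(2) by blast+
    then have "\<sigma> z = \<sigma> c + \<sigma> d * \<sigma> x" using s x cd(3) by (simp add: aut_add aut_mult k_mult)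
    then show False using z(2) r F(3)[OF s cd(1)] F(3)[OF s cd(2)] by auto
  qed
  have "(\<sigma> x)\<^sup>2 = \<sigma> a0 + \<sigma> b0 * \<sigma> x"
    using arg_cong[OF ab0(3), of \<sigma>] s x mem by (simp add: aut_add aut_mult aut_power k_mult)
  then have csx: "cnj (\<sigma> x) = \<sigma> b0 - \<sigma> x"
    using real_quadratic_nonreal_root F(3)[OF s ab0(1)] F(3)[OF s ab0(2)] sx by blast
  have "\<sigma> (cnj y) = \<sigma> a + \<sigma> b * (\<sigma> b0 - \<sigma> x)"
    unfolding cy using s x mem by (simp add: aut_add aut_mult aut_diff k_mult k_diff)
  also have "\<dots> = cnj (\<sigma> y)"
    using F(3)[OF s ab(1)] F(3)[OF s ab(2)] s x mem
    by (simp add: ab(3) csx Reals_cnj_iff aut_add aut_mult k_mult)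
  finally show "\<sigma> (cnj y) = cnj (\<sigma> y)" .
qed

text \<open>Conjugation cut off outside \<open>k\<close>: elements of \<open>nf_auts k\<close> must
  fix every number outside \<open>k\<close>, which \<open>cnj\<close> does not do.\<close>

definition cconj :: "complex \<Rightarrow> complex" where "cconj = conj_aut k (\<lambda>x. x)"

lemma cconj_eq: "x \<in> k \<Longrightarrow> cconj x = cnj x"
  by (simp add: cconj_def conj_aut_def)

lemma cconj_in_G: "cconj \<in> G"
proof -
  have "cconj ` k = k"
  proof
    show "cconj ` k \<subseteq> k" using cnj_k_commute(1) by (auto simp: cconj_eq)
    show "k \<subseteq> cconj ` k"
    proof
      fix x assume "x \<in> k"
      then have "cconj (cnj x) = x" "cnj x \<in> k" using cnj_k_commute(1) by (auto simp: cconj_eq)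
      then show "x \<in> cconj ` k" by (metis image_eqI)
    qed
  qed
  moreover have "cconj x = x" if "x \<notin> k" for x using that by (simp add: cconj_def conj_aut_def)
  ultimately show ?thesis
    by (subst nf_auts_def) (simp add: cconj_eq k_add k_mult)
qed

lemma cconj_image: "P \<subseteq> k \<Longrightarrow> cconj ` P = cnj ` P"
  by (intro image_cong) (auto simp: cconj_eq)

lemma cnj_cnj_image: "cnj ` cnj ` P = P"
  by (simp add: image_image)

lemma aut_cnj_image: "\<sigma> \<in> G \<Longrightarrow> P \<subseteq> k \<Longrightarrow> \<sigma> ` cnj ` P = cnj ` \<sigma> ` P"
  unfolding image_image by (intro image_cong refl cnj_k_commute(2)) (rule subsetD)

lemma prime_cnj: assumes "nz_prime_ideal k P" shows "nz_prime_ideal k (cnj ` P)"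
  using prime_image[OF cconj_in_G assms] cconj_image[OF prime_k[OF assms]] by simp

lemma ord_at_cnj:
  assumes "nz_prime_ideal k P" "x \<in> k" "x \<noteq> 0"
  shows "ord_at (cnj ` P) (cnj x) = ord_at P x"
  using ord_at_image[OF cconj_in_G assms] cconj_image[OF prime_k[OF assms(1)]] cconj_eq[OF assms(2)] by simp

lemma T_primes_D:
  assumes "P \<in> T_primes k p"
  shows "nz_prime_ideal k P" "of_nat p \<in> P" "cnj ` P \<noteq> P" "P \<subseteq> k"
  using assms prime_k[of P] by (simp_all add: T_primes_def primes_above_def)

lemma aut_T_primes:
  assumes s: "\<sigma> \<in> G" and P: "P \<in> T_primes k p" shows "\<sigma> ` P \<in> T_primes k p"
proof -
  have "cnj ` \<sigma> ` P \<noteq> \<sigma> ` P"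
    unfolding aut_cnj_image[OF s T_primes_D(4)[OF P], symmetric]
    using T_primes_D(3)[OF P] inj_image_eq_iff[OF bij_is_inj[OF bij_aut[OF s]]] by simp
  then show ?thesis using P aut_primes_above[OF s] by (simp add: T_primes_def)
qed

section \<open>The group E_p in terms of orders\<close>

lemma E_p_D:
  assumes "x \<in> E_p k p"
  shows "x \<in> k" "x \<noteq> 0" "\<sigma> \<in> G \<Longrightarrow> cmod (\<sigma> x) = 1" "cmod x = 1"
    "nz_prime_ideal k P \<Longrightarrow> of_nat p \<notin> P \<Longrightarrow> ord_at P x = 0"
proof -
  show x: "x \<in> k" "x \<noteq> 0" "\<sigma> \<in> G \<Longrightarrow> cmod (\<sigma> x) = 1" using assms by (auto simp: E_p_def)
  show "cmod x = 1" using assms id_in_G by (auto simp: E_p_def)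
  show "ord_at P x = 0" if P: "nz_prime_ideal k P" "of_nat p \<notin> P"
  proof -
    have "x \<in> loc_ring k P" "inverse x \<in> loc_ring k P" using assms P by (auto simp: E_p_def)
    then have "ord_at P x \<ge> 0" "ord_at P (inverse x) \<ge> 0"
      using ord_at_nonneg_iff[OF P(1)] x k_inverse by auto
    then show ?thesis using ord_at_inverse[OF P(1) x(1,2)] by simp
  qed
qed

lemma E_p_I:
  assumes x: "x \<in> k" "x \<noteq> 0" and "\<And>\<sigma>. \<sigma> \<in> G \<Longrightarrow> cmod (\<sigma> x) = 1"
    and o: "\<And>P. nz_prime_ideal k P \<Longrightarrow> of_nat p \<notin> P \<Longrightarrow> ord_at P x = 0"
  shows "x \<in> E_p k p"
proof -
  have "x \<in> loc_ring k P \<and> inverse x \<in> loc_ring k P" if P: "nz_prime_ideal k P" "of_nat p \<notin> P" for P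
    using o[OF P] ord_at_inverse[OF P(1) x] ord_at_nonneg_iff[OF P(1) x]
      ord_at_nonneg_iff[OF P(1) k_inverse[OF x(1)]] x by simp
  then show ?thesis unfolding E_p_def using assms by blast
qed

lemma E_p_1: "1 \<in> E_p k p"
  by (rule E_p_I) (auto simp: aut_1 ord_at_1)

lemma E_p_mult: assumes "x \<in> E_p k p" "y \<in> E_p k p" shows "x * y \<in> E_p k p"
  using E_p_D[OF assms(1)] E_p_D[OF assms(2)]
  by (intro E_p_I) (simp_all add: k_mult aut_mult norm_mult ord_at_mult)

lemma E_p_inverse: assumes "x \<in> E_p k p" shows "inverse x \<in> E_p k p"
  using E_p_D[OF assms]
  by (intro E_p_I) (simp_all add: k_inverse aut_inverse norm_inverse ord_at_inverse)

lemma E_p_aut: assumes s: "\<sigma> \<in> G" and x: "x \<in> E_p k p" shows "\<sigma> x \<in> E_p k p"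
proof (rule E_p_I)
  show "\<sigma> x \<in> k" "\<sigma> x \<noteq> 0" using E_p_D(1,2)[OF x] s by (auto simp: aut_eq_0)
  show "cmod (\<tau> (\<sigma> x)) = 1" if "\<tau> \<in> G" for \<tau>
    using E_p_D(3)[OF x comp_in_G[OF that s]] by simp
  fix P assume P: "nz_prime_ideal k P" "of_nat p \<notin> P"
  then have "of_nat p \<notin> inv \<sigma> ` P"
    using mem_aut_image[OF inv_in_G[OF s]] inv_inv_eq[OF bij_aut[OF s]] aut_of_nat[OF s] by simp
  then show "ord_at P (\<sigma> x) = 0"
    using ord_at_aut[OF s P(1) E_p_D(1,2)[OF x]] E_p_D(5)[OF x prime_image[OF inv_in_G[OF s] P(1)]] by simp
qed

lemma E_p_powi: assumes "x \<in> E_p k p" shows "x powi n \<in> E_p k p"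
proof -
  have "y ^ m \<in> E_p k p" if "y \<in> E_p k p" for y m
    by (induction m) (use that E_p_1 E_p_mult in auto)
  then show ?thesis using assms E_p_inverse by (auto simp: power_int_def)
qed

lemma E_p_prod: "(\<And>i. i \<in> I \<Longrightarrow> f i \<in> E_p k p) \<Longrightarrow> (\<Prod>i\<in>I. f i) \<in> E_p k p"
  by (induction I rule: infinite_finite_induct) (auto intro: E_p_1 E_p_mult)

lemma ord_at_cnj_E_p:
  assumes P: "nz_prime_ideal k P" and x: "x \<in> E_p k p"
  shows "ord_at (cnj ` P) x = - ord_at P x"
proof -
  have "x * cnj x = 1" using E_p_D(4)[OF x] by (simp add: complex_norm_square[symmetric])
  then have "cnj x = inverse x" by (metis inverse_unique)
  then have "ord_at (cnj ` P) (inverse x) = ord_at P x" using ord_at_cnj[OF P E_p_D(1,2)[OF x]] by simp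
  then show ?thesis using ord_at_inverse[OF prime_cnj[OF P] E_p_D(1,2)[OF x]] by simp
qed

text \<open>For \<open>x = b / cnj b\<close>, every conjugate has absolute value 1 because
  conjugation commutes with the automorphisms. At \<open>P\<close> nothing cancels: the order of
  \<open>cnj b\<close> there is the order of \<open>b\<close> at \<open>cnj\<close> of
  \<open>P\<close>, a different prime.\<close>

lemma E_p_element_at_prime:
  assumes P: "P \<in> T_primes k p"
  obtains x where "x \<in> E_p k p" "ord_at P x > 0"
    "\<And>Q. nz_prime_ideal k Q \<Longrightarrow> Q \<noteq> P \<Longrightarrow> Q \<noteq> cnj ` P \<Longrightarrow> ord_at Q x = 0"
proof -
  note PD = T_primes_D[OF P]
  obtain b where b: "b \<in> \<O>" "b \<noteq> 0" "ord_at P b > 0"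
    "\<And>Q. nz_prime_ideal k Q \<Longrightarrow> Q \<noteq> P \<Longrightarrow> ord_at Q b = 0"
    using prime_power_principal[OF PD(1)] by blast
  have bk: "b \<in> k" using b(1) O_k by blast
  define x where "x = b * inverse (cnj b)"
  have cb: "cnj b \<in> k" "cnj b \<noteq> 0" using cnj_k_commute(1)[OF bk] b(2) by auto
  have x: "x \<in> k" "x \<noteq> 0" using bk cb b(2) by (auto simp: x_def)
  have ord: "ord_at Q x = ord_at Q b - ord_at (cnj ` Q) b" if Q: "nz_prime_ideal k Q" for Q
  proof -
    have "ord_at Q (cnj b) = ord_at (cnj ` Q) b"
      using ord_at_cnj[OF prime_cnj[OF Q] bk b(2)] by (simp add: cnj_cnj_image)
    then show ?thesis
      unfolding x_def using ord_at_mult[OF Q bk b(2) k_inverse[OF cb(1)]] ord_at_inverse[OF Q cb] cb by simp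
  qed
  have ordQ: "ord_at Q x = 0" if Q: "nz_prime_ideal k Q" "Q \<noteq> P" "Q \<noteq> cnj ` P" for Q
  proof -
    have "cnj ` Q \<noteq> P" using Q(3) cnj_cnj_image by metis
    then show ?thesis using ord[OF Q(1)] b(4)[OF Q(1,2)] b(4)[OF prime_cnj[OF Q(1)]] by simp
  qed
  have "ord_at P x > 0"
    using ord[OF PD(1)] b(3) b(4)[OF prime_cnj[OF PD(1)] PD(3)] by simp
  moreover have "x \<in> E_p k p"
  proof (rule E_p_I[OF x])
    fix \<sigma> assume s: "\<sigma> \<in> G"
    have "\<sigma> x = \<sigma> b * inverse (cnj (\<sigma> b))"
      using s bk cb by (simp add: x_def aut_mult aut_inverse k_inverse cnj_k_commute(2))
    moreover have "\<sigma> b \<noteq> 0" using s bk b(2) by (simp add: aut_eq_0)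
    ultimately show "cmod (\<sigma> x) = 1" by (simp add: norm_mult norm_inverse)
  next
    fix Q assume Q: "nz_prime_ideal k Q" "of_nat p \<notin> Q"
    have "of_nat p \<in> cnj ` P" using PD(2) by (metis complex_cnj_of_nat imageI)
    then show "ord_at Q x = 0" using ordQ[OF Q(1)] Q(2) PD(2) by blast
  qed
  ultimately show thesis using that ordQ by blast
qed

section \<open>Characters on the image of E_p and their pairing with the vectors eps\<close>

context
  fixes p :: nat and sig :: "'v::finite \<Rightarrow> complex \<Rightarrow> complex" and S :: "complex set set"
  assumes p: "prime p" and sig: "place_reps k sig" and S: "S \<subseteq> T_primes k p"
    and S_reps: "\<forall>P\<in>T_primes k p. P \<in> S \<longleftrightarrow> cnj ` P \<notin> S"
begin

lemma sig_G: "sig v \<in> G"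
  using sig by (auto simp: place_reps_def)

lemma finite_S: "finite S"
  using S finite_primes_above[of p] p prime_gt_0_nat
  by (metis (no_types, lifting) T_primes_def finite_subset mem_Collect_eq subsetI)

lemma alpha_inf_E_p: "x \<in> E_p k p \<Longrightarrow> alpha_inf sig x = (\<chi> v. sig v x)"
  using E_p_D(1,2)[of x p] sig_G by (simp add: alpha_inf_def aut_eq_0)

lemma char_mu_alpha:
  assumes x: "x \<in> E_p k p"
  shows "char_mu \<mu> (alpha_inf sig x) = (\<Prod>v\<in>UNIV. sig v x powi (\<mu> $ v))"
    and "char_mu \<mu> (alpha_inf sig x) \<in> E_p k p"
    and "nz_prime_ideal k P \<Longrightarrow>
      ord_at P (char_mu \<mu> (alpha_inf sig x)) = (\<Sum>v\<in>UNIV. \<mu> $ v * ord_at (inv (sig v) ` P) x)"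
proof -
  show eq: "char_mu \<mu> (alpha_inf sig x) = (\<Prod>v\<in>UNIV. sig v x powi (\<mu> $ v))"
    using x by (simp add: alpha_inf_E_p char_mu_def)
  show "char_mu \<mu> (alpha_inf sig x) \<in> E_p k p"
    unfolding eq by (rule E_p_prod, rule E_p_powi, rule E_p_aut[OF sig_G x])
  assume P: "nz_prime_ideal k P"
  have sx: "sig v x \<in> k" "sig v x \<noteq> 0" for v
    using E_p_D(1,2)[OF E_p_aut[OF sig_G x]] by auto
  have "ord_at P (\<Prod>v\<in>UNIV. sig v x powi (\<mu> $ v)) = (\<Sum>v\<in>UNIV. ord_at P (sig v x powi (\<mu> $ v)))"
    using sx by (intro ord_at_prod[OF P]) (auto simp: power_int_eq_0_iff)
  also have "\<dots> = (\<Sum>v\<in>UNIV. \<mu> $ v * ord_at (inv (sig v) ` P) x)"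
    using sx by (simp add: ord_at_powi[OF P] ord_at_aut[OF sig_G P E_p_D(1,2)[OF x]])
  finally show "ord_at P (char_mu \<mu> (alpha_inf sig x)) = (\<Sum>v\<in>UNIV. \<mu> $ v * ord_at (inv (sig v) ` P) x)"
    unfolding eq .
qed

text \<open>Moves the automorphism to the side of \<open>P'\<close>, matching \<open>eps\<close>
  with the orders at the preimages of \<open>P'\<close> that occur in
  \<open>char_mu_alpha\<close>.\<close>

lemma sig_cnj_image_iff:
  assumes "P \<in> T_primes k p" "P' \<in> T_primes k p"
  shows "sig v ` P = cnj ` P' \<longleftrightarrow> cnj ` P = inv (sig v) ` P'"
proof -
  have "sig v ` P = cnj ` P' \<longleftrightarrow> cnj ` sig v ` P = P'" using cnj_cnj_image by metis
  also have "\<dots> \<longleftrightarrow> sig v ` cnj ` P = P'" using aut_cnj_image[OF sig_G T_primes_D(4)[OF assms(1)]] by simp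
  finally show ?thesis using aut_image_eq_iff[OF sig_G] by simp
qed

lemma trivial_character_orthogonal:
  assumes triv: "\<And>x. x \<in> E_p k p \<Longrightarrow> char_mu \<mu> (alpha_inf sig x) = 1" and P: "P \<in> S" and P': "P' \<in> S"
  shows "(\<Sum>v\<in>UNIV. of_int (\<mu> $ v) * eps k sig P P' $ v) = 0"
proof -
  have T: "P \<in> T_primes k p" "P' \<in> T_primes k p" using P P' S by auto
  note PD = T_primes_D[OF T(1)] and PD' = T_primes_D[OF T(2)]
  obtain x where x: "x \<in> E_p k p" "ord_at P x > 0"
    "\<And>Q. nz_prime_ideal k Q \<Longrightarrow> Q \<noteq> P \<Longrightarrow> Q \<noteq> cnj ` P \<Longrightarrow> ord_at Q x = 0"
    using E_p_element_at_prime[OF T(1)] by blast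
  \<comment> \<open>The element \<open>x\<close> has nonzero order only at \<open>P\<close> and its
    conjugate, with opposite signs, so its order at the preimage of \<open>P'\<close> is the entry
    of \<open>eps\<close> scaled by \<open>ord_at P x\<close>.\<close>
  have e: "of_int (ord_at (inv (sig v) ` P') x) = of_int (ord_at P x) * eps k sig P P' $ v" for v
  proof -
    consider "sig v ` P = P'" | "sig v ` P \<noteq> P'" "sig v ` P = cnj ` P'"
      | "sig v ` P \<noteq> P'" "sig v ` P \<noteq> cnj ` P'" by blast
    then show ?thesis
    proof cases
      case 1
      then show ?thesis using aut_image_eq_iff[OF sig_G, of v P P'] by (simp add: eps_def)
    next
      case 2
      then have "inv (sig v) ` P' = cnj ` P" using sig_cnj_image_iff[OF T] by simp
      then show ?thesis using 2 ord_at_cnj_E_p[OF PD(1) x(1)] by (simp add: eps_def)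
    next
      case 3
      then have "inv (sig v) ` P' \<noteq> P" "inv (sig v) ` P' \<noteq> cnj ` P"
        using sig_cnj_image_iff[OF T, of v] aut_image_eq_iff[OF sig_G, of v P P'] by auto
      then show ?thesis using 3 x(3) prime_image[OF inv_in_G[OF sig_G] PD'(1)] by (simp add: eps_def)
    qed
  qed
  have "(\<Sum>v\<in>UNIV. \<mu> $ v * ord_at (inv (sig v) ` P') x) = 0"
    using char_mu_alpha(3)[OF x(1) PD'(1), of \<mu>] triv[OF x(1)] ord_at_1[OF PD'(1)] by simp
  from arg_cong[OF this, of "of_int :: int \<Rightarrow> rat"]
  have "of_int (ord_at P x) * (\<Sum>v\<in>UNIV. of_int (\<mu> $ v) * eps k sig P P' $ v) = 0"
    by (simp add: e sum_distrib_left mult.left_commute)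
  then show ?thesis using x(2) by simp
qed

lemma orthogonal_character_finite:
  assumes orth: "\<And>P P'. P \<in> S \<Longrightarrow> P' \<in> S \<Longrightarrow> (\<Sum>v\<in>UNIV. of_int (\<mu> $ v) * eps k sig P P' $ v) = 0"
  shows "finite (char_mu \<mu> ` alpha_inf sig ` E_p k p)"
proof (rule finite_subset)
  show "finite {x \<in> \<O>. \<forall>\<sigma>\<in>G. cmod (\<sigma> x) \<le> 1}" by (rule finite_bounded_O)
  have "char_mu \<mu> (alpha_inf sig x) \<in> \<O>" if x: "x \<in> E_p k p" for x
  proof -
    define y where "y = char_mu \<mu> (alpha_inf sig x)"
    have y: "y \<in> E_p k p" unfolding y_def by (rule char_mu_alpha(2)[OF x])
    have ordS: "ord_at P' y = 0" if P': "P' \<in> S" for P'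
    proof -
      have T': "P' \<in> T_primes k p" using P' S by blast
      \<comment> \<open>Exactly one of the preimage of \<open>P'\<close> and its conjugate lies in
        \<open>S\<close>. It is the only contributing summand, and the sign in \<open>eps\<close>
        turns its order into the order at the preimage.\<close>
      have e: "rat_of_int (ord_at (inv (sig v) ` P') x) = (\<Sum>P\<in>S. of_int (ord_at P x) * eps k sig P P' $ v)" for v
      proof -
        let ?Q = "inv (sig v) ` P'"
        have Q: "?Q \<in> T_primes k p" using aut_T_primes[OF inv_in_G[OF sig_G] T'] .
        have eps: "eps k sig P P' $ v = (if P = ?Q then 1 else if cnj ` P = ?Q then - 1 else 0)" if "P \<in> S" for P
          using sig_cnj_image_iff[of P P' v] aut_image_eq_iff[OF sig_G, of v P P'] that S T'
          by (auto simp: eps_def)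
        show ?thesis
        proof (cases "?Q \<in> S")
          case True
          then have "cnj ` P \<noteq> ?Q" if "P \<in> S" for P
            using S_reps Q S that cnj_cnj_image by (metis subsetD)
          then have "(\<Sum>P\<in>S. of_int (ord_at P x) * eps k sig P P' $ v)
              = (\<Sum>P\<in>S. if P = ?Q then rat_of_int (ord_at P x) else 0)"
            by (intro sum.cong) (auto simp: eps)
          then show ?thesis using True finite_S by simp
        next
          case False
          have cQ: "cnj ` ?Q \<in> S" using False S_reps Q by blast
          have "(\<Sum>P\<in>S. of_int (ord_at P x) * eps k sig P P' $ v)
              = (\<Sum>P\<in>S. if P = cnj ` ?Q then rat_of_int (- ord_at P x) else 0)"
          proof (rule sum.cong)
            fix P assume P: "P \<in> S"
            have "cnj ` P = ?Q \<longleftrightarrow> P = cnj ` ?Q" using cnj_cnj_image by metis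
            then show "of_int (ord_at P x) * eps k sig P P' $ v = (if P = cnj ` ?Q then rat_of_int (- ord_at P x) else 0)"
              using eps[OF P] P False by auto
          qed simp
          also have "\<dots> = of_int (- ord_at (cnj ` ?Q) x)" using cQ finite_S by simp
          also have "\<dots> = of_int (ord_at ?Q x)" using ord_at_cnj_E_p[OF T_primes_D(1)[OF Q] x] by simp
          finally show ?thesis by simp
        qed
      qed
      have "rat_of_int (ord_at P' y) = (\<Sum>v\<in>UNIV. of_int (\<mu> $ v) * of_int (ord_at (inv (sig v) ` P') x))"
        unfolding y_def char_mu_alpha(3)[OF x T_primes_D(1)[OF T']] by simp
      also have "\<dots> = (\<Sum>v\<in>UNIV. \<Sum>P\<in>S. of_int (ord_at P x) * (of_int (\<mu> $ v) * eps k sig P P' $ v))"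
        by (simp add: e sum_distrib_left mult.left_commute)
      also have "\<dots> = (\<Sum>P\<in>S. of_int (ord_at P x) * (\<Sum>v\<in>UNIV. of_int (\<mu> $ v) * eps k sig P P' $ v))"
        by (subst sum.swap) (simp add: sum_distrib_left)
      also have "\<dots> = 0" using orth P' by simp
      finally show ?thesis by simp
    qed
    have "ord_at P y = 0" if P: "nz_prime_ideal k P" for P
    proof (cases "of_nat p \<in> P")
      case False
      then show ?thesis using E_p_D(5)[OF y P] by blast
    next
      case True
      have cy: "ord_at (cnj ` P) y = - ord_at P y" by (rule ord_at_cnj_E_p[OF P y])
      show ?thesis
      proof (cases "cnj ` P = P")
        \<comment> \<open>A prime fixed by conjugation has order equal to its negative, hence
          0.\<close>
        case True
        then show ?thesis using cy by simp
      next
        case False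
        then have "P \<in> T_primes k p" using True P by (simp add: T_primes_def primes_above_def)
        then have "P \<in> S \<or> cnj ` P \<in> S" using S_reps by blast
        then show ?thesis using ordS cy by fastforce
      qed
    qed
    then show ?thesis using integral_if_ord_nonneg[OF E_p_D(1,2)[OF y]] by (simp add: y_def)
  qed
  then show "char_mu \<mu> ` alpha_inf sig ` E_p k p \<subseteq> {x \<in> \<O>. \<forall>\<sigma>\<in>G. cmod (\<sigma> x) \<le> 1}"
    using E_p_D(3)[OF char_mu_alpha(2)] by fastforce
qed

text \<open>With as many primes as automorphisms, the transitive action is free. Hence the images of
  \<open>P\<close> under the \<open>sig v\<close> and their conjugates are all distinct. Taking for
  \<open>P'\<close> the member of \<open>S\<close> among the image of \<open>P\<close> under
  \<open>sig v\<close> and its conjugate, the vector \<open>eps k sig P P'\<close> is nonzero only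
  at \<open>v\<close>.\<close>

lemma completely_decomposed_orthogonal:
  assumes dec: "completely_decomposed k p"
    and orth: "\<And>P P'. P \<in> S \<Longrightarrow> P' \<in> S \<Longrightarrow> (\<Sum>v\<in>UNIV. of_int (\<mu> $ v) * eps k sig P P' $ v) = 0"
  shows "\<mu> = 0"
proof -
  have card: "card (primes_above k p) = card G" using dec by (simp add: completely_decomposed_def card_G)
  have "card G > 0" using finite_G id_in_G by (auto simp: card_gt_0_iff)
  then obtain Q where Q: "Q \<in> primes_above k p" using card by (metis card.empty ex_in_conv less_irrefl)
  have "(\<lambda>\<sigma>. \<sigma> ` Q) ` G = primes_above k p"
  proof
    show "(\<lambda>\<sigma>. \<sigma> ` Q) ` G \<subseteq> primes_above k p" using aut_primes_above[OF _ Q] by blast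
    show "primes_above k p \<subseteq> (\<lambda>\<sigma>. \<sigma> ` Q) ` G"
    proof
      fix P assume "P \<in> primes_above k p"
      then obtain \<sigma> where "\<sigma> \<in> G" "\<sigma> ` Q = P" using transitive_on_primes_above[OF p Q] by metis
      then show "P \<in> (\<lambda>\<sigma>. \<sigma> ` Q) ` G" by (intro image_eqI[of _ _ \<sigma>]) simp_all
    qed
  qed
  then have inj: "inj_on (\<lambda>\<sigma>. \<sigma> ` Q) G"
    using card finite_G by (intro eq_card_imp_inj_on) auto
  have free: "\<sigma> = \<tau>" if s: "\<sigma> \<in> G" "\<tau> \<in> G" and P: "P \<in> primes_above k p" and eq: "\<sigma> ` P = \<tau> ` P" for \<sigma> \<tau> P
  proof -
    obtain \<rho> where r: "\<rho> \<in> G" "\<rho> ` Q = P" using transitive_on_primes_above[OF p Q P] .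
    have "(\<sigma> \<circ> \<rho>) ` Q = (\<tau> \<circ> \<rho>) ` Q" using eq r(2) by (simp only: image_comp[symmetric])
    then have "\<sigma> \<circ> \<rho> = \<tau> \<circ> \<rho>" using inj_onD[OF inj] comp_in_G r(1) s by blast
    then show ?thesis using surj_fun_eq[of \<rho> UNIV \<sigma> \<tau>] bij_is_surj[OF bij_aut[OF r(1)]]
      by (metis comp_apply surj_def ext)
  qed
  \<comment> \<open>By freeness, a prime fixed by conjugation would make conjugation trivial on
    \<open>k\<close>, which contains nonreal numbers.\<close>
  have cnj_ne: "cnj ` P \<noteq> P" if P: "P \<in> primes_above k p" for P
  proof
    assume "cnj ` P = P"
    moreover have "P \<subseteq> k" using P prime_k by (auto simp: primes_above_def)
    ultimately have "cconj ` P = (\<lambda>x. x) ` P" by (simp add: cconj_image)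
    then have id: "cconj = (\<lambda>x. x)" using free[OF cconj_in_G id_in_G P] by blast
    obtain x where x: "x \<in> k" "x \<notin> \<real>" using cm_nonreal[OF id_in_G] .
    then show False using cconj_eq[OF x(1)] id by (simp add: Reals_cnj_iff)
  qed
  have T: "T_primes k p = primes_above k p" using cnj_ne by (auto simp: T_primes_def)
  have "Q \<in> S \<or> cnj ` Q \<in> S" using S_reps Q T by auto
  then obtain P where P: "P \<in> S" by blast
  have PT: "P \<in> T_primes k p" using P S by blast
  have "\<mu> $ v = 0" for v
  proof -
    have vT: "sig v ` P \<in> T_primes k p" using aut_T_primes[OF sig_G PT] .
    have other: "sig w ` P \<noteq> sig v ` P \<and> sig w ` P \<noteq> cnj ` sig v ` P" if w: "w \<noteq> v" for w
    proof
      show "sig w ` P \<noteq> sig v ` P"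
        using free[OF sig_G sig_G, of P w v] PT T w sig by (auto simp: place_reps_def inj_def)
      show "sig w ` P \<noteq> cnj ` sig v ` P"
      proof
        assume "sig w ` P = cnj ` sig v ` P"
        then have "sig w ` P = (cconj \<circ> sig v) ` P"
          using cconj_image[OF T_primes_D(4)[OF vT]] by (simp only: image_comp[symmetric])
        then have "sig w = cconj \<circ> sig v"
          using free[OF sig_G comp_in_G[OF cconj_in_G sig_G]] PT T by simp
        also have "\<dots> = conj_aut k (sig v)"
          using aut_k[OF sig_G] aut_outside[OF sig_G] by (auto simp: fun_eq_iff cconj_def conj_aut_def)
        finally show False using sig by (simp add: place_reps_def)
      qed
    qed
    obtain P' where P': "P' \<in> S" "P' = sig v ` P \<or> P' = cnj ` sig v ` P" using S_reps vT by blast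
    have e: "eps k sig P P' $ w = (if w = v then eps k sig P P' $ v else 0)" for w
    proof (cases "w = v")
      case False
      have "cnj ` P' = sig v ` P \<or> cnj ` P' = cnj ` sig v ` P" using P'(2) cnj_cnj_image by metis
      then have "sig w ` P \<noteq> P'" "sig w ` P \<noteq> cnj ` P'" using other[OF False] P'(2) by metis+
      then show ?thesis using False by (simp add: eps_def)
    qed simp
    have "(\<Sum>w\<in>UNIV. of_int (\<mu> $ w) * eps k sig P P' $ w) = of_int (\<mu> $ v) * eps k sig P P' $ v"
      by (subst e) (simp add: if_distrib cong: if_cong)
    then have "of_int (\<mu> $ v) * eps k sig P P' $ v = 0" using orth[OF P P'(1)] by simp
    moreover have "sig v ` P = P' \<or> sig v ` P = cnj ` P'" using P'(2) cnj_cnj_image by metis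
    then have "eps k sig P P' $ v \<noteq> 0" unfolding eps_def by (elim disjE) simp_all
    ultimately show ?thesis by simp
  qed
  then show ?thesis by (simp add: vec_eq_iff)
qed

lemma alpha_inf_image_subgroup:
  "alpha_inf sig ` E_p k p \<subseteq> torus"
  "1 \<in> alpha_inf sig ` E_p k p"
  "x \<in> alpha_inf sig ` E_p k p \<Longrightarrow> y \<in> alpha_inf sig ` E_p k p \<Longrightarrow> x * y \<in> alpha_inf sig ` E_p k p"
  "x \<in> alpha_inf sig ` E_p k p \<Longrightarrow> \<exists>y\<in>alpha_inf sig ` E_p k p. x * y = 1"
proof -
  show "alpha_inf sig ` E_p k p \<subseteq> torus"
    using E_p_D(3)[OF _ sig_G] by (auto simp: alpha_inf_E_p torus_def)
  have one: "alpha_inf sig 1 = 1"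
    using alpha_inf_E_p[OF E_p_1] aut_1[OF sig_G] by (simp add: vec_eq_iff)
  then show "1 \<in> alpha_inf sig ` E_p k p" using E_p_1 by (metis image_eqI)
  have mult: "alpha_inf sig (a * b) = alpha_inf sig a * alpha_inf sig b" if "a \<in> E_p k p" "b \<in> E_p k p" for a b
    using alpha_inf_E_p[OF E_p_mult[OF that]] alpha_inf_E_p[OF that(1)] alpha_inf_E_p[OF that(2)]
      aut_mult[OF sig_G E_p_D(1)[OF that(1)] E_p_D(1)[OF that(2)]] by (simp add: vec_eq_iff)
  show "x * y \<in> alpha_inf sig ` E_p k p" if xy: "x \<in> alpha_inf sig ` E_p k p" "y \<in> alpha_inf sig ` E_p k p"
  proof -
    obtain a b where ab: "a \<in> E_p k p" "x = alpha_inf sig a" "b \<in> E_p k p" "y = alpha_inf sig b"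
      using xy by blast
    then show ?thesis using mult[OF ab(1,3)] by (intro image_eqI[OF _ E_p_mult[OF ab(1,3)]]) simp
  qed
  show "\<exists>y\<in>alpha_inf sig ` E_p k p. x * y = 1" if x: "x \<in> alpha_inf sig ` E_p k p"
  proof -
    obtain a where a: "a \<in> E_p k p" "x = alpha_inf sig a" using x by blast
    have "x * alpha_inf sig (inverse a) = 1"
      using mult[OF a(1) E_p_inverse[OF a(1)]] one a E_p_D(2)[OF a(1)] by simp
    then show ?thesis using E_p_inverse[OF a(1)] by blast
  qed
qed

end

end

theorem theorem4p1:
  fixes k :: "complex set" and p :: nat and sig :: "'v::finite \<Rightarrow> (complex \<Rightarrow> complex)"
    and S :: "complex set set"
  assumes "CM_galois k" and "prime p" and "place_reps k sig"
    and "S \<subseteq> T_primes k p"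
    and "\<forall>P\<in>T_primes k p. (P \<in> S \<longleftrightarrow> cnj ` P \<notin> S)"
  defines "H \<equiv> closure (alpha_inf sig ` E_p k p)"
  shows "{\<mu>. \<forall>t\<in>connected_component_set H (\<chi> v. 1). char_mu \<mu> t = 1}
           = {\<mu>. \<forall>P\<in>S. \<forall>P'\<in>S. (\<Sum>v\<in>UNIV. of_int (\<mu> $ v) * (eps k sig P P' $ v)) = (0::rat)}
       \<and> lie_dim H = rat_span_dim {eps k sig P P' | P P'. P \<in> S \<and> P' \<in> S}
       \<and> (completely_decomposed k p \<longrightarrow> H = torus)"
proof -
  interpret cm_field k using assms(1) by unfold_locales
  let ?A = "alpha_inf sig ` E_p k p"
  let ?E = "{eps k sig P P' | P P'. P \<in> S \<and> P' \<in> S}"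
  note ctx = assms(2-5)
  note sub = alpha_inf_image_subgroup[OF ctx]
  have orth: "(\<Sum>v\<in>UNIV. of_int (\<mu> $ v) * e $ v) = 0"
    if "\<And>x. x \<in> ?A \<Longrightarrow> char_mu \<mu> x = 1" "e \<in> ?E" for \<mu> e
    using that trivial_character_orthogonal[OF ctx] by blast
  have fin: "finite (char_mu \<mu> ` ?A)"
    if "\<And>e. e \<in> ?E \<Longrightarrow> (\<Sum>v\<in>UNIV. of_int (\<mu> $ v) * e $ v) = 0" for \<mu>
    using that by (intro orthogonal_character_finite[OF ctx]) blast
  note main = closure_subgroup_of_torus[of ?A ?E, OF sub orth fin]
  have one: "(\<chi> v. 1) = (1 :: complex ^ 'v)" by (simp add: vec_eq_iff)
  have "{\<mu>. \<forall>t\<in>connected_component_set H (\<chi> v. 1). char_mu \<mu> t = 1}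
       = {\<mu>. \<forall>e\<in>?E. (\<Sum>v\<in>UNIV. of_int (\<mu> $ v) * e $ v) = 0}"
    unfolding H_def one by (rule main(1))
  also have "\<dots> = {\<mu>. \<forall>P\<in>S. \<forall>P'\<in>S. (\<Sum>v\<in>UNIV. of_int (\<mu> $ v) * (eps k sig P P' $ v)) = (0::rat)}"
    by blast
  moreover have "H = torus" if "completely_decomposed k p"
    unfolding H_def
  proof (rule main(3))
    fix \<mu> assume orth: "\<And>e. e \<in> ?E \<Longrightarrow> (\<Sum>v\<in>UNIV. of_int (\<mu> $ v) * e $ v) = 0"
    show "\<mu> = 0" by (rule completely_decomposed_orthogonal[OF ctx that], rule orth, blast)
  qed
  ultimately show ?thesis using main(2) unfolding H_def by blast
qed

end
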